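(* Let $\boldsymbol Z\in\mathbb{R}_+^d$ be a random vector such that for all $i=1,\ldots,d$ we have $\boldsymbol Z\in\mathcal{MRV}(\alpha_i,b_i,\mu_i,\mathbb{E}_d^{(i)})$, where $b_i$ is the canonical choice of the scaling function, and assume that $b_i(t)/b_{i+1}(t)\to\infty$ as $t\to\infty$ for all $i=1,\ldots,d-1$. Let $\boldsymbol A\in\mathbb{R}_+^{q\times d}$ be a random matrix, independent of $\boldsymbol Z$, which almost surely has no trivial (i.e. zero) row. Let $k\in\{1,\ldots,q\}$ and suppose that for all $i=1,\ldots,d$: (i) $\mathbf E_i^{(k)}\big[\tau_{q,d}^{(k,i)}(\boldsymbol A)^{\alpha_i+\delta}\big]<\infty$ for some $\delta=\delta(i,k)>0$; (ii) $\mu_i\big(\widetilde{\mathbb{CA}}_d^{(i)}(j)\big)>0$ for all $j=1,\ldots,\binom di$. Let $C\subset\mathbb{E}_q^{(k)}$ be a Borel set bounded away from $\mathbb{CA}_q^{(k-1)}$ with $\mathbf E_i^{(k)}[\mu_i(\partial\boldsymbol A^{-1}(C))]=0$ for all $i=1,\ldots,d$. Then: (a) As $t\to\infty$, $$\mathbf P(\boldsymbol A\boldsymbol Z\in tC)=\sum_{i=1}^d\mathbf P(Z^{(i)}>t)\,\Big[\mathbf E_i^{(k)}[\mu_i(\boldsymbol A^{-1}(C))]+o(1)\Big].$$ (b) Define $i_k^*=\min\{i\in\{1,\ldots,d\}:\mathbf P(\Omega_i^{(k)})>0\}$. Then, as $t\to\infty$, $$\frac{\mathbf P(\boldsymbol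 A\boldsymbol Z\in tC)}{\mathbf P(Z^{(i_k^* )}>t)}\to\mathbf E_{i_k^*}^{(k)}\big[\mu_{i_k^*}(\boldsymbol A^{-1}(C))\big]=:\overline\mu_k(C),$$ and the convergence $\mathbf P(\boldsymbol A\boldsymbol Z\in t\,\cdot\,)/\mathbf P(Z^{(i_k^* )}>t)\to\overline\mu_k(\cdot)$ holds in $\mathbb{M}(\mathbb{E}_q^{(k)})$. Hence $\boldsymbol A\boldsymbol Z\in\mathcal{MRV}(\alpha_{i_k^*},\overline\mu_k,\mathbb{E}_q^{(k)})$.
   Context: Let $d,q\ge1$ be integers and $\mathbb{R}_+=[0,\infty)$. All random elements live on one probability space $(\Omega,\mathcal F,\mathbf P)$. For $\boldsymbol v\in\mathbb{R}_+^d$, $v^{(1)}\ge\cdots\ge v^{(d)}$ denote its components in decreasing order; $Z^{(i)}$ is the $i$-th largest component of $\boldsymbol Z$. Distances are with respect to the sup-norm; a set $\Lambda$ is bounded away from $C_0$ if $\inf\{\|\boldsymbol x-\boldsymbol y\|_\infty:\boldsymbol x\in\Lambda,\boldsymbol y\in C_0\}>0$. Subcones. $\mathbb{CA}_d^{(0)}=\{\boldsymbol 0\}$ and $\mathbb{CA}_d^{(i)}=\{\boldsymbol v\in\mathbb{R}_+^d:v^{(i+1)}=0\}$ for $1\le i\le d-1$; $\mathbb{E}_d^{(i)}=\mathbb{R}_+^d\setminus\mathbb{CA}_d^{(i-1)}=\{\boldsymbol v\in\mathbb{R}_+^d:v^{(i)}>0\}$ for $1\le i\le d$; analogously with $q$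 in place of $d$. For $1\le i\le d$, the sets $\widetilde{\mathbb{CA}}_d^{(i)}(j)$, $j=1,\ldots,\binom di$, are an enumeration of the sets $\{\boldsymbol v\in\mathbb{R}_+^d: v_l>0\text{ for }l\in J,\ v_l=0\text{ for }l\notin J\}$, where $J$ runs over the $i$-element subsets of $\{1,\ldots,d\}$. Convergence. $\mathbb{M}(\mathbb{E}_d^{(i)})$ is the class of Borel measures on $\mathbb{E}_d^{(i)}$ that are finite on Borel sets bounded away from $\mathbb{CA}_d^{(i-1)}$. Measures $\mu_t\to\mu$ in $\mathbb{M}(\mathbb{E}_d^{(i)})$ as $t\to\infty$ if $\int f\,d\mu_t\to\int f\,d\mu$ for every bounded continuous real-valued $f$ on $\mathbb{E}_d^{(i)}$ whose support is bounded away from $\mathbb{CA}_d^{(i-1)}$. Regular variation. A function $f:\mathbb{R}_+\to\mathbb{R}_+$ is in $\mathcal{RV}_\beta$ if $f(tx)/f(t)\to x^\beta$ as $t\to\infty$ for all $x>0$. A random vector $\boldsymbol V\in\mathbb{R}_+^d$ satisfies $\boldsymbol V\in\mathcal{MRV}(\alpha,b,\mu,\mathbb{E}_d^{(i)})$, with $\alpha>0$, $b\in\mathcal{RV}_{1/\alpha}$ and $\mu\in\mathbb{M}(\mathbb{E}_d^{(i)})$ non-null, if $t\,\mathbf P(\boldsymbol V/b(t)\in\cdot)\to\mu(\cdot)$ in $\mathbb{M}(\mathbb{E}_d^{(i)})$ as $t\to\infty$. One writes $\boldsymbol V\in\mathcal{MRV}(\alpha,\mu,\mathbb{E}_d^{(i)})$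 if this holds for some $b\in\mathcal{RV}_{1/\alpha}$. The canonical choice of the scaling function is $b_i(t)=F_{V^{(i)}}^{\leftarrow}(1-1/t)$, where $F_{V^{(i)}}$ is the distribution function of $V^{(i)}$ and $F^{\leftarrow}(s)=\inf\{x\in\mathbb{R}:F(x)\ge s\}$. The functions $\tau$ and pre-images. For a deterministic matrix $\boldsymbol B\in\mathbb{R}_+^{q\times d}$, $$\tau_{q,d}^{(k,i)}(\boldsymbol B)=\sup_{\boldsymbol z\in\mathbb{E}_d^{(i)}}\frac{(\boldsymbol B\boldsymbol z)^{(k)}}{z^{(i)}}\in[0,\infty],\qquad \boldsymbol B^{-1}(C)=\{\boldsymbol z\in\mathbb{R}_+^d:\boldsymbol B\boldsymbol z\in C\}.$$ $\partial$ denotes topological boundary. Partition of $\Omega$. With $\boldsymbol A_\omega=\boldsymbol A(\omega)$, let $i_k(\boldsymbol A_\omega)=\max\{j\in\{1,\ldots,d\}:\tau_{q,d}^{(k,j)}(\boldsymbol A_\omega)<\infty\}$ (this set always contains $1$), $\Omega_i^{(k)}=\{\omega\in\Omega:i_k(\boldsymbol A_\omega)=i\}$, and $\mathbf E_i^{(k)}[\cdot]=\mathbf E[\,\cdot\,\mathbf 1_{\Omega_i^{(k)}}]$, where $\mathbf E$ is expectation under $\mathbf P$. *)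

theory Defs
  imports "HOL-Probability.Probability"
begin

section \<open>Order statistics and subcones of the nonnegative orthant\<close>

definition orthant :: "(real ^ 'n) set" where
  "orthant = {v. \<forall>l. 0 \<le> v $ l}"

text \<open>The \<open>i\<close>-th largest component, counted with multiplicity, for \<open>1 \<le> i \<le> CARD('n)\<close>.
  Outside this range the value is unspecified and never used.\<close>

definition ord_stat :: "nat \<Rightarrow> real ^ 'n \<Rightarrow> real" where
  "ord_stat i v = rev (sorted_list_of_multiset (image_mset (\<lambda>l. v $ l) (mset_set UNIV))) ! (i - 1)"

definition CA :: "nat \<Rightarrow> (real ^ 'n) set" where
  "CA i = (if i = 0 then {0} else {v \<in> orthant. ord_stat (i + 1) v = 0})"

definition EE :: "nat \<Rightarrow> (real ^ 'n) set" where
  "EE i = orthant - CA (i - 1)"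

text \<open>The faces \<open>face J\<close> with \<open>card J = i\<close> are the sets that are enumerated as
  \<open>j = 1, \<dots>, (d choose i)\<close> in the informal notation.\<close>

definition face :: "'n set \<Rightarrow> (real ^ 'n) set" where
  "face J = {v \<in> orthant. (\<forall>l\<in>J. 0 < v $ l) \<and> (\<forall>l. l \<notin> J \<longrightarrow> v $ l = 0)}"

text \<open>The distance is that of the sup-norm. The infimum is taken in the extended reals, so that
  the infimum over the empty set is \<open>\<infinity>\<close>.\<close>

definition bounded_away :: "(real ^ 'n) set \<Rightarrow> (real ^ 'n) set \<Rightarrow> bool" where
  "bounded_away L C0 \<longleftrightarrow> 0 < (INF x\<in>L. INF y\<in>C0. ereal (infnorm (x - y)))"

section \<open>Convergence of measures on subcones\<close>

definition MM :: "nat \<Rightarrow> (real ^ 'n) measure set" where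
  "MM i = {\<mu>. sets \<mu> = sets (restrict_space borel (EE i)) \<and>
              (\<forall>B\<in>sets \<mu>. bounded_away B (CA (i - 1)) \<longrightarrow> emeasure \<mu> B < \<infinity>)}"

definition MM_test :: "nat \<Rightarrow> (real ^ 'n \<Rightarrow> real) set" where
  "MM_test i = {f. continuous_on (EE i) f \<and> bounded (f ` EE i) \<and>
                   bounded_away (EE i \<inter> closure {x \<in> EE i. f x \<noteq> 0}) (CA (i - 1))}"

definition MM_conv :: "nat \<Rightarrow> (real \<Rightarrow> (real ^ 'n) measure) \<Rightarrow> (real ^ 'n) measure \<Rightarrow> bool" where
  "MM_conv i \<mu>s \<mu> \<longleftrightarrow> (\<forall>\<^sub>F t in at_top. \<mu>s t \<in> MM i) \<and> \<mu> \<in> MM i \<and>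
     (\<forall>f\<in>MM_test i. ((\<lambda>t. \<integral>x. f x \<partial>\<mu>s t) \<longlongrightarrow> (\<integral>x. f x \<partial>\<mu>)) at_top)"

text \<open>The measure \<open>c * P(V / s \<in> \<cdot>)\<close>, i.e. \<open>c * P(V \<in> s \<cdot>)\<close>, on the Borel subsets of \<open>EE i\<close>.\<close>

definition scaled_law ::
  "'w measure \<Rightarrow> ('w \<Rightarrow> real ^ 'n) \<Rightarrow> nat \<Rightarrow> real \<Rightarrow> real \<Rightarrow> (real ^ 'n) measure" where
  "scaled_law M V i c s =
     scale_measure (ennreal c) (restrict_space (distr M borel (\<lambda>\<omega>. V \<omega> /\<^sub>R s)) (EE i))"

section \<open>Regular variation\<close>

definition RV :: "real \<Rightarrow> (real \<Rightarrow> real) set" where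
  "RV \<beta> = {f. (\<forall>t\<ge>0. 0 \<le> f t) \<and> (\<forall>x>0. ((\<lambda>t. f (t * x) / f t) \<longlongrightarrow> x powr \<beta>) at_top)}"

definition MRV_scal ::
  "'w measure \<Rightarrow> ('w \<Rightarrow> real ^ 'n) \<Rightarrow> real \<Rightarrow> (real \<Rightarrow> real) \<Rightarrow> (real ^ 'n) measure \<Rightarrow> nat \<Rightarrow> bool" where
  "MRV_scal M V \<alpha> b \<mu> i \<longleftrightarrow>
     V \<in> borel_measurable M \<and> (\<forall>\<omega>\<in>space M. V \<omega> \<in> orthant) \<and>
     0 < \<alpha> \<and> b \<in> RV (1 / \<alpha>) \<and> \<mu> \<in> MM i \<and> emeasure \<mu> (EE i) \<noteq> 0 \<and>
     MM_conv i (\<lambda>t. scaled_law M V i t (b t)) \<mu>"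

definition MRV ::
  "'w measure \<Rightarrow> ('w \<Rightarrow> real ^ 'n) \<Rightarrow> real \<Rightarrow> (real ^ 'n) measure \<Rightarrow> nat \<Rightarrow> bool" where
  "MRV M V \<alpha> \<mu> i \<longleftrightarrow> (\<exists>b. MRV_scal M V \<alpha> b \<mu> i)"

definition gen_inverse :: "(real \<Rightarrow> real) \<Rightarrow> real \<Rightarrow> ereal" where
  "gen_inverse F s = Inf (ereal ` {x. s \<le> F x})"

text \<open>For \<open>V\<close> in the orthant and \<open>t > 1\<close> the generalised inverse at \<open>1 - 1 / t\<close> is finite and
  nonnegative. For \<open>0 < t \<le> 1\<close> it is \<open>-\<infinity>\<close>, which
  \<^const>\<open>real_of_ereal\<close> maps to \<open>0\<close>, so that the scaling function maps \<open>[0, \<infinity>)\<close> to itself.\<close>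

definition canon_scal :: "'w measure \<Rightarrow> ('w \<Rightarrow> real ^ 'n) \<Rightarrow> nat \<Rightarrow> real \<Rightarrow> real" where
  "canon_scal M V i t =
     real_of_ereal (gen_inverse (cdf (distr M borel (\<lambda>\<omega>. ord_stat i (V \<omega>)))) (1 - 1 / t))"

section \<open>Matrices acting on subcones\<close>

definition tau :: "nat \<Rightarrow> nat \<Rightarrow> real ^ 'd ^ 'q \<Rightarrow> ennreal" where
  "tau k i B = (SUP z\<in>EE i. ennreal (ord_stat k (B *v z) / ord_stat i z))"

definition preimg :: "real ^ 'd ^ 'q \<Rightarrow> (real ^ 'q) set \<Rightarrow> (real ^ 'd) set" where
  "preimg B C = {z \<in> orthant. B *v z \<in> C}"

text \<open>The topological boundary is taken in the state space \<open>[0, \<infinity>)\<^sup>d\<close>; the boundary in the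
  whole vector space would contain every point of a set that lies on a coordinate hyperplane.\<close>

definition bdry :: "(real ^ 'd) set \<Rightarrow> (real ^ 'd) set" where
  "bdry S = top_of_set orthant frontier_of S"

definition ik :: "nat \<Rightarrow> real ^ 'd ^ 'q \<Rightarrow> nat" where
  "ik k B = Max {j \<in> {1..CARD('d)}. tau k j B < \<infinity>}"

definition Omega :: "'w measure \<Rightarrow> ('w \<Rightarrow> real ^ 'd ^ 'q) \<Rightarrow> nat \<Rightarrow> nat \<Rightarrow> 'w set" where
  "Omega M A k i = {\<omega> \<in> space M. ik k (A \<omega>) = i}"

text \<open>The integrand is only relevant on \<open>Omega M A k i\<close>. There \<open>tau k i (A \<omega>)\<close> is finite, so that
  powers of it may be taken in the reals.\<close>

definition Eik ::
  "'w measure \<Rightarrow> ('w \<Rightarrow> real ^ 'd ^ 'q) \<Rightarrow> nat \<Rightarrow> nat \<Rightarrow> ('w \<Rightarrow> ennreal) \<Rightarrow> ennreal" where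
  "Eik M A k i X = (\<integral>\<^sup>+\<omega>. X \<omega> * indicator (Omega M A k i) \<omega> \<partial>M)"

definition istar :: "'w measure \<Rightarrow> ('w \<Rightarrow> real ^ 'd ^ 'q) \<Rightarrow> nat \<Rightarrow> nat" where
  "istar M A k = Min {i \<in> {1..CARD('d)}. 0 < measure M (Omega M A k i)}"

definition mu_bar ::
  "'w measure \<Rightarrow> ('w \<Rightarrow> real ^ 'd ^ 'q) \<Rightarrow> (nat \<Rightarrow> (real ^ 'd) measure) \<Rightarrow> nat \<Rightarrow> (real ^ 'q) measure"
  where
  "mu_bar M A \<mu> k = measure_of (EE k) (sets (restrict_space borel (EE k)))
     (\<lambda>B. Eik M A k (istar M A k) (\<lambda>\<omega>. emeasure (\<mu> (istar M A k)) (preimg (A \<omega>) B)))"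

text \<open>Independence of two random elements whose types may differ, as independence of the
  generated \<open>\<sigma>\<close>-algebras.\<close>

definition indep_elements ::
  "'w measure \<Rightarrow> ('w \<Rightarrow> 'a::topological_space) \<Rightarrow> ('w \<Rightarrow> 'b::topological_space) \<Rightarrow> bool" where
  "indep_elements M X Y \<longleftrightarrow> prob_space.indep_set M
     {X -` S \<inter> space M | S. S \<in> sets borel} {Y -` S \<inter> space M | S. S \<in> sets borel}"

end

theory Submission
  imports Defs
begin

text \<open>On the event where \<open>ik k A = i\<close>, the \<open>k\<close>-th largest component of \<open>A Z\<close> is at most
  \<open>tau k i A\<close> times the \<open>i\<close>-th largest component of \<open>Z\<close>. So, given \<open>A\<close>, the preimage of \<open>C\<close> is
  bounded away from \<open>CA (i - 1)\<close>, and the portmanteau theorem gives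
  \<open>P(A Z \<in> s C | A) / P(ord_stat i Z > s) \<rightarrow> \<mu> i (preimg A C)\<close> whenever the boundary is a null set.
  Independence, a Potter bound and the moment condition allow integrating this over \<open>A\<close> by dominated
  convergence. Summing over \<open>i\<close> gives the expansion. The first term with positive probability
  dominates, since \<open>b i / b (i + 1) \<rightarrow> \<infinity>\<close> makes the tail of \<open>ord_stat (i + 1) Z\<close> negligible against
  that of \<open>ord_stat i Z\<close>.\<close>

section \<open>Order statistics and subcones\<close>

text \<open>The sup-norm distance from \<open>CA (i - 1)\<close> is the \<open>i\<close>-th largest
  component itself, so being bounded away means lying in a superlevel set
  \<open>tail i \<epsilon>\<close>. The hypotheses control the law of \<open>Z\<close> only along
  the scales \<open>b t\<close>, and \<open>b\<close> may jump, while the conclusion is normalised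
  by the tail of an order statistic at every scale. The quantile property of the canonical
  \<open>b\<close> bridges this gap: it forces the limit mass of \<open>tail i x\<close> to be
  exactly \<open>x powr - \<alpha>\<close>, with constant 1, and it places \<open>s\<close> within
  any factor \<open>r > 1\<close> of \<open>b (1 / U s)\<close> for large \<open>s\<close>. Upper
  bounds for closed sets then pass to all scales by a radial fattening; lower bounds come from
  complements inside a tail, whose mass converges exactly. The moment exponent \<alpha> + \<delta>
  is what a Potter bound at the radius \<open>\<epsilon> / (tau + 1)\<close> consumes. A sufficient
  condition for finite \<open>tau\<close> counts nonzero entries; its failure just above the largest
  finite index provides a face inside the preimage of \<open>EE k\<close>, which makes the limit
  measure nonzero.\<close>

lemma sorted_nth_rev_ge_iff:
  fixes xs :: "'a::linorder list"
  assumes "sorted xs" "1 \<le> i" "i \<le> length xs" and mono: "\<And>x y. P x \<Longrightarrow> x \<le> y \<Longrightarrow> P y"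
  shows "P (rev xs ! (i - 1)) \<longleftrightarrow> i \<le> length (filter P xs)"
proof -
  have *: "rev xs ! (i - 1) = xs ! (length xs - i)"
    using assms by (simp add: rev_nth)
  let ?n = "length xs"
  have card: "length (filter P xs) = card {j. j < ?n \<and> P (xs ! j)}"
    by (rule length_filter_conv_card)
  show ?thesis
  proof
    assume "P (rev xs ! (i - 1))"
    then have "{?n - i..<?n} \<subseteq> {j. j < ?n \<and> P (xs ! j)}"
      using * mono sorted_nth_mono[OF assms(1)] by fastforce
    from card_mono[OF _ this] show "i \<le> length (filter P xs)"
      using assms card by simp
  next
    assume i: "i \<le> length (filter P xs)"
    show "P (rev xs ! (i - 1))"
    proof (rule ccontr)
      assume n: "\<not> P (rev xs ! (i - 1))"
      have "{j. j < ?n \<and> P (xs ! j)} \<subseteq> {?n - i<..<?n}"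
      proof
        fix j assume j: "j \<in> {j. j < ?n \<and> P (xs ! j)}"
        have "\<not> j \<le> ?n - i"
          using n * mono sorted_nth_mono[OF assms(1), of j "?n - i"] j assms by auto
        then show "j \<in> {?n - i<..<?n}" using j by auto
      qed
      from card_mono[OF _ this] show False using i card assms by auto
    qed
  qed
qed

text \<open>Entries satisfying an upward closed predicate form a final segment of the sorted list,
  so counting them decides the \<open>i\<close>-th largest one. Keeping \<open>P\<close> abstract
  serves both \<open>\<le>\<close> and \<open><\<close>, and no later proof has to look at the list
  again.\<close>

lemma ord_stat_iff:
  fixes v :: "real ^ 'n"
  assumes "i \<in> {1..CARD('n)}" and mono: "\<And>x y. P x \<Longrightarrow> x \<le> y \<Longrightarrow> P y"
  shows "P (ord_stat i v) \<longleftrightarrow> i \<le> card {l. P (v $ l)}"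
proof -
  define X where "X = image_mset (\<lambda>l. v $ l) (mset_set UNIV)"
  define xs where "xs = sorted_list_of_multiset X"
  have m: "mset xs = X" by (simp add: xs_def)
  have "length xs = size X" using m size_mset by metis
  then have len: "length xs = CARD('n)" by (simp add: X_def)
  have "length (filter P xs) = size (filter_mset P (mset xs))" by (simp flip: mset_filter)
  also have "\<dots> = size (filter_mset (\<lambda>l. P (v $ l)) (mset_set UNIV))"
    by (simp only: m X_def filter_mset_image_mset o_def size_image_mset)
  also have "\<dots> = card {l. P (v $ l)}" by simp
  finally have c: "length (filter P xs) = card {l. P (v $ l)}" .
  have "sorted xs" by (simp add: xs_def)
  from sorted_nth_rev_ge_iff[OF this, of i P] mono c len assms(1) show ?thesis
    by (simp add: ord_stat_def xs_def X_def)
qed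

lemma le_ord_stat_iff:
  fixes v :: "real ^ 'n"
  assumes "i \<in> {1..CARD('n)}"
  shows "x \<le> ord_stat i v \<longleftrightarrow> i \<le> card {l. x \<le> v $ l}"
  using ord_stat_iff[OF assms, of "\<lambda>y. x \<le> y" v] by auto

lemma less_ord_stat_iff:
  fixes v :: "real ^ 'n"
  assumes "i \<in> {1..CARD('n)}"
  shows "x < ord_stat i v \<longleftrightarrow> i \<le> card {l. x < v $ l}"
  using ord_stat_iff[OF assms, of "\<lambda>y. x < y" v] by auto

text \<open>The \<open>i\<close> components of \<open>v\<close> that reach
  \<open>ord_stat i v\<close> are still large in \<open>w\<close>. The shift \<open>c\<close> yields
  monotonicity for \<open>c = 0\<close> and the Lipschitz bound for \<open>c\<close> a
  distance.\<close>

lemma ord_stat_mono_vec: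
  fixes v w :: "real ^ 'n"
  assumes i: "i \<in> {1..CARD('n)}" and "\<And>l. v $ l - c \<le> w $ l"
  shows "ord_stat i v - c \<le> ord_stat i w"
proof -
  have "i \<le> card {l. ord_stat i v \<le> v $ l}"
    using le_ord_stat_iff[OF i, of "ord_stat i v" v] by simp
  also have "\<dots> \<le> card {l. ord_stat i v - c \<le> w $ l}"
    by (rule card_mono) (auto intro: order_trans[OF _ assms(2)])
  finally show ?thesis by (simp add: le_ord_stat_iff[OF i])
qed

lemma ord_stat_infnorm:
  fixes v w :: "real ^ 'n"
  assumes i: "i \<in> {1..CARD('n)}"
  shows "\<bar>ord_stat i v - ord_stat i w\<bar> \<le> infnorm (v - w)"
proof -
  have c: "\<bar>v $ l - w $ l\<bar> \<le> infnorm (v - w)" for l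
    using component_le_infnorm_cart[of "v - w" l] by simp
  have "ord_stat i v - infnorm (v - w) \<le> ord_stat i w"
    by (rule ord_stat_mono_vec[OF i]) (use c in \<open>smt (verit)\<close>)
  moreover have "ord_stat i w - infnorm (v - w) \<le> ord_stat i v"
    by (rule ord_stat_mono_vec[OF i]) (use c in \<open>smt (verit)\<close>)
  ultimately show ?thesis by linarith
qed

lemma ord_stat_norm:
  fixes v w :: "real ^ 'n"
  assumes "i \<in> {1..CARD('n)}"
  shows "\<bar>ord_stat i v - ord_stat i w\<bar> \<le> norm (v - w)"
  using ord_stat_infnorm[OF assms, of v w] infnorm_le_norm[of "v - w"] by linarith

lemma continuous_on_ord_stat [continuous_intros]:
  assumes "i \<in> {1..CARD('n)}" "continuous_on S f"
  shows "continuous_on S (\<lambda>x. ord_stat i (f x :: real ^ 'n))"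
proof -
  have "continuous_on UNIV (ord_stat i :: real ^ 'n \<Rightarrow> real)"
    by (rule continuous_onI[of _ _])
       (auto simp: dist_norm intro!: exI order_le_less_trans[OF ord_stat_norm[OF assms(1)]] less_imp_le)
  from continuous_on_compose2[OF this assms(2)] show ?thesis by simp
qed

lemma borel_measurable_ord_stat [measurable (raw)]:
  assumes "i \<in> {1..CARD('n)}" "f \<in> borel_measurable M"
  shows "(\<lambda>x. ord_stat i (f x :: real ^ 'n)) \<in> borel_measurable M"
  using measurable_compose[OF assms(2) borel_measurable_continuous_onI[OF continuous_on_ord_stat[OF assms(1) continuous_on_id]]]
  by simp

lemma ord_stat_scaleR:
  fixes v :: "real ^ 'n"
  assumes i: "i \<in> {1..CARD('n)}" and "0 < c"
  shows "ord_stat i (c *\<^sub>R v) = c * ord_stat i v"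
proof (rule antisym)
  show "c * ord_stat i v \<le> ord_stat i (c *\<^sub>R v)"
    using le_ord_stat_iff[OF i, of "ord_stat i v" v] assms by (simp add: le_ord_stat_iff[OF i])
  have "ord_stat i (c *\<^sub>R v) / c \<le> ord_stat i v"
    using le_ord_stat_iff[OF i, of "ord_stat i (c *\<^sub>R v)" "c *\<^sub>R v"] assms
    by (simp add: le_ord_stat_iff[OF i] divide_le_eq mult.commute)
  then show "ord_stat i (c *\<^sub>R v) \<le> c * ord_stat i v"
    using assms by (simp add: divide_le_eq mult.commute)
qed

lemma orthant_iff: "v \<in> orthant \<longleftrightarrow> (\<forall>l. 0 \<le> v $ l)"
  by (simp add: orthant_def)

lemma ord_stat_nonneg:
  fixes v :: "real ^ 'n"
  assumes i: "i \<in> {1..CARD('n)}" and "v \<in> orthant"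
  shows "0 \<le> ord_stat i v"
  using assms by (simp add: le_ord_stat_iff[OF i] orthant_iff)

lemma ord_stat_zero:
  assumes i: "i \<in> {1..CARD('n)}"
  shows "ord_stat i (0 :: real ^ 'n) = 0"
proof -
  have "0 \<le> ord_stat i (0 :: real ^ 'n)" "\<not> 0 < ord_stat i (0 :: real ^ 'n)"
    using assms by (simp_all add: le_ord_stat_iff[OF i] less_ord_stat_iff[OF i])
  then show ?thesis by simp
qed

lemma component_le_ord_stat_1: "v $ l \<le> ord_stat 1 (v :: real ^ 'n)"
proof -
  have "{l'. v $ l \<le> v $ l'} \<noteq> {}" by auto
  then have "0 < card {l'. v $ l \<le> v $ l'}" by (simp only: card_gt_0_iff) simp
  moreover have "1 \<in> {1..CARD('n)}" by (simp add: Suc_le_eq)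
  ultimately show ?thesis by (simp add: le_ord_stat_iff Suc_le_eq)
qed

lemma closed_orthant: "closed (orthant :: (real ^ 'n) set)"
  unfolding orthant_def by (intro closed_Collect_all closed_Collect_le continuous_intros)

lemma orthant_borel [measurable]: "orthant \<in> sets (borel :: (real ^ 'n) measure)"
  using closed_orthant by (rule borel_closed)

lemma orthant_scaleR: "v \<in> orthant \<Longrightarrow> 0 \<le> c \<Longrightarrow> c *\<^sub>R v \<in> orthant"
  by (simp add: orthant_iff)

text \<open>The definition treats the subcone {0} separately. In the orthant a vanishing largest
  component already forces the zero vector, so one formula covers every index.\<close>

lemma CA_eq:
  assumes i: "i \<in> {1..CARD('n)}"
  shows "CA (i - 1) = {v \<in> orthant. ord_stat i (v :: real ^ 'n) = 0}"
proof (cases "i = 1")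
  case True
  have "v = 0" if "v \<in> orthant" "ord_stat i v = 0" for v :: "real ^ 'n"
    using that component_le_ord_stat_1[of v] True by (auto simp: vec_eq_iff orthant_iff intro: antisym)
  then show ?thesis using True ord_stat_zero[OF i] by (auto simp: CA_def orthant_iff)
next
  case False
  then show ?thesis using i by (simp add: CA_def)
qed

lemma EE_eq:
  assumes i: "i \<in> {1..CARD('n)}"
  shows "EE i = {v \<in> orthant. 0 < ord_stat i (v :: real ^ 'n)}"
  unfolding EE_def CA_eq[OF i] using ord_stat_nonneg[OF i] by (auto simp: less_le)

lemma EE_borel [measurable]:
  assumes i: "i \<in> {1..CARD('n)}"
  shows "EE i \<in> sets (borel :: (real ^ 'n) measure)"
proof -
  note [measurable] = borel_measurable_ord_stat[OF i measurable_ident_sets[OF refl]]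
  show ?thesis unfolding EE_eq[OF i] by measurable
qed

section \<open>Superlevel sets of an order statistic and the distance from a subcone\<close>

definition tail :: "nat \<Rightarrow> real \<Rightarrow> (real ^ 'n) set" where
  "tail i \<epsilon> = {v \<in> orthant. \<epsilon> \<le> ord_stat i v}"

lemma closed_tail: "i \<in> {1..CARD('n)} \<Longrightarrow> closed (tail i \<epsilon> :: (real ^ 'n) set)"
  unfolding tail_def
  by (intro closed_Collect_conj closed_Collect_le continuous_intros) (auto simp: closed_orthant)

lemma tail_borel [measurable]:
  "i \<in> {1..CARD('n)} \<Longrightarrow> tail i \<epsilon> \<in> sets (borel :: (real ^ 'n) measure)"
  by (rule borel_closed[OF closed_tail])

lemma tail_subset_EE: "i \<in> {1..CARD('n)} \<Longrightarrow> 0 < \<epsilon> \<Longrightarrow> tail i \<epsilon> \<subseteq> (EE i :: (real ^ 'n) set)"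
  by (auto simp: tail_def EE_eq)

text \<open>The sup-norm distance of \<open>v\<close> from the subcone is exactly the \<open>i\<close>-th largest component.\<close>

lemma infnorm_CA_attained:
  fixes v :: "real ^ 'n"
  assumes i: "i \<in> {1..CARD('n)}" and v: "v \<in> orthant"
  shows "\<exists>y\<in>CA (i - 1). infnorm (v - y) \<le> ord_stat i v"
proof
  \<comment> \<open>Fewer than \<open>i\<close> components exceed the \<open>i\<close>-th largest
    one, so erasing all the others lands in the subcone and moves no component by more than
    \<open>ord_stat i v\<close>.\<close>
  define y :: "real ^ 'n" where "y = (\<chi> l. if v $ l \<le> ord_stat i v then 0 else v $ l)"
  have "\<not> i \<le> card {l. ord_stat i v < v $ l}" using less_ord_stat_iff[OF i, of "ord_stat i v" v] by simp
  moreover have "{l. 0 < y $ l} \<subseteq> {l. ord_stat i v < v $ l}" by (auto simp: y_def split: if_splits)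
  then have "card {l. 0 < y $ l} \<le> card {l. ord_stat i v < v $ l}" by (intro card_mono) auto
  ultimately have "\<not> 0 < ord_stat i y" by (simp add: less_ord_stat_iff[OF i])
  moreover have "y \<in> orthant" using v by (auto simp: y_def orthant_iff)
  ultimately show "y \<in> CA (i - 1)" unfolding CA_eq[OF i] using ord_stat_nonneg[OF i, of y] by auto
  show "infnorm (v - y) \<le> ord_stat i v"
    unfolding infnorm_cart
  proof (rule cSup_least)
    fix x assume "x \<in> {\<bar>(v - y) $ l\<bar> |l. l \<in> UNIV}"
    then show "x \<le> ord_stat i v" using v ord_stat_nonneg[OF i v] by (auto simp: y_def orthant_iff)
  qed auto
qed

text \<open>From left to right the nearest point of the subcone realises the order statistic as a
  distance; from right to left order statistics are 1-Lipschitz. From here on distances are replaced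
  by closed sets \<open>tail i \<epsilon>\<close>.\<close>

lemma bounded_away_iff:
  fixes L :: "(real ^ 'n) set"
  assumes i: "i \<in> {1..CARD('n)}" and L: "L \<subseteq> orthant"
  shows "bounded_away L (CA (i - 1)) \<longleftrightarrow> (\<exists>\<epsilon>>0. L \<subseteq> tail i \<epsilon>)"
proof
  assume "bounded_away L (CA (i - 1))"
  then have "0 < (INF x\<in>L. INF y\<in>CA (i - 1). ereal (infnorm (x - y)))" by (simp add: bounded_away_def)
  then obtain e where e: "0 < ereal e" "ereal e < (INF x\<in>L. INF y\<in>CA (i - 1). ereal (infnorm (x - y)))"
    using ereal_dense2 by blast
  have "L \<subseteq> tail i e"
  proof
    fix x assume x: "x \<in> L"
    obtain y where y: "y \<in> CA (i - 1)" "infnorm (x - y) \<le> ord_stat i x"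
      using infnorm_CA_attained[OF i] L x by blast
    have "ereal e \<le> ereal (infnorm (x - y))"
      using less_imp_le[OF e(2)] x y(1) by (auto simp: le_INF_iff)
    then show "x \<in> tail i e" using y L x by (auto simp: tail_def)
  qed
  then show "\<exists>\<epsilon>>0. L \<subseteq> tail i \<epsilon>" using e by auto
next
  assume "\<exists>\<epsilon>>0. L \<subseteq> tail i \<epsilon>"
  then obtain e where e: "0 < e" "L \<subseteq> tail i e" by auto
  have "ereal e \<le> (INF x\<in>L. INF y\<in>CA (i - 1). ereal (infnorm (x - y)))"
  proof (intro INF_greatest)
    fix x y :: "real ^ 'n" assume "x \<in> L" and y: "y \<in> CA (i - 1)"
    from y have "ord_stat i y = 0" unfolding CA_eq[OF i] by simp
    with \<open>x \<in> L\<close> have "e \<le> ord_stat i x" "ord_stat i y = 0" using e by (auto simp: tail_def)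
    with ord_stat_infnorm[OF i, of x y] show "ereal e \<le> ereal (infnorm (x - y))" by simp
  qed
  moreover have "0 < ereal e" using e by simp
  ultimately show "bounded_away L (CA (i - 1))"
    unfolding bounded_away_def by (rule less_le_trans[rotated])
qed

section \<open>The functions tau and the index of a matrix\<close>

lemma mult_vec_orthant:
  fixes B :: "real ^ 'd ^ 'q"
  assumes "\<And>r c. 0 \<le> B $ r $ c" "z \<in> orthant"
  shows "B *v z \<in> orthant"
  using assms by (auto simp: orthant_iff matrix_vector_mult_def intro!: sum_nonneg)

lemma mult_vec_mono:
  fixes B :: "real ^ 'd ^ 'q"
  assumes "\<And>r c. 0 \<le> B $ r $ c" "\<And>l. z $ l \<le> w $ l"
  shows "(B *v z) $ r \<le> (B *v w) $ r"
  using assms by (auto simp: matrix_vector_mult_def intro!: sum_mono mult_left_mono)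

lemma continuous_on_matrix_vector_mult [continuous_intros]:
  fixes f :: "'x::topological_space \<Rightarrow> real ^ 'd ^ 'q"
  assumes "continuous_on S f" "continuous_on S g"
  shows "continuous_on S (\<lambda>x. f x *v g x)"
  unfolding matrix_vector_mult_def by (intro continuous_intros assms)

lemma borel_measurable_matrix_vector_mult [measurable (raw)]:
  fixes f :: "'x \<Rightarrow> real ^ 'd ^ 'q"
  assumes [measurable]: "f \<in> borel_measurable M" "g \<in> borel_measurable M"
  shows "(\<lambda>x. f x *v g x) \<in> borel_measurable M"
  by (rule borel_measurable_continuous_Pair[OF assms]) (intro continuous_intros continuous_on_fst continuous_on_snd)

text \<open>The supremum defining \<open>tau\<close> ranges over \<open>EE i\<close> only. Points
  with \<open>ord_stat i z = 0\<close> are reached by a perturbation into \<open>EE i\<close>, so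
  that the inequality also shows that such points are sent to vectors whose \<open>k\<close>-th
  largest component vanishes.\<close>

lemma ord_stat_mult_le_tau:
  fixes B :: "real ^ 'd ^ 'q"
  assumes k: "k \<in> {1..CARD('q)}" and i: "i \<in> {1..CARD('d)}"
    and B: "\<And>r c. 0 \<le> B $ r $ c" and fin: "tau k i B < \<infinity>" and z: "z \<in> orthant"
  shows "ord_stat k (B *v z) \<le> enn2real (tau k i B) * ord_stat i z"
proof -
  define \<tau> where "\<tau> = enn2real (tau k i B)"
  have \<tau>: "tau k i B = ennreal \<tau>" "0 \<le> \<tau>" using fin by (auto simp: \<tau>_def)
  have bound: "ord_stat k (B *v w) \<le> \<tau> * ord_stat i w" if w: "w \<in> EE i" for w
  proof -
    have pos: "0 < ord_stat i w" using w by (simp add: EE_eq[OF i])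
    have "ennreal (ord_stat k (B *v w) / ord_stat i w) \<le> tau k i B"
      unfolding tau_def using w by (rule SUP_upper)
    then have "ord_stat k (B *v w) / ord_stat i w \<le> \<tau>" using \<tau> by (simp add: ennreal_le_iff)
    then show ?thesis using pos by (simp add: divide_le_eq)
  qed
  \<comment> \<open>Raising every component by \<open>e\<close> raises the order statistic by
    exactly \<open>e\<close>, makes it positive, and can only increase the image under a nonnegative
    matrix.\<close>
  let ?one = "(\<chi> l. 1) :: real ^ 'd"
  have "ord_stat k (B *v z) \<le> \<tau> * (ord_stat i z + e)" if e: "0 < e" for e
  proof -
    let ?w = "z + e *\<^sub>R ?one"
    have up: "ord_stat i z + e \<le> ord_stat i ?w"
      using ord_stat_mono_vec[OF i, of z "- e" ?w] by simp
    have dn: "ord_stat i ?w - e \<le> ord_stat i z"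
      by (rule ord_stat_mono_vec[OF i]) simp
    have "0 < ord_stat i ?w" using up e ord_stat_nonneg[OF i z] by linarith
    moreover have "?w \<in> orthant" using z e by (simp add: orthant_iff add_nonneg_nonneg)
    ultimately have "?w \<in> EE i" by (simp add: EE_eq[OF i])
    have "ord_stat k (B *v z) - 0 \<le> ord_stat k (B *v ?w)"
      using e by (intro ord_stat_mono_vec[OF k]) (auto intro!: mult_vec_mono B)
    also have "\<dots> \<le> \<tau> * ord_stat i ?w" by (rule bound) fact
    also have "\<dots> \<le> \<tau> * (ord_stat i z + e)" using dn \<tau> by (intro mult_left_mono) auto
    finally show ?thesis by simp
  qed
  then have *: "ord_stat k (B *v z) \<le> \<tau> * ord_stat i z + \<tau> * e" if "0 < e" for e
    using that by (simp add: distrib_left)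
  have "ord_stat k (B *v z) \<le> \<tau> * ord_stat i z"
  proof (rule field_le_epsilon)
    fix e :: real assume "0 < e"
    \<comment> \<open>Since \<open>\<tau>\<close> may be 0, the perturbation is scaled by
      \<open>\<tau> + 1\<close>.\<close>
    have "\<tau> * (e / (\<tau> + 1)) \<le> e" using \<open>0 < e\<close> \<tau> by (simp add: field_simps)
    with *[of "e / (\<tau> + 1)"] \<open>0 < e\<close> \<tau> show "ord_stat k (B *v z) \<le> \<tau> * ord_stat i z + e"
      by (simp add: add_nonneg_pos)
  qed
  then show ?thesis by (simp add: \<tau>_def)
qed

text \<open>At most \<open>i - 1\<close> components of \<open>z\<close> exceed
  \<open>ord_stat i z\<close>, and only these can be disproportionately large. A row with zeros in
  those columns is controlled by \<open>ord_stat i z\<close> times its row sum; if fewer than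
  \<open>k\<close> rows escape this control, the \<open>k\<close>-th largest image component is
  controlled too.\<close>

lemma tau_finiteI:
  fixes B :: "real ^ 'd ^ 'q"
  assumes k: "k \<in> {1..CARD('q)}" and i: "i \<in> {1..CARD('d)}" and B: "\<And>r c. 0 \<le> B $ r $ c"
    and few: "\<And>J. card J = i - 1 \<Longrightarrow> card {r. \<exists>c\<in>J. B $ r $ c \<noteq> 0} < k"
  shows "tau k i B < \<infinity>"
proof -
  define b where "b = (\<Sum>r\<in>UNIV. \<Sum>c\<in>UNIV. B $ r $ c)"
  have b: "(\<Sum>c\<in>UNIV. B $ r $ c) \<le> b" for r
    unfolding b_def by (rule member_le_sum) (auto intro: sum_nonneg B)
  have "ord_stat k (B *v z) / ord_stat i z \<le> b" if z: "z \<in> EE i" for z :: "real ^ 'd"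
  proof -
    let ?m = "ord_stat i z"
    have pos: "0 < ?m" and zo: "\<And>l. 0 \<le> z $ l" using z by (auto simp: EE_eq[OF i] orthant_iff)
    have "\<not> i \<le> card {l. ?m < z $ l}" using less_ord_stat_iff[OF i, of ?m z] by simp
    then have "card {l. ?m < z $ l} \<le> i - 1" "i - 1 \<le> card (UNIV :: 'd set)" using i by auto
    \<comment> \<open>The set of large components may be smaller than \<open>i - 1\<close>, whereas
      the hypothesis speaks of exactly \<open>i - 1\<close> columns; hence the enlargement.\<close>
    then obtain J where J: "{l. ?m < z $ l} \<subseteq> J" "card J = i - 1"
      using exists_subset_between[of "{l. ?m < z $ l}" "i - 1" UNIV] by auto
    have "ord_stat k (B *v z) \<le> b * ?m"
    proof (rule ccontr)
      assume "\<not> ?thesis"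
      then have "k \<le> card {r. b * ?m < (B *v z) $ r}" by (simp add: less_ord_stat_iff[OF k] not_le)
      also have "\<dots> \<le> card {r. \<exists>c\<in>J. B $ r $ c \<noteq> 0}"
      proof (intro card_mono subsetI; clarsimp)
        fix r assume r: "b * ?m < (B *v z) $ r"
        show "\<exists>c\<in>J. B $ r $ c \<noteq> 0"
        proof (rule ccontr)
          assume n: "\<not> ?thesis"
          have "(B *v z) $ r = (\<Sum>c\<in>UNIV. B $ r $ c * z $ c)" by (simp add: matrix_vector_mult_def)
          also have "\<dots> \<le> (\<Sum>c\<in>UNIV. B $ r $ c * ?m)"
          proof (rule sum_mono)
            fix c show "B $ r $ c * z $ c \<le> B $ r $ c * ?m"
              
            proof (cases "c \<in> J")
              case True
              then show ?thesis using n by auto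
            next
              case False
              then have "z $ c \<le> ?m" using J(1) by (meson mem_Collect_eq not_less subsetD)
              then show ?thesis by (rule mult_left_mono) (rule B)
            qed
          qed
          also have "\<dots> = (\<Sum>c\<in>UNIV. B $ r $ c) * ?m" by (simp add: sum_distrib_right)
          also have "\<dots> \<le> b * ?m" using b pos by (intro mult_right_mono) auto
          finally show False using r by simp
        qed
      qed
      finally show False using few[OF J(2)] by simp
    qed
    then show ?thesis using pos by (simp add: divide_le_eq)
  qed
  then have "tau k i B \<le> ennreal b" unfolding tau_def by (intro SUP_least ennreal_leI)
  then show ?thesis using le_less_trans by fastforce
qed

lemma tau_1_finite:
  fixes B :: "real ^ 'd ^ 'q"
  assumes "k \<in> {1..CARD('q)}" "\<And>r c. 0 \<le> B $ r $ c"
  shows "tau k 1 B < \<infinity>"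
  using assms by (intro tau_finiteI) (auto simp: Suc_le_eq card_eq_0_iff)

lemma ik_properties:
  fixes B :: "real ^ 'd ^ 'q"
  assumes "k \<in> {1..CARD('q)}" "\<And>r c. 0 \<le> B $ r $ c"
  shows "ik k B \<in> {1..CARD('d)}" "tau k (ik k B) B < \<infinity>"
    "\<And>j. j \<in> {ik k B<..CARD('d)} \<Longrightarrow> tau k j B = \<infinity>"
proof -
  let ?S = "{j \<in> {1..CARD('d)}. tau k j B < \<infinity>}"
  have "1 \<in> ?S" using tau_1_finite[OF assms] by (simp add: Suc_le_eq)
  then have "?S \<noteq> {}" by blast
  then have "Max ?S \<in> ?S" by (intro Max_in) auto
  then show "ik k B \<in> {1..CARD('d)}" "tau k (ik k B) B < \<infinity>" by (auto simp: ik_def)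
  fix j assume j: "j \<in> {ik k B<..CARD('d)}"
  show "tau k j B = \<infinity>"
  proof (rule ccontr)
    assume "tau k j B \<noteq> \<infinity>"
    then have "j \<in> ?S" using j by (auto simp: less_top)
    then have "j \<le> Max ?S" by (intro Max_ge) auto
    then show False using j by (simp add: ik_def)
  qed
qed

text \<open>This is where maximality of \<open>ik k B\<close> is used: it supplies as many columns
  as the index, jointly meeting at least \<open>k\<close> rows. A vector positive exactly on these
  columns has at least \<open>k\<close> positive image components. Positive mass of the faces
  thereby becomes positive mass of the limit.\<close>

lemma face_subset_preimg:
  fixes B :: "real ^ 'd ^ 'q"
  assumes k: "k \<in> {1..CARD('q)}" and B: "\<And>r c. 0 \<le> B $ r $ c" and rows: "\<And>r. row r B \<noteq> 0"
  shows "\<exists>J. card J = ik k B \<and> face J \<subseteq> preimg B (EE k)"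
proof -
  let ?i = "ik k B"
  have "\<exists>J. card J = ?i \<and> k \<le> card {r. \<exists>c\<in>J. B $ r $ c \<noteq> 0}"
  \<comment> \<open>At the top index there is no larger \<open>tau\<close> to be infinite; all
    columns are taken, and the absence of zero rows makes every row count.\<close>
  proof (cases "?i = CARD('d)")
    case True
    have "\<exists>c. B $ r $ c \<noteq> 0" for r using rows[of r] by (auto simp: row_def vec_eq_iff)
    then have "k \<le> card {r. \<exists>c\<in>UNIV. B $ r $ c \<noteq> 0}" using k by simp
    then show ?thesis using True by (intro exI[of _ UNIV]) simp
  next
    case False
    then have "?i + 1 \<in> {?i<..CARD('d)}" using ik_properties(1)[OF k B] by auto
    then have "\<not> tau k (?i + 1) B < \<infinity>" using ik_properties(3)[OF k B] by simp
    moreover have "?i + 1 \<in> {1..CARD('d)}" using \<open>?i + 1 \<in> _\<close> by auto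
    ultimately have "\<not> (\<forall>J. card J = ?i + 1 - 1 \<longrightarrow> card {r. \<exists>c\<in>J. B $ r $ c \<noteq> 0} < k)"
      using tau_finiteI[OF k _ B, of "?i + 1"] by blast
    then show ?thesis by (simp add: not_less)
  qed
  then obtain J where J: "card J = ?i" "k \<le> card {r. \<exists>c\<in>J. B $ r $ c \<noteq> 0}" by auto
  have "face J \<subseteq> preimg B (EE k)"
  proof
    fix z :: "real ^ 'd" assume z: "z \<in> face J"
    then have zo: "z \<in> orthant" by (simp add: face_def)
    have pos: "0 < (B *v z) $ r" if "c \<in> J" "B $ r $ c \<noteq> 0" for r c
    proof -
      have "0 < B $ r $ c * z $ c" using that z B[of r c] by (auto simp: face_def less_le)
      also have "\<dots> \<le> (\<Sum>c\<in>UNIV. B $ r $ c * z $ c)"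
        using zo B by (intro member_le_sum) (auto simp: orthant_iff)
      finally show ?thesis by (simp add: matrix_vector_mult_def)
    qed
    have "card {r. \<exists>c\<in>J. B $ r $ c \<noteq> 0} \<le> card {r. 0 < (B *v z) $ r}"
      by (rule card_mono) (auto intro: pos)
    with J(2) have "0 < ord_stat k (B *v z)" by (simp add: less_ord_stat_iff[OF k])
    with zo mult_vec_orthant[OF B zo] show "z \<in> preimg B (EE k)"
      by (simp add: preimg_def EE_eq[OF k])
  qed
  with J show ?thesis by blast
qed

text \<open>A bound on \<open>ord_stat k (B *v z)\<close> from below becomes one on
  \<open>ord_stat i z\<close>. The \<open>+ 1\<close> keeps the radius meaningful when
  \<open>tau\<close> is 0; this radius recurs in the dominating function.\<close>

lemma preimg_tail_subset:
  fixes B :: "real ^ 'd ^ 'q"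
  assumes k: "k \<in> {1..CARD('q)}" and i: "i \<in> {1..CARD('d)}"
    and B: "\<And>r c. 0 \<le> B $ r $ c" and fin: "tau k i B < \<infinity>" and \<epsilon>: "0 < \<epsilon>"
  shows "preimg B (tail k \<epsilon>) \<subseteq> tail i (\<epsilon> / (enn2real (tau k i B) + 1))"
proof
  fix z assume z: "z \<in> preimg B (tail k \<epsilon>)"
  let ?\<tau> = "enn2real (tau k i B)"
  have zo: "z \<in> orthant" and e: "\<epsilon> \<le> ord_stat k (B *v z)" using z by (auto simp: preimg_def tail_def)
  have "\<epsilon> \<le> ?\<tau> * ord_stat i z" using e ord_stat_mult_le_tau[OF k i B fin zo] by linarith
  also have "\<dots> \<le> (?\<tau> + 1) * ord_stat i z"
    using ord_stat_nonneg[OF i zo] by (simp add: distrib_right)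
  finally have "\<epsilon> / (?\<tau> + 1) \<le> ord_stat i z"
    by (simp add: divide_le_eq add_nonneg_pos mult.commute)
  then show "z \<in> tail i (\<epsilon> / (?\<tau> + 1))" using zo by (simp add: tail_def)
qed

lemma preimg_EE_subset:
  fixes B :: "real ^ 'd ^ 'q"
  assumes k: "k \<in> {1..CARD('q)}" and i: "i \<in> {1..CARD('d)}"
    and B: "\<And>r c. 0 \<le> B $ r $ c" and fin: "tau k i B < \<infinity>"
  shows "preimg B (EE k) \<subseteq> EE i"
proof
  fix z assume z: "z \<in> preimg B (EE k)"
  then have zo: "z \<in> orthant" and e: "0 < ord_stat k (B *v z)" by (auto simp: preimg_def EE_eq[OF k])
  have "0 < enn2real (tau k i B) * ord_stat i z" using e ord_stat_mult_le_tau[OF k i B fin zo] by linarith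
  then show "z \<in> EE i" using zo ord_stat_nonneg[OF i zo] by (auto simp: EE_eq[OF i] zero_less_mult_iff)
qed

text \<open>As a supremum of functions that are continuous in the matrix, \<open>tau\<close> is lower
  semicontinuous, which makes the uncountable supremum measurable.\<close>

lemma borel_measurable_tau [measurable]:
  assumes k: "k \<in> {1..CARD('q)}"
  shows "(tau k i :: real ^ 'd ^ 'q \<Rightarrow> ennreal) \<in> borel_measurable borel"
proof (rule borel_measurableI_greater)
  fix y :: ennreal
  have "open {B :: real ^ 'd ^ 'q. y < ennreal (ord_stat k (B *v z) / ord_stat i z)}" for z
    unfolding divide_inverse
    by (intro open_Collect_less continuous_on_ennreal continuous_intros k)
  then have "open {B :: real ^ 'd ^ 'q. y < tau k i B}"
    unfolding tau_def less_SUP_iff Collect_bex_eq by (intro open_UN ballI)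
  then show "{B :: real ^ 'd ^ 'q \<in> space borel. y < tau k i B} \<in> sets borel" by simp
qed

lemma sets_ik [measurable]:
  assumes k: "k \<in> {1..CARD('q)}"
  shows "{B :: real ^ 'd ^ 'q. ik k B = i} \<in> sets borel"
proof -
  have eq: "{B. ik k B = i} = (\<Union>S\<in>{S \<in> Pow {1..CARD('d)}. Max S = i}.
     \<Inter>j\<in>{1..CARD('d)}. {B :: real ^ 'd ^ 'q. (tau k j B < \<infinity>) = (j \<in> S)})" (is "?L = ?R")
  proof (intro set_eqI iffI)
    fix B :: "real ^ 'd ^ 'q" assume "B \<in> ?L"
    then show "B \<in> ?R"
      by (intro UN_I[of "{j \<in> {1..CARD('d)}. tau k j B < \<infinity>}"]) (auto simp: ik_def)
  next
    fix B :: "real ^ 'd ^ 'q" assume "B \<in> ?R"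
    then obtain S where S: "S \<subseteq> {1..CARD('d)}" "Max S = i" "\<forall>j\<in>{1..CARD('d)}. (tau k j B < \<infinity>) = (j \<in> S)"
      by auto
    then have "{j \<in> {1..CARD('d)}. tau k j B < \<infinity>} = S" by auto
    then show "B \<in> ?L" using S by (simp add: ik_def)
  qed
  have m: "{B :: real ^ 'd ^ 'q. (tau k j B < \<infinity>) = (j \<in> S)} \<in> sets borel" for j S
  proof -
    note [measurable] = borel_measurable_tau[OF k]
    show ?thesis by measurable
  qed
  show ?thesis unfolding eq
  proof (rule sets.finite_UN)
    fix S
    show "(\<Inter>j\<in>{1..CARD('d)}. {B :: real ^ 'd ^ 'q. (tau k j B < \<infinity>) = (j \<in> S)}) \<in> sets borel"
      by (rule sets.finite_INT) (use m in \<open>auto simp: Suc_le_eq\<close>)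
  qed simp
qed

section \<open>Regular variation along the canonical scaling\<close>

lemma scale_measure_eq_density: "scale_measure r N = density N (\<lambda>_. r)"
  by (rule measure_eqI) (simp_all add: emeasure_density nn_integral_cmult_indicator)

lemma space_scaled_law:
  assumes i: "i \<in> {1..CARD('n)}"
  shows "space (scaled_law M (V :: _ \<Rightarrow> real ^ 'n) i c s) = EE i"
  by (simp add: scaled_law_def space_scale_measure space_restrict_space)

lemma sets_scaled_law:
  "sets (scaled_law M (V :: _ \<Rightarrow> real ^ 'n) i c s) = sets (restrict_space borel (EE i))"
  by (simp add: scaled_law_def cong: sets_restrict_space_cong)

lemma scaled_law_in_MM:
  fixes V :: "'w \<Rightarrow> real ^ 'n"
  assumes i: "i \<in> {1..CARD('n)}" and "prob_space M" and V [measurable]: "V \<in> borel_measurable M"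
  shows "scaled_law M V i c s \<in> MM i"
proof -
  interpret prob_space M by fact
  let ?D = "distr M borel (\<lambda>\<omega>. V \<omega> /\<^sub>R s)"
  interpret D: prob_space ?D by (rule prob_space_distr) measurable
  have "emeasure (scaled_law M V i c s) B < \<infinity>" if B: "B \<in> sets (scaled_law M V i c s)" for B
  proof -
    have "B \<subseteq> EE i" using sets.sets_into_space[OF B] by (simp add: space_scaled_law[OF i])
    then have "emeasure (restrict_space ?D (EE i)) B = emeasure ?D B"
      using EE_borel[OF i] by (subst emeasure_restrict_space) auto
    also have "\<dots> < \<infinity>" using D.emeasure_finite[of B] by (simp add: less_top[symmetric])
    finally show ?thesis by (simp add: scaled_law_def ennreal_mult_less_top)
  qed
  then show ?thesis by (auto simp: MM_def sets_scaled_law)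
qed

lemma integral_scaled_law:
  fixes V :: "'w \<Rightarrow> real ^ 'n" and f :: "real ^ 'n \<Rightarrow> real"
  assumes i: "i \<in> {1..CARD('n)}" and V [measurable]: "V \<in> borel_measurable M"
    and c: "0 \<le> c" and f: "f \<in> borel_measurable (restrict_space borel (EE i))"
  shows "(\<integral>x. f x \<partial>scaled_law M V i c s) = c * (\<integral>\<omega>. indicator (EE i) (V \<omega> /\<^sub>R s) * f (V \<omega> /\<^sub>R s) \<partial>M)"
proof -
  let ?D = "distr M borel (\<lambda>\<omega>. V \<omega> /\<^sub>R s)"
  note [measurable] = EE_borel[OF i]
  have f': "(\<lambda>x. indicator (EE i) x *\<^sub>R f x) \<in> borel_measurable borel"
    using f by (subst (asm) borel_measurable_restrict_space_iff) auto
  have "f \<in> borel_measurable (restrict_space ?D (EE i))"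
    using f by (simp cong: measurable_cong_sets sets_restrict_space_cong)
  then have "(\<integral>x. f x \<partial>scaled_law M V i c s) = (\<integral>x. c *\<^sub>R f x \<partial>restrict_space ?D (EE i))"
    unfolding scaled_law_def scale_measure_eq_density using c by (subst integral_density) auto
  also have "\<dots> = c * (\<integral>x. f x \<partial>restrict_space ?D (EE i))" by simp
  also have "(\<integral>x. f x \<partial>restrict_space ?D (EE i)) = (\<integral>x. indicator (EE i) x *\<^sub>R f x \<partial>?D)"
    by (subst integral_restrict_space) auto
  also have "\<dots> = (\<integral>\<omega>. indicator (EE i) (V \<omega> /\<^sub>R s) *\<^sub>R f (V \<omega> /\<^sub>R s) \<partial>M)"
    by (subst integral_distr) (use f' in auto)
  finally show ?thesis by simp
qed

lemma MM_test_measurable: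
  fixes f :: "real ^ 'n \<Rightarrow> real"
  assumes "f \<in> MM_test i"
  shows "f \<in> borel_measurable (restrict_space borel (EE i))"
  using assms by (auto simp: MM_test_def intro: borel_measurable_continuous_on_restrict)

text \<open>The closure in the support condition disappears because tails are closed: the support
  lies in a tail as soon as the points with nonzero value do.\<close>

lemma MM_test_iff:
  fixes f :: "real ^ 'n \<Rightarrow> real"
  assumes i: "i \<in> {1..CARD('n)}"
  shows "f \<in> MM_test i \<longleftrightarrow> continuous_on (EE i) f \<and> (\<exists>K. \<forall>x\<in>EE i. \<bar>f x\<bar> \<le> K) \<and>
    (\<exists>\<epsilon>>0. \<forall>x\<in>EE i. f x \<noteq> 0 \<longrightarrow> x \<in> tail i \<epsilon>)"
proof -
  have sub: "EE i \<inter> closure {x \<in> EE i. f x \<noteq> 0} \<subseteq> orthant" by (auto simp: EE_def)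
  have "EE i \<inter> closure {x \<in> EE i. f x \<noteq> 0} \<subseteq> tail i \<epsilon> \<longleftrightarrow> (\<forall>x\<in>EE i. f x \<noteq> 0 \<longrightarrow> x \<in> tail i \<epsilon>)" for \<epsilon>
    using closure_minimal[OF _ closed_tail[OF i], of "{x \<in> EE i. f x \<noteq> 0}" \<epsilon>]
      closure_subset[of "{x \<in> EE i. f x \<noteq> 0}"] by auto
  then show ?thesis
    using bounded_away_iff[OF i sub] unfolding MM_test_def bounded_iff mem_Collect_eq
    by (simp only: real_norm_def) auto
qed

section \<open>One index: the limit measure and convergence along the canonical scaling\<close>

locale mrv_vector = prob_space M for M :: "'w measure" +
  fixes Z :: "'w \<Rightarrow> real ^ 'd" and i :: nat and \<alpha> :: real and \<mu> :: "(real ^ 'd) measure"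
  assumes i: "i \<in> {1..CARD('d)}"
    and mrv: "MRV_scal M Z \<alpha> (canon_scal M Z i) \<mu> i"
begin

abbreviation b :: "real \<Rightarrow> real" where "b \<equiv> canon_scal M Z i"

definition U :: "real \<Rightarrow> real" where "U s = prob {\<omega> \<in> space M. s < ord_stat i (Z \<omega>)}"

text \<open>\<open>m\<close> extends \<open>\<mu>\<close> by zero to the Borel sets of the whole space.\<close>

definition m :: "(real ^ 'd) measure" where "m = distr \<mu> borel (\<lambda>x. x)"

lemma Z_measurable [measurable]: "Z \<in> borel_measurable M"
  and Z_orthant: "\<omega> \<in> space M \<Longrightarrow> Z \<omega> \<in> orthant"
  and alpha_pos: "0 < \<alpha>"
  and b_nonneg: "0 \<le> t \<Longrightarrow> 0 \<le> b t"
  and b_RV: "0 < x \<Longrightarrow> ((\<lambda>t. b (t * x) / b t) \<longlongrightarrow> x powr (1 / \<alpha>)) at_top"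
  and mu_MM: "\<mu> \<in> MM i"
  and conv: "MM_conv i (\<lambda>t. scaled_law M Z i t (b t)) \<mu>"
  using mrv by (auto simp: MRV_scal_def RV_def)

lemmas [measurable] = borel_measurable_ord_stat[OF i] EE_borel[OF i] tail_borel[OF i]

lemma sets_mu: "sets \<mu> = sets (restrict_space borel (EE i))"
  using mu_MM by (simp add: MM_def)

lemma space_mu: "space \<mu> = EE i"
  using sets_eq_imp_space_eq[OF sets_mu] by (simp add: space_restrict_space)

lemma id_measurable_mu: "(\<lambda>x. x) \<in> borel_measurable \<mu>"
  unfolding measurable_cong_sets[OF sets_mu refl] by (rule measurable_restrict_space1) simp

lemma sets_m [simp, measurable_cong]: "sets m = sets borel" and space_m [simp]: "space m = UNIV"
  by (simp_all add: m_def)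

lemma emeasure_m: "S \<in> sets borel \<Longrightarrow> emeasure m S = emeasure \<mu> (S \<inter> EE i)"
  by (simp add: m_def emeasure_distr id_measurable_mu space_mu)

lemma emeasure_m_subset: "S \<in> sets borel \<Longrightarrow> S \<subseteq> EE i \<Longrightarrow> emeasure m S = emeasure \<mu> S"
  by (simp add: emeasure_m Int_absorb2)

lemma integral_m:
  fixes f :: "real ^ 'd \<Rightarrow> real"
  assumes "f \<in> borel_measurable borel"
  shows "(\<integral>x. f x \<partial>m) = (\<integral>x. f x \<partial>\<mu>)"
  unfolding m_def using assms by (subst integral_distr) (auto simp: id_measurable_mu)

lemma m_tail_finite: "0 < \<epsilon> \<Longrightarrow> emeasure m (tail i \<epsilon>) < \<infinity>"
proof -
  assume \<epsilon>: "0 < \<epsilon>"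
  have sub: "tail i \<epsilon> \<subseteq> (EE i :: (real ^ 'd) set)" by (rule tail_subset_EE[OF i \<epsilon>])
  have "bounded_away (tail i \<epsilon> :: (real ^ 'd) set) (CA (i - 1))"
    by (subst bounded_away_iff[OF i]) (use \<epsilon> in \<open>auto simp: tail_def\<close>)
  moreover have "tail i \<epsilon> \<in> sets \<mu>" using sub by (auto simp: sets_mu sets_restrict_space_iff)
  ultimately show ?thesis using mu_MM sub by (simp add: emeasure_m_subset MM_def)
qed

lemma m_fmeasurable: "0 < \<epsilon> \<Longrightarrow> tail i \<epsilon> \<in> fmeasurable m"
  using m_tail_finite by (auto simp: fmeasurable_def)

lemma m_subset_fmeasurable: "0 < \<epsilon> \<Longrightarrow> D \<in> sets borel \<Longrightarrow> D \<subseteq> tail i \<epsilon> \<Longrightarrow> D \<in> fmeasurable m"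
  by (rule fmeasurableI2[OF m_fmeasurable]) auto

lemma AE_m_EE: "AE x in m. x \<in> EE i"
  by (rule AE_I[of _ _ "- EE i"]) (auto simp: emeasure_m)

text \<open>The tails of radius \<open>1 / (n + 1)\<close> exhaust \<open>EE i\<close> and have
  finite mass, and the complement of \<open>EE i\<close> is null. Fubini arguments over
  \<open>m\<close> rest on this.\<close>

lemma sigma_finite_m: "sigma_finite_measure m"
proof (standard, intro exI conjI)
  let ?A = "insert (- EE i) (range (\<lambda>n. tail i (inverse (real (Suc n)))))"
  show "countable ?A" by auto
  show "?A \<subseteq> sets m" by auto
  have "x \<in> \<Union>?A" for x :: "real ^ 'd"
  proof (cases "x \<in> EE i")
    case True
    then obtain n where "inverse (real (Suc n)) < ord_stat i x"
      using reals_Archimedean[of "ord_stat i x"] by (auto simp: EE_eq[OF i])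
    then show ?thesis using True by (auto simp: EE_eq[OF i] tail_def intro!: exI[of _ n])
  qed auto
  then show "\<Union>?A = space m" by auto
  show "\<forall>a\<in>?A. emeasure m a \<noteq> \<infinity>"
    using m_tail_finite by (auto simp: emeasure_m less_top[symmetric])
qed

lemma integrable_m:
  fixes f :: "real ^ 'd \<Rightarrow> real"
  assumes [measurable]: "f \<in> borel_measurable borel" and \<epsilon>: "0 < \<epsilon>"
    and K: "\<And>x. x \<in> EE i \<Longrightarrow> \<bar>f x\<bar> \<le> K" and supp: "\<And>x. x \<in> EE i \<Longrightarrow> f x \<noteq> 0 \<Longrightarrow> x \<in> tail i \<epsilon>"
  shows "integrable m f"
proof (rule Bochner_Integration.integrable_bound[of m "\<lambda>x. K * indicator (tail i \<epsilon>) x"])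
  show "integrable m (\<lambda>x. K * indicator (tail i \<epsilon>) x)"
    using m_tail_finite[OF \<epsilon>] by (auto intro!: integrable_mult_right integrable_real_indicator)
  show "AE x in m. norm (f x) \<le> norm (K * indicator (tail i \<epsilon>) x :: real)"
    using AE_m_EE
  proof eventually_elim
    case (elim x)
    then show ?case using K[OF elim] supp[OF elim] by (cases "f x = 0") auto
  qed
qed simp

text \<open>Restricts attention to functions continuous on the whole space. The truncation to
  \<open>EE i\<close> in \<open>scaled_law\<close> is invisible: the rescaled vector stays in the
  orthant, where \<open>g\<close> vanishes off a tail.\<close>

lemma conv_test:
  fixes g :: "real ^ 'd \<Rightarrow> real"
  assumes g: "continuous_on UNIV g" and \<epsilon>: "0 < \<epsilon>" and K: "\<And>x. \<bar>g x\<bar> \<le> K"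
    and supp: "\<And>x. x \<in> orthant \<Longrightarrow> g x \<noteq> 0 \<Longrightarrow> x \<in> tail i \<epsilon>"
  shows "((\<lambda>t. t * (\<integral>\<omega>. g (Z \<omega> /\<^sub>R b t) \<partial>M)) \<longlongrightarrow> (\<integral>x. g x \<partial>m)) at_top"
proof -
  have gm [measurable]: "g \<in> borel_measurable borel" using g by (rule borel_measurable_continuous_onI)
  have test: "g \<in> MM_test i"
    unfolding MM_test_iff[OF i] using g \<epsilon> K supp by (auto intro: continuous_on_subset simp: EE_def)
  have "((\<lambda>t. \<integral>x. g x \<partial>scaled_law M Z i t (b t)) \<longlongrightarrow> (\<integral>x. g x \<partial>\<mu>)) at_top"
    using conv test by (auto simp: MM_conv_def)
  then have "((\<lambda>t. \<integral>x. g x \<partial>scaled_law M Z i t (b t)) \<longlongrightarrow> (\<integral>x. g x \<partial>m)) at_top"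
    by (simp add: integral_m)
  moreover have "\<forall>\<^sub>F t in at_top. (\<integral>x. g x \<partial>scaled_law M Z i t (b t)) = t * (\<integral>\<omega>. g (Z \<omega> /\<^sub>R b t) \<partial>M)"
    using eventually_ge_at_top[of 0]
  proof eventually_elim
    case (elim t)
    have "indicator (EE i) (Z \<omega> /\<^sub>R b t) * g (Z \<omega> /\<^sub>R b t) = g (Z \<omega> /\<^sub>R b t)" if "\<omega> \<in> space M" for \<omega>
    proof -
      have "Z \<omega> /\<^sub>R b t \<in> orthant" using b_nonneg[OF elim] Z_orthant[OF that] by (simp add: orthant_scaleR)
      then show ?thesis using supp tail_subset_EE[OF i \<epsilon>] by (auto split: split_indicator)
    qed
    then show ?case
      using elim by (subst integral_scaled_law[OF i _ _ MM_test_measurable[OF test]])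
        (auto intro!: Bochner_Integration.integral_cong)
  qed
  ultimately show ?thesis using tendsto_cong by fast
qed

lemma prob_as_integral:
  assumes [measurable]: "D \<in> sets borel"
  shows "(\<integral>\<omega>. indicator D (Z \<omega> /\<^sub>R s) \<partial>M) = prob {\<omega> \<in> space M. Z \<omega> /\<^sub>R s \<in> D}"
proof -
  have "(\<integral>\<omega>. indicator D (Z \<omega> /\<^sub>R s) \<partial>M) = (\<integral>\<omega>. indicator {\<omega> \<in> space M. Z \<omega> /\<^sub>R s \<in> D} \<omega> \<partial>M :: real)"
    by (rule Bochner_Integration.integral_cong) (auto split: split_indicator)
  then show ?thesis by (simp add: measurable)
qed

lemma infdist_tail:
  fixes D :: "(real ^ 'd) set"
  assumes D: "D \<subseteq> tail i \<epsilon>" "D \<noteq> {}" and x: "infdist x D < \<epsilon> / 2" "x \<in> orthant"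
  shows "x \<in> tail i (\<epsilon> / 2)"
proof -
  have "\<not> \<epsilon> / 2 \<le> (INF y\<in>D. dist x y)" using x D by (simp add: infdist_def)
  then obtain y where y: "y \<in> D" "dist x y < \<epsilon> / 2"
    using cINF_greatest[of D "\<epsilon> / 2" "dist x"] D(2) by force
  have "\<bar>ord_stat i x - ord_stat i y\<bar> < \<epsilon> / 2"
    using ord_stat_norm[OF i, of x y] y(2) by (simp add: dist_norm)
  moreover have "\<epsilon> \<le> ord_stat i y" using y D by (auto simp: tail_def)
  ultimately have "\<epsilon> / 2 \<le> ord_stat i x" by linarith
  then show ?thesis using x(2) by (simp add: tail_def)
qed

text \<open>Upper half of the portmanteau theorem: Lipschitz cutoffs around \<open>D\<close>
  decrease to its indicator, and dominated convergence under \<open>m\<close> brings their integrals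
  down to \<open>measure m D\<close>.\<close>

lemma conv_closed:
  assumes D: "closed D" "D \<subseteq> tail i \<epsilon>" and \<epsilon>: "0 < \<epsilon>" and e: "0 < e"
  shows "\<forall>\<^sub>F t in at_top. t * prob {\<omega> \<in> space M. Z \<omega> /\<^sub>R b t \<in> D} \<le> measure m D + e"
proof (cases "D = {}")
  \<comment> \<open>The empty set is separated because \<open>infdist x {}\<close> is 0 by
    convention, which would make every cutoff constantly 1.\<close>
  case True
  then show ?thesis using e by simp
next
  case False
  define h where "h n x = max 0 (1 - real n * infdist x D)" for n x
  \<comment> \<open>The cutoff \<open>h n\<close> vanishes from distance \<open>1 / n\<close> of
    \<open>D\<close> on. Beyond \<open>n0\<close> this distance is below
    \<open>\<epsilon> / 2\<close>, so that by the Lipschitz property the support stays in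
    \<open>tail i (\<epsilon> / 2)\<close>.\<close>
  obtain n0 :: nat where n0: "2 / \<epsilon> < real n0" using reals_Archimedean2 by blast
  have Dm [measurable]: "D \<in> sets borel" using D by simp
  have cont: "continuous_on UNIV (h n)" for n unfolding h_def by (intro continuous_intros)
  have hm [measurable]: "h n \<in> borel_measurable borel" for n using cont by (rule borel_measurable_continuous_onI)
  have h01: "0 \<le> h n x" "h n x \<le> 1" for n x by (auto simp: h_def infdist_nonneg)
  have hD: "x \<in> D \<Longrightarrow> h n x = 1" for n x by (simp add: h_def)
  have supp: "x \<in> tail i (\<epsilon> / 2)" if "x \<in> orthant" "h n x \<noteq> 0" "n0 \<le> n" for n x
  proof -
    have "0 < h n x" using that h01(1)[of n x] by simp
    then have "real n * infdist x D < 1" by (auto simp: h_def max_def split: if_splits)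
    moreover have "2 / \<epsilon> * infdist x D \<le> real n * infdist x D"
      using n0 that by (intro mult_right_mono) (auto simp: infdist_nonneg)
    ultimately have "2 / \<epsilon> * infdist x D < 1" by linarith
    then have "infdist x D < \<epsilon> / 2" using \<epsilon> by (simp add: field_simps)
    then show ?thesis using infdist_tail[OF D(2) False] that by simp
  qed
  have dom: "h n x \<le> indicator (tail i (\<epsilon> / 2)) x" if "x \<in> orthant" "n0 \<le> n" for n x
    using supp[OF that(1) _ that(2)] h01[of n x] by (auto split: split_indicator)
  have "(\<lambda>n. \<integral>x. h (n + n0) x \<partial>m) \<longlonglongrightarrow> (\<integral>x. indicator D x \<partial>m)"
  proof (rule integral_dominated_convergence[where w = "indicator (tail i (\<epsilon> / 2))"])
    show "integrable m (indicator (tail i (\<epsilon> / 2)) :: _ \<Rightarrow> real)"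
      using m_tail_finite[of "\<epsilon> / 2"] \<epsilon> by (intro integrable_real_indicator) auto
    have "(\<lambda>n. h (n + n0) x) \<longlonglongrightarrow> indicator D x" for x
    proof (cases "x \<in> D")
      case False
      then have pos: "0 < infdist x D" using in_closed_iff_infdist_zero[OF D(1) \<open>D \<noteq> {}\<close>, of x] infdist_nonneg[of x D] by auto
      then obtain N :: nat where N: "1 / infdist x D < real N" using reals_Archimedean2 by blast
      have "h (n + n0) x = 0" if "N \<le> n" for n
      proof -
        have "1 / infdist x D < real (n + n0)" using N that by simp
        then have "1 < real (n + n0) * infdist x D" using pos by (simp only: divide_less_eq) 
        then show ?thesis by (simp add: h_def)
      qed
      then have "\<forall>\<^sub>F n in sequentially. h (n + n0) x = 0" by (auto simp: eventually_sequentially)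
      then show ?thesis using False tendsto_eventually by fastforce
    qed (simp add: hD)
    then show "AE x in m. (\<lambda>n. h (n + n0) x) \<longlonglongrightarrow> indicator D x" by simp
    show "AE x in m. norm (h (n + n0) x) \<le> indicator (tail i (\<epsilon> / 2)) x" for n
      using AE_m_EE
    proof eventually_elim
      case (elim x)
      then show ?case using dom[of x "n + n0"] h01[of "n + n0" x] by (auto simp: EE_def)
    qed
  qed auto
  then have "\<forall>\<^sub>F n in sequentially. (\<integral>x. h (n + n0) x \<partial>m) < measure m D + e / 2"
    using e by (intro order_tendstoD(2)) (auto simp: measure_def)
  then obtain n where n: "(\<integral>x. h (n + n0) x \<partial>m) < measure m D + e / 2"
    by (auto simp: eventually_sequentially)
  have "((\<lambda>t. t * (\<integral>\<omega>. h (n + n0) (Z \<omega> /\<^sub>R b t) \<partial>M)) \<longlongrightarrow> (\<integral>x. h (n + n0) x \<partial>m)) at_top"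
    by (rule conv_test[OF cont, of "\<epsilon> / 2" _ 1]) (use \<epsilon> h01 supp in auto)
  then have "\<forall>\<^sub>F t in at_top. t * (\<integral>\<omega>. h (n + n0) (Z \<omega> /\<^sub>R b t) \<partial>M) < measure m D + e / 2 + e / 2"
    using n e by (intro order_tendstoD(2)) auto
  then show ?thesis using eventually_ge_at_top[of 0]
  proof eventually_elim
    case (elim t)
    have "prob {\<omega> \<in> space M. Z \<omega> /\<^sub>R b t \<in> D} = (\<integral>\<omega>. indicator D (Z \<omega> /\<^sub>R b t) \<partial>M)"
      by (simp add: prob_as_integral)
    also have "\<dots> \<le> (\<integral>\<omega>. h (n + n0) (Z \<omega> /\<^sub>R b t) \<partial>M)"
    proof (rule integral_mono_AE)
      show "integrable M (\<lambda>\<omega>. h (n + n0) (Z \<omega> /\<^sub>R b t))"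
        by (rule integrable_const_bound[of _ 1]) (use h01 in auto)
      show "integrable M (\<lambda>\<omega>. indicator D (Z \<omega> /\<^sub>R b t) :: real)"
        by (rule integrable_const_bound[of _ 1]) (auto split: split_indicator)
      show "AE \<omega> in M. indicator D (Z \<omega> /\<^sub>R b t) \<le> h (n + n0) (Z \<omega> /\<^sub>R b t)"
        using h01 hD by (auto split: split_indicator)
    qed
    finally show ?case using elim mult_left_mono[of _ _ t] by fastforce
  qed
qed

definition G :: "real \<Rightarrow> real" where "G x = measure m (tail i x)"

text \<open>A continuous ramp rising from 0 at \<open>x\<close> to 1 at \<open>y\<close> separates
  the two indicators. The ramp needs the gap between \<open>x\<close> and \<open>y\<close>; it can
  be closed later, once \<open>G\<close> is known to be continuous.\<close>

lemma conv_tail_lower: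
  assumes x: "0 < x" "x < y" and e: "0 < e"
  shows "\<forall>\<^sub>F t in at_top. G y - e \<le> t * prob {\<omega> \<in> space M. x < ord_stat i (Z \<omega> /\<^sub>R b t)}"
proof -
  define g where "g z = min 1 (max 0 ((ord_stat i z - x) / (y - x)))" for z :: "real ^ 'd"
  have cont: "continuous_on UNIV g" unfolding g_def by (intro continuous_intros i) (use x in auto)
  have [measurable]: "g \<in> borel_measurable borel" using cont by (rule borel_measurable_continuous_onI)
  have g01: "0 \<le> g z" "g z \<le> 1" for z by (auto simp: g_def)
  have supp: "x < ord_stat i z" if "g z \<noteq> 0" for z
    using that x by (auto simp: g_def max_def min_def divide_le_0_iff zero_le_divide_iff split: if_splits)
  have lim: "((\<lambda>t. t * (\<integral>\<omega>. g (Z \<omega> /\<^sub>R b t) \<partial>M)) \<longlongrightarrow> (\<integral>x. g x \<partial>m)) at_top"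
    by (rule conv_test[OF cont x(1), of 1]) (use g01 supp in \<open>auto simp: tail_def intro!: less_imp_le\<close>)
  have "G y = (\<integral>z. indicator (tail i y) z \<partial>m)" by (simp add: G_def)
  also have "\<dots> \<le> (\<integral>z. g z \<partial>m)"
  proof (rule integral_mono_AE)
    show "integrable m g"
      by (rule integrable_m[of _ x 1]) (use x g01 supp in \<open>auto simp: tail_def EE_def intro: less_imp_le\<close>)
    show "integrable m (indicator (tail i y) :: _ \<Rightarrow> real)"
      using m_tail_finite[of y] x by (intro integrable_real_indicator) auto
    show "AE z in m. indicator (tail i y) z \<le> g z"
      using x g01 by (auto simp: g_def tail_def split: split_indicator)
  qed
  finally have "\<forall>\<^sub>F t in at_top. G y - e < t * (\<integral>\<omega>. g (Z \<omega> /\<^sub>R b t) \<partial>M)"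
    using e by (intro order_tendstoD(1)[OF lim]) auto
  then show ?thesis using eventually_ge_at_top[of 0]
  proof eventually_elim
    case (elim t)
    have "(\<integral>\<omega>. g (Z \<omega> /\<^sub>R b t) \<partial>M) \<le> (\<integral>\<omega>. indicator {z. x < ord_stat i z} (Z \<omega> /\<^sub>R b t) \<partial>M)"
    proof (rule integral_mono_AE)
      show "integrable M (\<lambda>\<omega>. g (Z \<omega> /\<^sub>R b t))"
        by (rule integrable_const_bound[of _ 1]) (use g01 in auto)
      show "integrable M (\<lambda>\<omega>. indicator {z. x < ord_stat i z} (Z \<omega> /\<^sub>R b t) :: real)"
        by (rule integrable_const_bound[of _ 1]) (auto split: split_indicator)
      have "g z \<le> indicator {z. x < ord_stat i z} z" for z
        using g01[of z] supp[of z] by (cases "g z = 0") (auto split: split_indicator)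
      then show "AE \<omega> in M. g (Z \<omega> /\<^sub>R b t) \<le> indicator {z. x < ord_stat i z} (Z \<omega> /\<^sub>R b t)" by simp
    qed
    also have "\<dots> = prob {\<omega> \<in> space M. x < ord_stat i (Z \<omega> /\<^sub>R b t)}"
      by (subst prob_as_integral) auto
    finally show ?case using elim mult_left_mono[of _ _ t] by fastforce
  qed
qed

end

section \<open>Passing from the canonical scaling to all scales\<close>

context mrv_vector
begin

text \<open>For \<open>t > 1\<close> the level \<open>1 - 1 / t\<close> lies strictly between 0 and
  1, and right-continuity of the distribution function makes the quantile attained. These two
  inequalities are all that is used of the canonical choice.\<close>

lemma canonical:
  assumes t: "1 < t"
  shows U_b_le: "U (b t) \<le> 1 / t" and U_below_b: "x < b t \<Longrightarrow> 1 / t < U x"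
proof -
  let ?N = "distr M borel (\<lambda>\<omega>. ord_stat i (Z \<omega>))"
  interpret N: cdf_distribution ?N
    unfolding cdf_distribution_def by (rule real_distribution_distr) measurable
  let ?S = "{x. 1 - 1 / t \<le> cdf ?N x}"
  have s: "0 < 1 - 1 / t" "1 - 1 / t < 1" using t by auto
  have U_eq: "U x = 1 - cdf ?N x" for x
  proof -
    have "cdf ?N x = prob {\<omega> \<in> space M. ord_stat i (Z \<omega>) \<le> x}"
      by (simp add: cdf_def measure_distr vimage_def Int_def conj_commute)
    moreover have "{\<omega> \<in> space M. x < ord_stat i (Z \<omega>)} = space M - {\<omega> \<in> space M. ord_stat i (Z \<omega>) \<le> x}"
      by auto
    ultimately show ?thesis by (simp add: U_def prob_compl)
  qed
  \<comment> \<open>The real infimum has the Galois property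
    \<open>1 - 1 / t \<le> cdf ?N x \<longleftrightarrow> q \<le> x\<close>; this also shows that
    the set is nonempty and bounded below, so the infimum in the extended reals is the same
    number.\<close>
  define q where "q = Inf ?S"
  have q: "1 - 1 / t \<le> cdf ?N x \<longleftrightarrow> q \<le> x" for x
    unfolding q_def by (rule N.pseudoinverse[OF s])
  then have "q \<in> ?S" by simp
  then have ne: "?S \<noteq> {}" by blast
  have bdd: "bdd_below ?S"
    by (rule bdd_belowI[of _ q]) (simp add: q)
  have "b t = q"
    unfolding canon_scal_def gen_inverse_def q_def ereal_Inf'[OF bdd ne, symmetric] by simp
  then have *: "1 - 1 / t \<le> cdf ?N x \<longleftrightarrow> b t \<le> x" for x using q by simp
  from *[of "b t"] show "U (b t) \<le> 1 / t" by (simp add: U_eq)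
  from *[of x] show "x < b t \<Longrightarrow> 1 / t < U x" by (simp add: U_eq not_le)
qed

lemma U_antimono: "x \<le> y \<Longrightarrow> U y \<le> U x"
  unfolding U_def by (intro finite_measure_mono) auto

lemma b_mono: "1 < s \<Longrightarrow> s \<le> t \<Longrightarrow> b s \<le> b t"
proof (rule ccontr)
  assume st: "1 < s" "s \<le> t" "\<not> b s \<le> b t"
  then have "1 / s < U (b t)" "U (b t) \<le> 1 / t" using canonical by auto
  moreover have "1 / t \<le> 1 / s" using st by (simp add: frac_le)
  ultimately show False by linarith
qed

text \<open>Doubling the time eventually multiplies \<open>b\<close> by more than a constant
  \<open>c > 1\<close>, so \<open>b\<close> grows geometrically along \<open>t1 * 2 ^ n\<close>;
  monotonicity fills the gaps.\<close>

lemma b_at_top: "filterlim b at_top at_top"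
proof -
  define c where "c = (1 + 2 powr (1 / \<alpha>)) / 2"
  have "1 < 2 powr (1 / \<alpha>)" using alpha_pos by simp
  then have c: "1 < c" "c < 2 powr (1 / \<alpha>)" by (auto simp: c_def)
  have "\<forall>\<^sub>F t in at_top. c < b (t * 2) / b t"
    using b_RV[of 2] c by (intro order_tendstoD(1)) auto
  then obtain t0 where t0: "\<And>t. t0 \<le> t \<Longrightarrow> c < b (t * 2) / b t" by (auto simp: eventually_at_top_linorder)
  define t1 where "t1 = max t0 2"
  \<comment> \<open>Positivity comes for free: if \<open>b t\<close> were 0, the quotient would be 0
    by convention and could not exceed \<open>c\<close>.\<close>
  have step: "0 < b t \<and> c * b t \<le> b (t * 2)" if "t1 \<le> t" for t
  proof -
    have q: "c < b (t * 2) / b t" and "0 \<le> b t" using that t0[of t] b_nonneg[of t] by (auto simp: t1_def)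
    then have "0 < b t" using c by (cases "b t = 0") auto
    then show ?thesis using q by (simp add: less_divide_eq)
  qed
  have pow: "c ^ n * b t1 \<le> b (t1 * 2 ^ n)" for n
  proof (induction n)
    case (Suc n)
    have "t1 * 1 \<le> t1 * 2 ^ n" by (intro mult_left_mono) (auto simp: t1_def)
    then have "c * b (t1 * 2 ^ n) \<le> b (t1 * 2 ^ Suc n)" using step[of "t1 * 2 ^ n"] by (simp add: ac_simps)
    moreover have "c * (c ^ n * b t1) \<le> c * b (t1 * 2 ^ n)" using Suc c by (intro mult_left_mono) auto
    ultimately show ?case by (simp add: ac_simps)
  qed simp
  show ?thesis
  proof (rule filterlim_at_top[THEN iffD2], rule allI)
    fix K :: real
    have p: "0 < b t1" using step[of t1] by simp
    obtain n where n: "K / b t1 < c ^ n" using real_arch_pow[OF c(1)] by blast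
    then have "K < c ^ n * b t1" using p by (simp add: divide_less_eq)
    then have K: "K \<le> b (t1 * 2 ^ n)" using pow[of n] by simp
    have "t1 * 1 \<le> t1 * 2 ^ n" by (intro mult_left_mono) (auto simp: t1_def)
    then have "1 < t1 * 2 ^ n" by (auto simp: t1_def)
    then have "K \<le> b t" if "t1 * 2 ^ n \<le> t" for t using b_mono[of "t1 * 2 ^ n" t] that K by linarith
    then show "\<forall>\<^sub>F t in at_top. K \<le> b t" by (auto simp: eventually_at_top_linorder)
  qed
qed

lemma eventually_b_pos: "\<forall>\<^sub>F t in at_top. 0 < b t"
  using b_at_top unfolding filterlim_at_top_dense by blast

lemma U_pos: "0 < U s"
proof -
  have "\<forall>\<^sub>F t in at_top. s < b t" using b_at_top unfolding filterlim_at_top_dense by blast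
  then have "\<forall>\<^sub>F t in at_top. s < b t \<and> 1 < t" using eventually_gt_at_top[of 1] by eventually_elim auto
  then obtain t where "s < b t" "1 < t" by (auto simp: eventually_at_top_linorder)
  then show ?thesis using U_below_b[of t s] by (auto intro: less_trans[rotated])
qed

lemma inverse_U_at_top: "filterlim (\<lambda>s. 1 / U s) at_top at_top"
proof (rule filterlim_at_top[THEN iffD2], rule allI)
  fix K :: real
  define t where "t = max K 2"
  have t: "1 < t" by (simp add: t_def)
  have "K \<le> 1 / U s" if "b t \<le> s" for s
  proof -
    have "U s \<le> 1 / t" using U_antimono[OF that] U_b_le[OF t] by linarith
    then have "t \<le> 1 / U s" using t U_pos[of s] by (simp add: field_simps)
    then show ?thesis by (simp add: t_def)
  qed
  then show "\<forall>\<^sub>F s in at_top. K \<le> 1 / U s" by (auto simp: eventually_at_top_linorder)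
qed

lemma ord_stat_div: "0 < s \<Longrightarrow> ord_stat i (Z \<omega> /\<^sub>R s) = ord_stat i (Z \<omega>) / s"
  using ord_stat_scaleR[OF i, of "inverse s" "Z \<omega>"] by (simp add: divide_inverse_commute)

lemma in_tail_div: "\<omega> \<in> space M \<Longrightarrow> 0 < s \<Longrightarrow> Z \<omega> /\<^sub>R s \<in> tail i x \<longleftrightarrow> x * s \<le> ord_stat i (Z \<omega>)"
  using Z_orthant[of \<omega>] by (simp add: tail_def ord_stat_div orthant_scaleR le_divide_eq)

lemma conv_tail_upper:
  assumes "0 < x" "0 < e"
  shows "\<forall>\<^sub>F t in at_top. t * prob {\<omega> \<in> space M. Z \<omega> /\<^sub>R b t \<in> tail i x} \<le> G x + e"
  unfolding G_def using assms by (intro conv_closed[of _ x] closed_tail[OF i]) auto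

text \<open>The same event is read at the times \<open>t\<close> and \<open>t * u\<close>. As
  \<open>b (t * u)\<close> is about \<open>u powr (1 / \<alpha>)\<close> times \<open>b t\<close>,
  exceeding \<open>y * b t\<close> implies reaching \<open>x * b (t * u)\<close>, and the prefactors
  differ by \<open>u\<close>.\<close>

lemma G_scaling_aux:
  assumes x: "0 < x" and u: "0 < u" and w: "x * u powr (1 / \<alpha>) < w"
  shows "u * G w \<le> G x"
proof -
  let ?p = "u powr (1 / \<alpha>)"
  \<comment> \<open>The intermediate \<open>y\<close> leaves room on both sides: below it for the
    limit of \<open>b (t * u) / b t\<close>, above it for the gap in
    \<open>conv_tail_lower\<close>.\<close>
  obtain y where y: "x * ?p < y" "y < w" using dense[OF w] by auto
  have ypos: "0 < y" using y(1) x u by (auto intro: less_trans[rotated])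
  have "?p < y / x" using y x by (simp add: less_divide_eq mult.commute)
  then have r: "\<forall>\<^sub>F t in at_top. b (t * u) / b t < y / x"
    using b_RV[OF u] by (intro order_tendstoD(2)) auto
  have tu: "filterlim (\<lambda>t. t * u) at_top at_top"
    using u by (simp add: filterlim_at_top_mult_tendsto_pos[OF tendsto_const] filterlim_ident filterlim_tendsto_pos_mult_at_top mult.commute)
  have "u * (G w - e) \<le> G x + e" if e: "0 < e" for e
  proof -
    \<comment> \<open>The premise is a dummy. The conclusion does not depend on \<open>t\<close>,
      and a constant statement that holds eventually along \<open>at_top\<close> is true.\<close>
    have "\<forall>\<^sub>F t in at_top. (t :: real) = t \<longrightarrow> u * (G w - e) \<le> G x + e"
      using conv_tail_lower[OF ypos y(2) e] filterlim_iff[THEN iffD1, OF tu, rule_format, OF conv_tail_upper[OF x e]]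
        filterlim_iff[THEN iffD1, OF tu, rule_format, OF eventually_b_pos]
        eventually_b_pos r eventually_gt_at_top[of 0]
    proof eventually_elim
      case (elim t)
      have "b (t * u) * x \<le> y * b t" using elim x by (simp add: field_simps)
      then have "prob {\<omega> \<in> space M. y < ord_stat i (Z \<omega> /\<^sub>R b t)} \<le>
          prob {\<omega> \<in> space M. Z \<omega> /\<^sub>R b (t * u) \<in> tail i x}"
        using elim by (intro finite_measure_mono) (auto simp: in_tail_div ord_stat_div less_divide_eq mult.commute)
      then have "t * u * prob {\<omega> \<in> space M. y < ord_stat i (Z \<omega> /\<^sub>R b t)} \<le> G x + e"
        using elim u by (intro order_trans[OF mult_left_mono elim(2)]) auto
      moreover have "u * (G w - e) \<le> u * (t * prob {\<omega> \<in> space M. y < ord_stat i (Z \<omega> /\<^sub>R b t)})"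
        using elim u by (intro mult_left_mono) auto
      ultimately show ?case by (simp add: ac_simps)
    qed
    then show ?thesis by simp
  qed
  then have *: "u * G w - G x \<le> (u + 1) * e" if "0 < e" for e using that by (fastforce simp: algebra_simps)
  have "u * G w - G x \<le> e" if "0 < e" for e
    using *[of "e / (u + 1)"] that u by simp
  then show ?thesis by (metis diff_le_0_iff_le field_le_epsilon add_0)
qed

text \<open>Apply \<open>G_scaling_aux\<close> with \<open>u = (v / x) powr \<alpha>\<close> for
  \<open>v < w\<close> and let \<open>v\<close> tend to \<open>w\<close>. Exchanging
  \<open>x\<close> and \<open>w\<close> then shows that \<open>x powr \<alpha> * G x\<close> is
  constant.\<close>

lemma G_scaling:
  assumes x: "0 < x" and w: "0 < w"
  shows "w powr \<alpha> * G w \<le> x powr \<alpha> * G x"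
proof (rule tendsto_upperbound)
  show "((\<lambda>v. v powr \<alpha> * G w) \<longlongrightarrow> w powr \<alpha> * G w) (at_left w)"
    using w by (intro tendsto_intros) auto
  show "\<forall>\<^sub>F v in at_left w. v powr \<alpha> * G w \<le> x powr \<alpha> * G x"
    using eventually_at_left_real[OF w]
  proof eventually_elim
    case (elim v)
    have "x * ((v / x) powr \<alpha>) powr (1 / \<alpha>) = v" using x elim alpha_pos by (simp add: powr_powr)
    then have "(v / x) powr \<alpha> * G w \<le> G x"
      using elim x by (intro G_scaling_aux) auto
    then show ?case using x elim by (simp add: powr_divide divide_le_eq mult.commute)
  qed
qed simp

lemma prob_below_b:
  assumes "1 < t" "0 < b t" "x < 1"
  shows "1 \<le> t * prob {\<omega> \<in> space M. x < ord_stat i (Z \<omega> /\<^sub>R b t)}"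
proof -
  have "1 / t < U (x * b t)" using assms by (intro U_below_b) auto
  then show ?thesis using assms by (simp add: U_def ord_stat_div less_divide_eq divide_less_eq mult.commute)
qed

text \<open>Homogeneity leaves one constant, and the canonical scaling fixes it: the quantile
  inequalities give \<open>1 \<le> G x\<close> for \<open>x < 1\<close> and
  \<open>G y \<le> 1\<close> for \<open>y > 1\<close>, and both limits at 1 equal
  \<open>c\<close>.\<close>

lemma G_eq:
  assumes x: "0 < x"
  shows "G x = x powr - \<alpha>"
proof -
  define c where "c = G 1"
  have Gc: "G x = c * x powr - \<alpha>" if "0 < x" for x
    using G_scaling[OF that, of 1] G_scaling[of 1, OF _ that] that by (simp add: c_def powr_minus field_simps)
  have ge: "1 \<le> G x" if x: "0 < x" "x < 1" for x
  proof (rule field_le_epsilon)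
    fix e :: real assume e: "0 < e"
    have "\<forall>\<^sub>F t in at_top. (t :: real) = t \<longrightarrow> 1 \<le> G x + e"
      using conv_tail_upper[OF x(1) e] eventually_b_pos eventually_gt_at_top[of 1]
    proof eventually_elim
      case (elim t)
      have "1 \<le> t * prob {\<omega> \<in> space M. x < ord_stat i (Z \<omega> /\<^sub>R b t)}"
        using elim x by (intro prob_below_b) auto
      also have "\<dots> \<le> t * prob {\<omega> \<in> space M. Z \<omega> /\<^sub>R b t \<in> tail i x}"
        using elim Z_orthant b_nonneg[of t]
        by (intro mult_left_mono finite_measure_mono) (auto simp: tail_def orthant_scaleR)
      finally show ?case using elim by linarith
    qed
    then show "1 \<le> G x + e" by simp
  qed
  have le: "G y \<le> 1" if y: "1 < y" for y
  proof (rule field_le_epsilon)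
    fix e :: real assume e: "0 < e"
    have "\<forall>\<^sub>F t in at_top. (t :: real) = t \<longrightarrow> G y \<le> 1 + e"
      using conv_tail_lower[OF zero_less_one y e] eventually_b_pos eventually_gt_at_top[of 1]
    proof eventually_elim
      case (elim t)
      have "prob {\<omega> \<in> space M. 1 < ord_stat i (Z \<omega> /\<^sub>R b t)} = U (b t)"
        using elim by (simp add: U_def ord_stat_div less_divide_eq)
      then have "t * prob {\<omega> \<in> space M. 1 < ord_stat i (Z \<omega> /\<^sub>R b t)} \<le> 1"
        using U_b_le[of t] elim by (simp add: le_divide_eq mult.commute)
      then show ?case using elim by linarith
    qed
    then show "G y \<le> 1 + e" by simp
  qed
  have "1 \<le> c"
  proof (rule tendsto_lowerbound)
    show "((\<lambda>x. c * x powr - \<alpha>) \<longlongrightarrow> c) (at_left 1)" by (auto intro!: tendsto_eq_intros)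
    show "\<forall>\<^sub>F x in at_left 1. 1 \<le> c * x powr - \<alpha>"
      using eventually_at_left_real[of 0 1] by (rule eventually_mono) (use ge Gc in auto)
  qed simp
  moreover have "c \<le> 1"
  proof (rule tendsto_upperbound)
    show "((\<lambda>x. c * x powr - \<alpha>) \<longlongrightarrow> c) (at_right 1)" by (auto intro!: tendsto_eq_intros)
    show "\<forall>\<^sub>F x in at_right 1. c * x powr - \<alpha> \<le> 1"
      using eventually_at_right_real[of 1 2] by (rule eventually_mono) (use le Gc in auto)
  qed simp
  ultimately show ?thesis using Gc[OF x] by simp
qed

text \<open>Above 1 the product is excluded by the quantile inequality. Below, \<open>y > 1\<close>
  is taken so close to 1 that \<open>y powr - \<alpha>\<close> exceeds the midpoint of
  \<open>a\<close> and 1, and the other half of the gap pays for the error term.\<close>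

lemma t_U_b: "((\<lambda>t. t * U (b t)) \<longlongrightarrow> 1) at_top"
proof (rule order_tendstoI)
  fix a :: real assume a: "a < 1"
  have "((\<lambda>y. y powr - \<alpha>) \<longlongrightarrow> 1) (at_right 1)" by (auto intro!: tendsto_eq_intros)
  from order_tendstoD(1)[OF this, of "(a + 1) / 2"] eventually_at_right_less[of "1 :: real"]
  have "\<forall>\<^sub>F y in at_right 1. (a + 1) / 2 < y powr - \<alpha> \<and> 1 < y"
    using a by (intro eventually_conj) auto
  then obtain y where y: "(a + 1) / 2 < y powr - \<alpha>" "1 < y"
    using eventually_happens'[of "at_right (1::real)"] by auto
  have e: "0 < (1 - a) / 2" using a by simp
  show "\<forall>\<^sub>F t in at_top. a < t * U (b t)"
    using conv_tail_lower[OF zero_less_one y(2) e] eventually_b_pos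
  proof eventually_elim
    case (elim t)
    then have "prob {\<omega> \<in> space M. 1 < ord_stat i (Z \<omega> /\<^sub>R b t)} = U (b t)"
      by (simp add: U_def ord_stat_div less_divide_eq)
    moreover have "G y = y powr - \<alpha>" using y by (intro G_eq) auto
    moreover have "(a + 1) / 2 - (1 - a) / 2 = a" by (simp add: field_simps)
    ultimately show ?case using elim y by (metis diff_strict_right_mono less_le_trans)
  qed
next
  fix a :: real assume a: "1 < a"
  show "\<forall>\<^sub>F t in at_top. t * U (b t) < a"
    using eventually_gt_at_top[of 1]
  proof eventually_elim
    case (elim t)
    then show ?case using U_b_le[OF elim] a by (simp add: le_divide_eq mult.commute)
  qed
qed

text \<open>At the time \<open>1 / U s\<close> the canonical scaling is asymptotic to \<open>s\<close>; as \<open>b\<close>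
  need not be continuous, not every \<open>s\<close> is itself of the form \<open>b t\<close>.\<close>

lemma b_inverse_U:
  assumes r: "1 < r"
  shows "\<forall>\<^sub>F s in at_top. 0 < b (1 / U s) \<and> b (1 / U s) \<le> s \<and> s \<le> r * b (1 / U s)"
proof -
  \<comment> \<open>Chosen so that \<open>u powr (1 / \<alpha>)\<close> is the midpoint of 1 and
    \<open>r\<close>.\<close>
  define u where "u = ((1 + r) / 2) powr \<alpha>"
  have u: "1 < u" "u powr (1 / \<alpha>) < r"
    using r alpha_pos powr_less_mono2[of \<alpha> 1 "(1 + r) / 2"] by (auto simp: u_def powr_powr)
  have "\<forall>\<^sub>F t in at_top. b (t * u) / b t < r"
    using b_RV[of u] u by (intro order_tendstoD(2)) auto
  then have "\<forall>\<^sub>F t in at_top. b (t * u) / b t < r \<and> 0 < b t \<and> 1 < t"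
    using eventually_b_pos eventually_gt_at_top[of 1] by eventually_elim auto
  from filterlim_iff[THEN iffD1, OF inverse_U_at_top, rule_format, OF this] show ?thesis
  proof eventually_elim
    case (elim s)
    let ?T = "1 / U s"
    have "b ?T \<le> s" using U_below_b[of ?T s] elim by force
    \<comment> \<open>Delaying the time by the factor \<open>u > 1\<close> makes the tail at the
      quantile at most \<open>U s / u\<close>, strictly below \<open>U s\<close>, so the quantile
      must have passed \<open>s\<close>.\<close>
    moreover have "s < b (?T * u)"
    proof (rule ccontr)
      assume "\<not> s < b (?T * u)"
      then have "U s \<le> U (b (?T * u))" by (intro U_antimono) simp
      also have "\<dots> \<le> 1 / (?T * u)" using elim u by (intro U_b_le less_1_mult) auto
      also have "\<dots> = U s / u" by simp
      finally show False using u U_pos[of s] by (simp add: le_divide_eq)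
    qed
    moreover have "b (?T * u) \<le> r * b ?T"
      using elim pos_divide_less_eq[of "b ?T" "b (?T * u)" r] by (meson less_imp_le)
    ultimately show ?case using elim by linarith
  qed
qed

section \<open>Convergence of sets at arbitrary scales\<close>

definition nu :: "real \<Rightarrow> (real ^ 'd) set \<Rightarrow> real" where
  "nu s D = prob {\<omega> \<in> space M. Z \<omega> /\<^sub>R s \<in> D} / U s"

text \<open>If \<open>B \<le> s \<le> r * B\<close> with \<open>B > 0\<close>, then
  \<open>Z \<omega> /\<^sub>R s\<close> is a contraction of \<open>Z \<omega> /\<^sub>R B\<close> by
  a factor in \<open>{1 / r..1}\<close>. So when the former lies in \<open>D\<close>, the latter
  lies in this set, whatever the precise ratio is.\<close>

definition fatten :: "real \<Rightarrow> (real ^ 'd) set \<Rightarrow> (real ^ 'd) set" where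
  "fatten r D = {z. \<exists>c. c \<in> {1 / r..1} \<and> c *\<^sub>R z \<in> D}"

lemma closed_fatten:
  assumes "closed D"
  shows "closed (fatten r D)"
proof -
  have "closed ((\<lambda>p :: real \<times> (real ^ 'd). fst p *\<^sub>R snd p) -` D)"
    by (intro closed_vimage assms continuous_intros)
  from closed_compact_projection[OF _ this, of "{1 / r..1}"] show ?thesis
    by (simp add: fatten_def)
qed

text \<open>The added points are enlargements of points of \<open>D\<close>, which only increases
  order statistics in the orthant; the radius of the tail is not spoiled.\<close>

lemma fatten_tail:
  assumes "D \<subseteq> tail i \<epsilon>" "0 < \<epsilon>" "1 < r"
  shows "fatten r D \<subseteq> tail i \<epsilon>"
proof
  fix z assume "z \<in> fatten r D"
  then obtain c where c: "1 / r \<le> c" "c \<le> 1" "c *\<^sub>R z \<in> D" by (auto simp: fatten_def)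
  have "0 < 1 / r" using assms by simp
  then have c0: "0 < c" using c by linarith
  have *: "c *\<^sub>R z \<in> orthant" "\<epsilon> \<le> ord_stat i (c *\<^sub>R z)" using c assms by (auto simp: tail_def)
  then have zo: "z \<in> orthant" using c0 by (auto simp: orthant_iff zero_le_mult_iff)
  have "c * ord_stat i z \<le> 1 * ord_stat i z" using c ord_stat_nonneg[OF i zo] by (intro mult_right_mono)
  then show "z \<in> tail i \<epsilon>" using * zo c0 by (simp add: tail_def ord_stat_scaleR[OF i])
qed

text \<open>As \<open>r\<close> decreases to 1 the fattened sets shrink to \<open>D\<close>: the
  contraction factors tend to 1 and \<open>D\<close> is closed. Continuity from above applies
  because all of them lie in one tail of finite mass.\<close>

lemma measure_fatten:
  assumes D: "closed D" "D \<subseteq> tail i \<epsilon>" and \<epsilon>: "0 < \<epsilon>" and e: "0 < e"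
  shows "\<exists>r>1. measure m (fatten r D) < measure m D + e"
proof -
  define r where "r n = 1 + 1 / real (Suc n)" for n
  have r: "1 < r n" for n by (simp add: r_def)
  have lim: "(\<lambda>n. 1 / r n) \<longlonglongrightarrow> 1"
    unfolding r_def using tendsto_divide[OF tendsto_const[of 1] tendsto_add[OF tendsto_const[of 1] lim_1_over_n[THEN LIMSEQ_Suc]]] by simp
  have "(\<Inter>n. fatten (r n) D) = D"
  proof (intro antisym subsetI)
    fix z assume "z \<in> (\<Inter>n. fatten (r n) D)"
    then have "\<forall>n. \<exists>c. c \<in> {1 / r n..1} \<and> c *\<^sub>R z \<in> D" by (auto simp: fatten_def)
    then obtain c where c: "\<And>n. c n \<in> {1 / r n..1}" "\<And>n. c n *\<^sub>R z \<in> D" by metis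
    have "c \<longlonglongrightarrow> 1"
      by (rule tendsto_sandwich[OF _ _ lim tendsto_const]) (use c in auto)
    then have "(\<lambda>n. c n *\<^sub>R z) \<longlonglongrightarrow> 1 *\<^sub>R z" by (intro tendsto_intros)
    with closed_sequentially[OF D(1)] c(2) show "z \<in> D" by fastforce
  next
    fix z assume "z \<in> D"
    then show "z \<in> (\<Inter>n. fatten (r n) D)"
      using less_imp_le[OF r] by (auto simp: fatten_def intro!: exI[of _ 1] simp: divide_le_eq_1 intro: less_le_trans[OF _ less_imp_le[OF r]])
  qed
  moreover have "(\<lambda>n. measure m (fatten (r n) D)) \<longlonglongrightarrow> measure m (\<Inter>n. fatten (r n) D)"
  proof (rule Lim_measure_decseq)
    show "range (\<lambda>n. fatten (r n) D) \<subseteq> sets m" using closed_fatten[OF D(1)] by auto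
    show "decseq (\<lambda>n. fatten (r n) D)"
    proof (rule decseq_SucI)
      fix n have "r (Suc n) \<le> r n" by (simp add: r_def frac_le)
      then have "1 / r n \<le> 1 / r (Suc n)" using r[of n] r[of "Suc n"] by (intro frac_le) auto
      then show "fatten (r (Suc n)) D \<subseteq> fatten (r n) D"
        unfolding fatten_def atLeastAtMost_iff by (blast intro: order_trans)
    qed
    show "emeasure m (fatten (r n) D) \<noteq> \<infinity>" for n
      using emeasure_mono[OF fatten_tail[OF D(2) \<epsilon> r[of n]], of m] m_tail_finite[OF \<epsilon>] by (auto simp: top_unique less_top)
  qed
  ultimately have "\<forall>\<^sub>F n in sequentially. measure m (fatten (r n) D) < measure m D + e"
    using e by (intro order_tendstoD(2)) auto
  then show ?thesis using r by (auto simp: eventually_sequentially)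
qed

lemma nu_closed:
  assumes D: "closed D" "D \<subseteq> tail i \<epsilon>" and \<epsilon>: "0 < \<epsilon>" and e: "0 < e"
  shows "\<forall>\<^sub>F s in at_top. nu s D \<le> measure m D + e"
proof -
  obtain r where r: "1 < r" "measure m (fatten r D) < measure m D + e / 2"
    using measure_fatten[OF D \<epsilon>, of "e / 2"] e by auto
  have e2: "0 < e / 2" using e by simp
  note up = conv_closed[OF closed_fatten[OF D(1)] fatten_tail[OF D(2) \<epsilon> r(1)] \<epsilon> e2]
  from filterlim_iff[THEN iffD1, OF inverse_U_at_top, rule_format, OF up] b_inverse_U[OF r(1)]
  show ?thesis
  proof eventually_elim
    case (elim s)
    let ?T = "1 / U s"
    have D_sub: "Z \<omega> /\<^sub>R b ?T \<in> fatten r D" if "Z \<omega> /\<^sub>R s \<in> D" for \<omega>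
    proof -
      define B where "B = b ?T"
      have B: "0 < B" "B \<le> s" "s \<le> r * B" using elim by (auto simp: B_def)
      then have "B / s * inverse B = inverse s" by (simp add: field_simps)
      then have "(B / s) *\<^sub>R (Z \<omega> /\<^sub>R B) = Z \<omega> /\<^sub>R s" by simp
      moreover have "B / s \<in> {1 / r..1}" using B r(1) by (simp add: field_simps)
      ultimately show ?thesis unfolding fatten_def B_def[symmetric] using that by fastforce
    qed
    have "fatten r D \<in> sets borel" using closed_fatten[OF D(1)] by simp
    then have "prob {\<omega> \<in> space M. Z \<omega> /\<^sub>R s \<in> D} \<le> prob {\<omega> \<in> space M. Z \<omega> /\<^sub>R b ?T \<in> fatten r D}"
      by (intro finite_measure_mono) (auto intro: D_sub)
    then have "nu s D \<le> ?T * prob {\<omega> \<in> space M. Z \<omega> /\<^sub>R b ?T \<in> fatten r D}"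
      using U_pos[of s] by (simp add: nu_def divide_right_mono)
    with elim r show ?case by linarith
  qed
qed

lemma nu_tail:
  assumes x: "0 < x"
  shows "((\<lambda>s. nu s (tail i x)) \<longlongrightarrow> measure m (tail i x)) at_top"
proof (rule order_tendstoI)
  fix a assume "measure m (tail i x) < a"
  then obtain e where e: "0 < e" "measure m (tail i x) + e < a" using dense[of 0 "a - measure m (tail i x)"] by (auto simp: algebra_simps)
  from nu_closed[OF closed_tail[OF i] order_refl x e(1)] show "\<forall>\<^sub>F s in at_top. nu s (tail i x) < a"
    by eventually_elim (use e in simp)
next
  fix a assume a: "a < measure m (tail i x)"
  have "((\<lambda>y. y powr - \<alpha>) \<longlongrightarrow> x powr - \<alpha>) (at_right x)" using x by (auto intro!: tendsto_eq_intros)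
  then have "\<forall>\<^sub>F y in at_right x. a < y powr - \<alpha>"
    using a G_eq[OF x] by (intro order_tendstoD(1)) (auto simp: G_def)
  then have "\<forall>\<^sub>F y in at_right x. a < y powr - \<alpha> \<and> x < y"
    using eventually_at_right_less by (rule eventually_conj)
  then obtain y where y: "a < y powr - \<alpha>" "x < y" using eventually_happens'[of "at_right x"] by auto
  \<comment> \<open>Two gaps are needed: the ratio \<open>y1 / x\<close> absorbs the mismatch
    between \<open>s\<close> and \<open>b (1 / U s)\<close>, and the interval from \<open>y1\<close>
    to \<open>y\<close> is the one required by \<open>conv_tail_lower\<close>.\<close>
  obtain y1 where y1: "x < y1" "y1 < y" using dense[OF y(2)] by auto
  define e where "e = (y powr - \<alpha> - a) / 2"
  have e: "0 < e" using y by (simp add: e_def)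
  have r: "1 < y1 / x" and y1pos: "0 < y1" using y1 x by auto
  from filterlim_iff[THEN iffD1, OF inverse_U_at_top, rule_format, OF conv_tail_lower[OF y1pos y1(2) e]] b_inverse_U[OF r]
    eventually_gt_at_top[of 0]
  show "\<forall>\<^sub>F s in at_top. a < nu s (tail i x)"
  proof eventually_elim
    case (elim s)
    let ?T = "1 / U s"
    have "x * s \<le> y1 * b ?T" using elim x by (simp add: field_simps)
    then have "prob {\<omega> \<in> space M. y1 < ord_stat i (Z \<omega> /\<^sub>R b ?T)} \<le> prob {\<omega> \<in> space M. Z \<omega> /\<^sub>R s \<in> tail i x}"
      using elim by (intro finite_measure_mono) (auto simp: in_tail_div ord_stat_div less_divide_eq)
    then have "?T * prob {\<omega> \<in> space M. y1 < ord_stat i (Z \<omega> /\<^sub>R b ?T)} \<le> nu s (tail i x)"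
      using U_pos[of s] by (simp add: nu_def divide_right_mono)
    moreover have "G y = y powr - \<alpha>" using x y by (intro G_eq) auto
    moreover have "a < y powr - \<alpha> - e" using y by (simp add: e_def field_simps)
    ultimately show ?case using elim by linarith
  qed
qed

end

section \<open>Portmanteau and Potter bounds\<close>

text \<open>Since \<open>orthant\<close> is closed, closures relative to it are ordinary closures,
  and the portmanteau argument can work in the whole space.\<close>

lemma bdry_eq:
  fixes D :: "(real ^ 'n) set"
  assumes "D \<subseteq> orthant"
  shows "bdry D = closure D \<inter> closure (orthant - D)"
proof -
  have "closure D \<subseteq> orthant" "closure (orthant - D) \<subseteq> orthant"
    by (intro closure_minimal[OF _ closed_orthant] assms Diff_subset)+
  moreover have "orthant \<inter> D = D" "orthant \<inter> (orthant - D) = orthant - D" using assms by auto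
  ultimately show ?thesis
    by (auto simp: bdry_def frontier_of_closures closure_of_subtopology euclidean_closure_of)
qed

lemma bdry_borel: "D \<subseteq> orthant \<Longrightarrow> bdry D \<in> sets (borel :: (real ^ 'n) measure)"
  by (simp add: bdry_eq)

context mrv_vector
begin

lemma nu_mono:
  assumes "D \<subseteq> E" "E \<in> sets borel"
  shows "nu s D \<le> nu s E"
proof -
  note [measurable] = assms(2)
  have "prob {\<omega> \<in> space M. Z \<omega> /\<^sub>R s \<in> D} \<le> prob {\<omega> \<in> space M. Z \<omega> /\<^sub>R s \<in> E}"
    using assms by (intro finite_measure_mono) auto
  then show ?thesis using U_pos[of s] by (simp add: nu_def divide_right_mono)
qed

lemma nu_Diff:
  assumes "D \<subseteq> E" and [measurable]: "D \<in> sets borel" "E \<in> sets borel"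
  shows "nu s (E - D) = nu s E - nu s D"
proof -
  have "prob ({\<omega> \<in> space M. Z \<omega> /\<^sub>R s \<in> E} - {\<omega> \<in> space M. Z \<omega> /\<^sub>R s \<in> D}) =
      prob {\<omega> \<in> space M. Z \<omega> /\<^sub>R s \<in> E} - prob {\<omega> \<in> space M. Z \<omega> /\<^sub>R s \<in> D}"
    using assms(1) by (intro finite_measure_Diff) auto
  moreover have "{\<omega> \<in> space M. Z \<omega> /\<^sub>R s \<in> E} - {\<omega> \<in> space M. Z \<omega> /\<^sub>R s \<in> D} = {\<omega> \<in> space M. Z \<omega> /\<^sub>R s \<in> E - D}"
    by auto
  ultimately show ?thesis by (simp add: nu_def diff_divide_distrib)
qed

text \<open>The closure of \<open>D\<close> bounds it from above. For the lower bound the closed set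
  \<open>?F2\<close> covers \<open>?E - D\<close>, and the mass of \<open>?E\<close> converges
  exactly by \<open>nu_tail\<close>. Either way the loss is at most the boundary mass, which is kept
  explicit because for random preimages it vanishes only in the mean.\<close>

lemma nu_set:
  assumes D [measurable]: "D \<in> sets borel" and sub: "D \<subseteq> tail i \<epsilon>" and \<epsilon>: "0 < \<epsilon>" and e: "0 < e"
  shows "\<forall>\<^sub>F s in at_top. \<bar>nu s D - measure m D\<bar> \<le> measure m (bdry D) + e"
proof -
  let ?E = "tail i \<epsilon>" let ?F1 = "closure D" let ?F2 = "?E \<inter> closure (orthant - D)"
  have orth: "D \<subseteq> orthant" using sub by (auto simp: tail_def)
  have F1: "closed ?F1" "?F1 \<subseteq> ?E" using closure_minimal[OF sub closed_tail[OF i]] by auto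
  have F2: "closed ?F2" "?F2 \<subseteq> ?E" using closed_tail[OF i] by auto
  have Dm: "D \<in> fmeasurable m" by (rule m_subset_fmeasurable[OF \<epsilon> D sub])
  have EDm: "?E - D \<in> fmeasurable m" by (rule m_subset_fmeasurable[OF \<epsilon>]) auto
  have b: "bdry D = closure D \<inter> closure (orthant - D)" by (rule bdry_eq[OF orth])
  have "bdry D \<subseteq> ?E" using F1 b by auto
  then have bm: "bdry D \<in> fmeasurable m" by (intro m_subset_fmeasurable[OF \<epsilon> bdry_borel[OF orth]])
  have cl: "closure D \<subseteq> D \<union> bdry D"
    using closure_subset[of "orthant - D"] closure_minimal[OF orth closed_orthant] by (auto simp: b)
  have F2_sub: "?F2 \<subseteq> (?E - D) \<union> bdry D" using closure_subset[of D] by (auto simp: b)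
  have "measure m ?F1 \<le> measure m (D \<union> bdry D)"
    using cl Dm bm by (intro measure_mono_fmeasurable) (auto simp: fmeasurable.Un)
  also have "\<dots> \<le> measure m D + measure m (bdry D)" using Dm bm by (intro measure_Un_le) auto
  finally have up: "measure m ?F1 \<le> measure m D + measure m (bdry D)" .
  have "measure m ?F2 \<le> measure m ((?E - D) \<union> bdry D)"
    using F2_sub EDm bm F2 by (intro measure_mono_fmeasurable) (auto simp: fmeasurable.Un)
  also have "\<dots> \<le> measure m (?E - D) + measure m (bdry D)" using EDm bm by (intro measure_Un_le) auto
  also have "measure m (?E - D) = measure m ?E - measure m D"
    using sub Dm by (intro measurable_measure_Diff m_fmeasurable \<epsilon>) auto
  finally have lo: "measure m ?F2 \<le> measure m ?E - measure m D + measure m (bdry D)" .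
  have e2: "0 < e / 2" using e by simp
  have "\<forall>\<^sub>F s in at_top. measure m ?E - e / 2 < nu s ?E"
    using e by (intro order_tendstoD(1)[OF nu_tail[OF \<epsilon>]]) auto
  then show ?thesis using nu_closed[OF F1 \<epsilon> e2] nu_closed[OF F2 \<epsilon> e2]
  proof eventually_elim
    case (elim s)
    have "nu s D \<le> nu s ?F1" using F1 by (intro nu_mono closure_subset) auto
    moreover have "nu s (?E - D) \<le> nu s ?F2" using closure_subset[of "orthant - D"] F2
      by (intro nu_mono) (auto simp: tail_def)
    moreover have "nu s (?E - D) = nu s ?E - nu s D" by (intro nu_Diff sub) auto
    ultimately show ?case using elim up lo e by linarith
  qed
qed

section \<open>Convergence of integrals of bounded functions\<close>

lemma integrable_bounded_Z:
  fixes f :: "real ^ 'd \<Rightarrow> real"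
  assumes [measurable]: "f \<in> borel_measurable borel" and "\<And>x. \<bar>f x\<bar> \<le> K"
  shows "integrable M (\<lambda>\<omega>. f (Z \<omega> /\<^sub>R s))"
  by (rule integrable_const_bound[of _ K]) (use assms in auto)

definition J :: "(real ^ 'd \<Rightarrow> real) \<Rightarrow> real \<Rightarrow> real" where
  "J f s = (\<integral>\<omega>. f (Z \<omega> /\<^sub>R s) \<partial>M) / U s"

lemma J_indicator: "D \<in> sets borel \<Longrightarrow> J (indicator D) s = nu s D"
  by (simp add: J_def nu_def prob_as_integral)

lemma J_mono:
  assumes "f \<in> borel_measurable borel" "g \<in> borel_measurable borel"
    and "\<And>x. \<bar>f x\<bar> \<le> K" "\<And>x. \<bar>g x\<bar> \<le> L" and "\<And>x. f x \<le> g x"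
  shows "J f s \<le> J g s"
  unfolding J_def using U_pos[of s] assms
  by (intro divide_right_mono integral_mono integrable_bounded_Z) auto

lemma layer_bounds:
  fixes y :: real and n :: nat
  assumes "0 \<le> y" "y \<le> real n"
  shows "(\<Sum>j = 1..n. of_bool (real j \<le> y)) \<le> y" "y \<le> (\<Sum>j = 1..n. of_bool (real j \<le> y)) + 1"
proof -
  have "{j \<in> {1..n}. real j \<le> y} = {1..nat \<lfloor>y\<rfloor>}" using assms by (auto simp: le_nat_iff le_floor_iff)
  then have "(\<Sum>j = 1..n. of_bool (real j \<le> y)) = real (nat \<lfloor>y\<rfloor>)"
    by (simp add: sum.If_cases of_bool_def Int_def)
  then show "(\<Sum>j = 1..n. of_bool (real j \<le> y)) \<le> y" "y \<le> (\<Sum>j = 1..n. of_bool (real j \<le> y)) + 1"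
    using assms by linarith+
qed

text \<open>A discrete layer-cake formula: \<open>?g\<close> lies between the average of the
  indicators of \<open>{g \<ge> j / n}\<close> inside the tail and that average plus
  \<open>1 / n\<close>. These superlevel sets are closed although \<open>?g\<close> may jump at the
  edge of the tail, so \<open>nu_closed\<close> suffices.\<close>

lemma J_upper:
  fixes g :: "real ^ 'd \<Rightarrow> real"
  assumes g: "continuous_on (tail i \<epsilon>) g" and g01: "\<And>x. x \<in> tail i \<epsilon> \<Longrightarrow> 0 \<le> g x \<and> g x \<le> 1"
    and \<epsilon>: "0 < \<epsilon>" and e: "0 < e"
  shows "\<forall>\<^sub>F s in at_top. J (\<lambda>x. indicator (tail i \<epsilon>) x * g x) s \<le> (\<integral>x. indicator (tail i \<epsilon>) x * g x \<partial>m) + e"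
proof -
  let ?E = "tail i \<epsilon> :: (real ^ 'd) set"
  let ?g = "\<lambda>x. indicator ?E x * g x"
  have gm [measurable]: "?g \<in> borel_measurable borel"
    using borel_measurable_continuous_on_indicator[OF tail_borel[OF i] g] by simp
  \<comment> \<open>The rounding error has limit mass \<open>measure m ?E / real n\<close>, which
    this \<open>n\<close> pushes below a quarter of \<open>e\<close>.\<close>
  obtain n :: nat where n: "4 * (measure m ?E + 1) / e < real n" using reals_Archimedean2 by blast
  moreover have "0 \<le> 4 * (measure m ?E + 1) / e" using e by simp
  ultimately have npos: "0 < real n" by linarith
  have nE: "measure m ?E / real n \<le> e / 4"
    using n npos e by (simp add: field_simps) 
  define c where "c j = {x \<in> ?E. real j / real n \<le> g x}" for j :: nat
  have c: "closed (c j)" "c j \<subseteq> ?E" for j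
  proof -
    have "closed (?E \<inter> g -` {real j / real n..})"
      by (intro continuous_closed_preimage g closed_tail[OF i] closed_atLeast)
    moreover have "?E \<inter> g -` {real j / real n..} = c j" by (auto simp: c_def)
    ultimately show "closed (c j)" by simp
  qed (auto simp: c_def)
  have [measurable]: "c j \<in> sets borel" for j using c by simp
  define h where "h x = (\<Sum>j = 1..n. indicator (c j) x) / real n" for x :: "real ^ 'd"
  have h_eq: "h x = indicator ?E x * ((\<Sum>j = 1..n. of_bool (real j \<le> real n * g x)) / real n)" for x
    using npos by (auto simp: h_def c_def divide_le_eq mult.commute indicator_def of_bool_def intro!: arg_cong[where f = "\<lambda>x. x / real n"] sum.cong)
  have lay: "(\<Sum>j = 1..n. of_bool (real j \<le> real n * g x)) \<le> real n * g x"
    "real n * g x \<le> (\<Sum>j = 1..n. of_bool (real j \<le> real n * g x)) + 1" if "x \<in> ?E" for x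
    using layer_bounds[of "real n * g x" n] g01[OF that] npos by auto
  have h_le: "h x \<le> ?g x" for x
    using lay[of x] npos by (auto simp: h_eq divide_le_eq mult.commute split: split_indicator)
  have g_le: "?g x \<le> h x + indicator ?E x / real n" for x
    using lay[of x] npos by (auto simp: h_eq le_divide_eq add_divide_distrib[symmetric] mult.commute split: split_indicator)
  have bound: "\<bar>indicator D x\<bar> \<le> (1 :: real)" for D and x :: "real ^ 'd" by (auto split: split_indicator)
  have h0: "0 \<le> h x" for x by (auto simp: h_def intro!: sum_nonneg divide_nonneg_nonneg)
  have gb: "\<bar>?g x\<bar> \<le> 1" for x using g01[of x] by (auto split: split_indicator)
  have hb: "\<bar>h x + indicator ?E x / real n\<bar> \<le> 1 + 1 / real n" for x
    using h0[of x] h_le[of x] gb[of x] npos by (auto split: split_indicator)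
  have int_ind: "integrable m (indicator (c j) :: _ \<Rightarrow> real)" for j
    using m_subset_fmeasurable[OF \<epsilon> _ c(2), of j] by (intro integrable_real_indicator) (auto simp: fmeasurable_def)
  have "(\<Sum>j = 1..n. measure m (c j)) / real n = (\<integral>x. h x \<partial>m)"
    unfolding h_def by (simp add: int_ind)
  also have "\<dots> \<le> (\<integral>x. ?g x \<partial>m)"
  proof (rule integral_mono)
    show "integrable m h" unfolding h_def using int_ind by auto
    show "integrable m ?g" by (rule integrable_m[OF gm \<epsilon>, of 1]) (use gb in \<open>auto split: split_indicator_asm\<close>)
  qed (rule h_le)
  finally have lower: "(\<Sum>j = 1..n. measure m (c j)) / real n \<le> (\<integral>x. ?g x \<partial>m)" .
  have int_Z: "integrable M (\<lambda>\<omega>. indicator (c j) (Z \<omega> /\<^sub>R s) :: real)"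
    "integrable M (\<lambda>\<omega>. indicator ?E (Z \<omega> /\<^sub>R s) :: real)" for j s
    by (rule integrable_bounded_Z[OF _ bound], measurable)+
  have J_le: "J ?g s \<le> (\<Sum>j = 1..n. nu s (c j)) / real n + nu s ?E / real n" for s
  proof -
    have "J ?g s \<le> J (\<lambda>x. h x + indicator ?E x / real n) s"
      by (rule J_mono[OF gm _ gb hb g_le]) (unfold h_def, measurable)
    also have "\<dots> = (\<Sum>j = 1..n. J (indicator (c j)) s) / real n + J (indicator ?E) s / real n"
      unfolding J_def h_def
      by (subst Bochner_Integration.integral_add)
        (auto simp: int_Z add_divide_distrib sum_divide_distrib mult.commute)
    finally show ?thesis by (simp add: J_indicator)
  qed
  have e4: "0 < e / 4" using e by simp
  have "\<forall>\<^sub>F s in at_top. \<forall>j\<in>{1..n}. nu s (c j) \<le> measure m (c j) + e / 4"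
    using nu_closed[OF c \<epsilon> e4] by (intro eventually_ball_finite) auto
  then show ?thesis using nu_closed[OF closed_tail[OF i] order_refl \<epsilon> e4]
  proof eventually_elim
    case (elim s)
    have "(\<Sum>j = 1..n. nu s (c j)) / real n \<le> (\<Sum>j = 1..n. measure m (c j) + e / 4) / real n"
      using elim npos by (intro divide_right_mono sum_mono) auto
    also have "\<dots> = (\<Sum>j = 1..n. measure m (c j)) / real n + e / 4"
      using npos by (simp add: sum.distrib add_divide_distrib)
    finally have 1: "(\<Sum>j = 1..n. nu s (c j)) / real n \<le> (\<integral>x. ?g x \<partial>m) + e / 4" using lower by linarith
    have "nu s ?E / real n \<le> (measure m ?E + e / 4) / real n"
      using elim npos by (intro divide_right_mono) auto
    also have "\<dots> = measure m ?E / real n + e / 4 / real n" by (simp add: add_divide_distrib)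
    also have "e / 4 / real n \<le> e / 4" using npos e by (simp add: divide_le_eq)
    finally show ?case using 1 J_le[of s] nE e by linarith
  qed
qed

text \<open>Rescale \<open>g\<close> affinely to \<open>p\<close> with values in [0, 1]. The upper
  bound for \<open>1 - p\<close> turns into the lower bound for \<open>p\<close>, because the mass
  of the tail itself converges.\<close>

lemma J_conv:
  fixes g :: "real ^ 'd \<Rightarrow> real"
  assumes g: "continuous_on (tail i \<epsilon>) g" and gK: "\<And>x. x \<in> tail i \<epsilon> \<Longrightarrow> \<bar>g x\<bar> \<le> K" and \<epsilon>: "0 < \<epsilon>"
  shows "(J (\<lambda>x. indicator (tail i \<epsilon>) x * g x) \<longlongrightarrow> (\<integral>x. indicator (tail i \<epsilon>) x * g x \<partial>m)) at_top"
proof -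
  let ?E = "tail i \<epsilon> :: (real ^ 'd) set"
  \<comment> \<open>The summand 1 makes the divisor \<open>2 * L\<close> positive for every
    \<open>K\<close>.\<close>
  define L where "L = \<bar>K\<bar> + 1"
  have L: "0 < L" "\<And>x. x \<in> ?E \<Longrightarrow> \<bar>g x\<bar> \<le> L" using gK by (force simp: L_def)+
  define p where "p x = (g x + L) / (2 * L)" for x
  have pc: "continuous_on ?E p" unfolding p_def by (intro continuous_intros g) (use L in auto)
  have p01: "0 \<le> p x \<and> p x \<le> 1" if "x \<in> ?E" for x
    using L(2)[OF that] L(1) by (auto simp: p_def abs_le_iff divide_le_eq)
  have q01: "0 \<le> 1 - p x \<and> 1 - p x \<le> 1" if "x \<in> ?E" for x using p01[OF that] by auto
  have qc: "continuous_on ?E (\<lambda>x. 1 - p x)" by (intro continuous_intros pc)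
  have pm [measurable]: "(\<lambda>x. indicator ?E x * p x) \<in> borel_measurable borel"
    using borel_measurable_continuous_on_indicator[OF tail_borel[OF i] pc] by simp
  have pb: "\<bar>indicator ?E x * p x\<bar> \<le> 1" for x using p01[of x] by (auto split: split_indicator)
  have eb: "\<bar>indicator ?E x\<bar> \<le> (1 :: real)" for x :: "real ^ 'd" by (auto split: split_indicator)
  have pi: "integrable m (\<lambda>x. indicator ?E x * p x)"
    by (rule integrable_m[OF pm \<epsilon>, of 1]) (use pb in \<open>auto split: split_indicator_asm\<close>)
  have ei: "integrable m (indicator ?E :: _ \<Rightarrow> real)"
    using m_tail_finite[OF \<epsilon>] by (intro integrable_real_indicator) auto
  have q_eq: "indicator ?E x * (1 - p x) = indicator ?E x - indicator ?E x * p x" for x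
    by (simp add: right_diff_distrib)
  have g_eq: "indicator ?E x * g x = 2 * L * (indicator ?E x * p x) - L * indicator ?E x" for x
    using L(1) by (simp add: p_def field_simps)
  have Jq: "J (\<lambda>x. indicator ?E x * (1 - p x)) s = nu s ?E - J (\<lambda>x. indicator ?E x * p x) s" for s
    unfolding q_eq J_indicator[OF tail_borel[OF i], symmetric] unfolding J_def
    by (subst Bochner_Integration.integral_diff)
      (auto intro: integrable_bounded_Z[OF _ pb] integrable_bounded_Z[OF _ eb] simp: diff_divide_distrib)
  have mq: "(\<integral>x. indicator ?E x * (1 - p x) \<partial>m) = measure m ?E - (\<integral>x. indicator ?E x * p x \<partial>m)"
    unfolding q_eq using pi ei by (subst Bochner_Integration.integral_diff) auto
  have up_p: "\<forall>\<^sub>F s in at_top. J (\<lambda>x. indicator ?E x * p x) s \<le> (\<integral>x. indicator ?E x * p x \<partial>m) + e"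
    and up_q: "\<forall>\<^sub>F s in at_top. J (\<lambda>x. indicator ?E x * (1 - p x)) s \<le> (\<integral>x. indicator ?E x * (1 - p x) \<partial>m) + e"
    if "0 < e" for e
    by (rule J_upper[OF _ _ \<epsilon> that]; use pc qc p01 q01 in blast)+
  have lim: "(J (\<lambda>x. indicator ?E x * p x) \<longlongrightarrow> (\<integral>x. indicator ?E x * p x \<partial>m)) at_top"
  proof (rule tendstoI)
    fix e :: real assume e: "0 < e"
    then have e3: "0 < e / 3" by simp
    have "\<forall>\<^sub>F s in at_top. measure m ?E - e / 3 < nu s ?E"
      using e by (intro order_tendstoD(1)[OF nu_tail[OF \<epsilon>]]) auto
    then show "\<forall>\<^sub>F s in at_top. dist (J (\<lambda>x. indicator ?E x * p x) s) (\<integral>x. indicator ?E x * p x \<partial>m) < e"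
      using up_p[OF e3] up_q[OF e3]
    proof eventually_elim
      case (elim s)
      have "(\<integral>x. indicator ?E x * p x \<partial>m) - (e / 3 + e / 3) < J (\<lambda>x. indicator ?E x * p x) s"
        using elim(1,3) unfolding Jq mq by linarith
      then show ?case using elim(2) e by (simp add: dist_real_def abs_less_iff)
    qed
  qed
  have "J (\<lambda>x. indicator ?E x * g x) = (\<lambda>s. 2 * L * J (\<lambda>x. indicator ?E x * p x) s - L * nu s ?E)"
    unfolding g_eq J_indicator[OF tail_borel[OF i], symmetric] unfolding J_def
    by (rule ext, subst Bochner_Integration.integral_diff)
      (auto intro: integrable_bounded_Z[OF _ pb] integrable_bounded_Z[OF _ eb] simp: diff_divide_distrib)
  moreover have "(\<integral>x. indicator ?E x * g x \<partial>m) = 2 * L * (\<integral>x. indicator ?E x * p x \<partial>m) - L * measure m ?E"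
    unfolding g_eq using pi ei by (subst Bochner_Integration.integral_diff) auto
  ultimately show ?thesis
    using tendsto_diff[OF tendsto_mult_left[OF lim, of "2 * L"] tendsto_mult_left[OF nu_tail[OF \<epsilon>], of L]] by simp
qed

text \<open>As \<open>2 powr - \<alpha>\<close> exceeds \<open>2 powr - \<beta>\<close>, passing
  from \<open>y\<close> to \<open>2 * y\<close> eventually costs \<open>V\<close> a factor at most
  \<open>2 powr \<beta>\<close>; iteration gives the power bound uniformly in the scale. The summand
  1 takes care of \<open>x \<ge> 1\<close>.\<close>

lemma potter:
  assumes \<beta>: "\<alpha> < \<beta>"
  shows "\<exists>K s0. 0 \<le> K \<and> 0 < s0 \<and> (\<forall>s\<ge>s0. \<forall>x>0. nu s (tail i x) \<le> K * (1 + x powr - \<beta>))"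
proof -
  define V where "V y = prob {\<omega> \<in> space M. y \<le> ord_stat i (Z \<omega>)}" for y
  have V_mono: "x \<le> y \<Longrightarrow> V y \<le> V x" for x y unfolding V_def by (intro finite_measure_mono) auto
  have "U y \<le> V y" for y unfolding U_def V_def by (intro finite_measure_mono) auto
  then have V_pos: "0 < V y" for y using U_pos[of y] by (rule less_le_trans[rotated])
  have V_le1: "V y \<le> 1" for y by (simp add: V_def)
  have nuV: "nu s (tail i x) = V (x * s) / U s" if "0 < s" for s x
    unfolding nu_def V_def using that by (intro arg_cong[where f = "\<lambda>A. prob A / U s"]) (auto simp: in_tail_div)
  have t1: "((\<lambda>s. nu s (tail i 1)) \<longlongrightarrow> 1) at_top" using nu_tail[of 1] G_eq[of 1] by (simp add: G_def)
  have t2: "((\<lambda>s. nu s (tail i 2)) \<longlongrightarrow> 2 powr - \<alpha>) at_top" using nu_tail[of 2] G_eq[of 2] by (simp add: G_def)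
  have "((\<lambda>s. nu s (tail i 2) / nu s (tail i 1)) \<longlongrightarrow> 2 powr - \<alpha> / 1) at_top"
    by (intro tendsto_divide t1 t2) auto
  moreover have "2 powr - \<beta> < 2 powr - \<alpha> / 1" using \<beta> by simp
  ultimately have "\<forall>\<^sub>F s in at_top. 2 powr - \<beta> < nu s (tail i 2) / nu s (tail i 1)" by (rule order_tendstoD(1))
  moreover have "\<forall>\<^sub>F s in at_top. nu s (tail i 1) < 2" using t1 by (rule order_tendstoD(2)) simp
  ultimately have "\<forall>\<^sub>F s in at_top. 2 powr - \<beta> < nu s (tail i 2) / nu s (tail i 1) \<and> nu s (tail i 1) < 2"
    by (rule eventually_conj)
  then obtain s1 where s1: "\<And>s. s1 \<le> s \<Longrightarrow> 2 powr - \<beta> < nu s (tail i 2) / nu s (tail i 1) \<and> nu s (tail i 1) < 2"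
    by (auto simp: eventually_at_top_linorder)
  define s0 where "s0 = max s1 1"
  have s0: "0 < s0" by (simp add: s0_def)
  have dbl: "V y \<le> 2 powr \<beta> * V (2 * y)" if "s0 \<le> y" for y
  proof -
    have "0 < y" "s1 \<le> y" using that by (auto simp: s0_def)
    then have "2 powr - \<beta> < V (2 * y) / V y" using s1[of y] nuV[of y 2] nuV[of y 1] U_pos[of y] by simp
    then show ?thesis using V_pos[of y] by (simp add: less_divide_eq powr_minus field_simps)
  qed
  have VU: "V s \<le> 2 * U s" if "s0 \<le> s" for s
    using s1[of s] that nuV[of s 1] U_pos[of s] by (auto simp: s0_def divide_less_eq)
  \<comment> \<open>The prefactor \<open>2 powr \<beta>\<close> pays for the last doubling, which
    may overshoot \<open>s\<close>.\<close>
  have it: "V y \<le> 2 powr \<beta> * (s / y) powr \<beta> * V s" if "s0 \<le> y" "y \<le> s" "s \<le> 2 ^ n * y" for n y s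
    using that
  proof (induction n arbitrary: y)
    case 0
    have "0 < \<beta>" using \<beta> alpha_pos by simp
    then have "1 \<le> 2 powr \<beta> * (s / y) powr \<beta>" using 0 s0 by (auto intro!: ge_one_powr_ge_zero mult_ge1_I simp: one_le_mult_iff)
    moreover have "y = s" using 0 by simp
    ultimately show ?case using V_pos[of s] by simp
  next
    case (Suc n)
    have y: "0 < y" and \<beta>0: "0 < \<beta>" using Suc.prems s0 \<beta> alpha_pos by auto
    show ?case
    proof (cases "2 * y \<le> s")
      case True
      then have "V (2 * y) \<le> 2 powr \<beta> * (s / (2 * y)) powr \<beta> * V s"
        using Suc.prems s0 by (intro Suc.IH) auto
      also have "2 powr \<beta> * (s / (2 * y)) powr \<beta> = (s / y) powr \<beta>"
        using y True by (simp flip: powr_mult)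
      finally have "2 powr \<beta> * V (2 * y) \<le> 2 powr \<beta> * ((s / y) powr \<beta> * V s)" by (intro mult_left_mono) auto
      then show ?thesis using order_trans[OF dbl[OF Suc.prems(1)]] by (simp only: mult.assoc)
    next
      case False
      have "V (2 * y) \<le> 1 * V s" using False by (simp add: V_mono)
      also have "\<dots> \<le> (s / y) powr \<beta> * V s"
        using y Suc.prems \<beta>0 V_pos[of s] by (intro mult_right_mono ge_one_powr_ge_zero) auto
      finally have "2 powr \<beta> * V (2 * y) \<le> 2 powr \<beta> * ((s / y) powr \<beta> * V s)" by (intro mult_left_mono) auto
      then show ?thesis using order_trans[OF dbl[OF Suc.prems(1)]] by (simp only: mult.assoc)
    qed
  qed
  have it': "V y \<le> 2 powr \<beta> * (s / y) powr \<beta> * V s" if "s0 \<le> y" "y \<le> s" for y s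
  proof -
    obtain n where "s / y < 2 ^ n" using real_arch_pow[of 2 "s / y"] by auto
    then show ?thesis using that s0 by (intro it[of _ _ n]) (auto simp: divide_less_eq)
  qed
  \<comment> \<open>Doubling is available only above \<open>s0\<close>. Below it \<open>V\<close> is
    at most 1, which is \<open>V s0 / V s0\<close>; hence the division by
    \<open>V s0\<close>.\<close>
  define K where "K = 2 powr \<beta> / V s0"
  have \<beta>0: "0 < \<beta>" using \<beta> alpha_pos by simp
  have K1: "1 \<le> 2 powr \<beta>" using \<beta>0 by (simp add: ge_one_powr_ge_zero)
  have K2: "2 powr \<beta> \<le> K" using V_pos[of s0] V_le1[of s0] by (simp add: K_def le_divide_eq mult_left_le)
  have main: "V y \<le> K * (1 + (s / y) powr \<beta>) * V s" if "s0 \<le> s" "0 < y" for y s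
  proof -
    let ?q = "(s / y) powr \<beta>"
    consider "s \<le> y" | "y < s" "s0 \<le> y" | "y < s" "y < s0" by linarith
    then show ?thesis
    proof cases
      case 1
      have "1 \<le> K * (1 + ?q)" using K1 K2 mult_mono[of 1 K 1 "1 + ?q"] by auto
      then show ?thesis using V_mono[OF 1] V_pos[of s] by (metis mult_right_mono mult_1 less_imp_le order_trans)
    next
      case 2
      have "2 powr \<beta> * ?q \<le> K * (1 + ?q)" using K1 K2 by (intro mult_mono) auto
      then show ?thesis using it'[of y s] 2 V_pos[of s] by (meson mult_right_mono less_imp_le order_trans)
    next
      case 3
      have "(s / s0) powr \<beta> \<le> ?q" using 3 that \<beta>0 s0 by (intro powr_mono2) (auto intro: frac_le)
      then have "2 powr \<beta> * (s / s0) powr \<beta> * V s \<le> 2 powr \<beta> * ?q * V s"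
        using V_pos[of s] by (intro mult_right_mono mult_left_mono) auto
      with it'[OF order_refl that(1)] have "V s0 \<le> 2 powr \<beta> * ?q * V s" by (rule order_trans)
      then have "1 \<le> K * ?q * V s" using V_pos[of s0] by (simp add: K_def le_divide_eq)
      also have "\<dots> \<le> K * (1 + ?q) * V s" using K1 K2 V_pos[of s] by (intro mult_right_mono mult_left_mono) auto
      finally show ?thesis using V_le1[of y] by linarith
    qed
  qed
  have "nu s (tail i x) \<le> (2 * K) * (1 + x powr - \<beta>)" if s: "s0 \<le> s" and x: "0 < x" for s x
  proof -
    have s': "0 < s" using s s0 by simp
    have "(s / (x * s)) powr \<beta> = x powr - \<beta>" using s' x by (simp add: powr_minus_divide powr_divide)
    then have "V (x * s) \<le> K * (1 + x powr - \<beta>) * V s" using main[OF s, of "x * s"] x s' by simp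
    also have "\<dots> \<le> K * (1 + x powr - \<beta>) * (2 * U s)" using VU[OF s] K1 K2 by (intro mult_left_mono) auto
    finally have "V (x * s) \<le> (2 * K) * (1 + x powr - \<beta>) * U s" by (simp only: mult_ac)
    then show ?thesis using U_pos[of s] unfolding nuV[OF s'] by (subst pos_divide_le_eq)
  qed
  then show ?thesis using K1 K2 s0 by (intro exI[of _ "2 * K"] exI[of _ s0]) auto
qed

end

section \<open>Random matrices\<close>

lemma ennreal_le_of_real_epsilon:
  fixes x :: ennreal
  assumes "\<And>e. 0 < e \<Longrightarrow> x \<le> ennreal (y + e)" "0 \<le> y"
  shows "x \<le> ennreal y"
  by (rule ennreal_le_epsilon) (use assms in \<open>simp flip: ennreal_plus\<close>)

locale mrv_random_matrix = mrv_vector M Z i \<alpha> \<mu>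
  for M :: "'w measure" and Z :: "'w \<Rightarrow> real ^ 'd" and i \<alpha> \<mu> +
  fixes A :: "'w \<Rightarrow> real ^ 'd ^ 'q" and k :: nat
  assumes A_measurable [measurable]: "A \<in> borel_measurable M"
    and A_nonneg: "\<omega> \<in> space M \<Longrightarrow> 0 \<le> A \<omega> $ r $ c"
    and indep: "indep_elements M A Z"
    and k: "k \<in> {1..CARD('q)}"
    and moment: "\<exists>\<delta>>0. Eik M A k i (\<lambda>\<omega>. ennreal (enn2real (tau k i (A \<omega>)) powr (\<alpha> + \<delta>))) < \<infinity>"
begin

abbreviation Om :: "'w set" where "Om \<equiv> Omega M A k i"

definition t :: "'w \<Rightarrow> real" where "t \<omega> = enn2real (tau k i (A \<omega>))"

lemmas [measurable] = borel_measurable_tau[OF k] sets_ik[OF k]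

lemma t_measurable [measurable]: "t \<in> borel_measurable M"
  unfolding t_def by measurable

lemma t_nonneg: "0 \<le> t \<omega>" by (simp add: t_def)

lemma Om_measurable [measurable]: "Om \<in> sets M"
proof -
  have "A -` {B. ik k B = i} \<inter> space M \<in> sets M" by measurable
  then show ?thesis by (simp add: Omega_def vimage_def Int_def conj_commute)
qed

lemma Om_space: "\<omega> \<in> Om \<Longrightarrow> \<omega> \<in> space M" and Om_ik: "\<omega> \<in> Om \<Longrightarrow> ik k (A \<omega>) = i"
  by (auto simp: Omega_def)

lemma Om_tau: "\<omega> \<in> Om \<Longrightarrow> tau k i (A \<omega>) < \<infinity>"
  using ik_properties(2)[OF k, of "A \<omega>"] A_nonneg Om_space Om_ik by metis

text \<open>The random radius on the right is the only way in which the size of \<open>A\<close>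
  enters the estimates that follow.\<close>

lemma Om_preimg_tail: "\<omega> \<in> Om \<Longrightarrow> 0 < \<epsilon> \<Longrightarrow> preimg (A \<omega>) (tail k \<epsilon>) \<subseteq> tail i (\<epsilon> / (t \<omega> + 1))"
  unfolding t_def by (intro preimg_tail_subset k i A_nonneg Om_tau Om_space)

lemma Om_preimg_EE: "\<omega> \<in> Om \<Longrightarrow> preimg (A \<omega>) (EE k) \<subseteq> EE i"
  by (intro preimg_EE_subset k i A_nonneg Om_tau Om_space)

section \<open>Independence and integrable domination\<close>

lemma joint_distr:
  "distr M (borel \<Otimes>\<^sub>M borel) (\<lambda>\<omega>. (A \<omega>, Z \<omega>)) = distr M borel A \<Otimes>\<^sub>M distr M borel Z"
proof (rule pair_measure_eqI[symmetric])
  interpret PA: prob_space "distr M borel A" by (rule prob_space_distr) measurable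
  interpret PZ: prob_space "distr M borel Z" by (rule prob_space_distr) measurable
  show "sigma_finite_measure (distr M borel A)" "sigma_finite_measure (distr M borel Z)" by unfold_locales
  show "sets (distr M borel A \<Otimes>\<^sub>M distr M borel Z) = sets (distr M (borel \<Otimes>\<^sub>M borel) (\<lambda>\<omega>. (A \<omega>, Z \<omega>)))"
    by (simp cong: sets_pair_measure_cong)
  fix S T assume "S \<in> sets (distr M borel A)" "T \<in> sets (distr M borel Z)"
  then have [measurable]: "S \<in> sets borel" "T \<in> sets borel" by simp_all
  have "prob ((A -` S \<inter> space M) \<inter> (Z -` T \<inter> space M)) = prob (A -` S \<inter> space M) * prob (Z -` T \<inter> space M)"
    by (rule indep_setD[OF indep[unfolded indep_elements_def]]) auto
  moreover have "(\<lambda>\<omega>. (A \<omega>, Z \<omega>)) -` (S \<times> T) \<inter> space M = (A -` S \<inter> space M) \<inter> (Z -` T \<inter> space M)" by auto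
  ultimately show "emeasure (distr M borel A) S * emeasure (distr M borel Z) T =
      emeasure (distr M (borel \<Otimes>\<^sub>M borel) (\<lambda>\<omega>. (A \<omega>, Z \<omega>))) (S \<times> T)"
    by (simp add: emeasure_distr emeasure_eq_measure ennreal_mult)
qed

text \<open>Freezes the matrix: under the product law the vector may be integrated with a separate
  \<omega>', after which results for deterministic matrices apply for each \<omega>.\<close>

lemma integral_indep:
  fixes F :: "real ^ 'd ^ 'q \<Rightarrow> real ^ 'd \<Rightarrow> real"
  assumes F [measurable]: "case_prod F \<in> borel_measurable (borel \<Otimes>\<^sub>M borel)" and K: "\<And>B z. \<bar>F B z\<bar> \<le> K"
  shows "(\<integral>\<omega>. F (A \<omega>) (Z \<omega>) \<partial>M) = (\<integral>\<omega>. (\<integral>\<omega>'. F (A \<omega>) (Z \<omega>') \<partial>M) \<partial>M)"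
proof -
  interpret PA: prob_space "distr M borel A" by (rule prob_space_distr) measurable
  interpret PZ: prob_space "distr M borel Z" by (rule prob_space_distr) measurable
  interpret P: pair_prob_space "distr M borel A" "distr M borel Z" ..
  have F': "case_prod F \<in> borel_measurable (distr M borel A \<Otimes>\<^sub>M distr M borel Z)"
    by (subst measurable_cong_sets[OF sets_pair_measure_cong[OF sets_distr sets_distr] refl]) (rule F)
  have int: "integrable (distr M borel A \<Otimes>\<^sub>M distr M borel Z) (case_prod F)"
    by (rule P.P.integrable_const_bound[of _ K]) (use K F' in auto)
  have "(\<integral>\<omega>. F (A \<omega>) (Z \<omega>) \<partial>M) = (\<integral>p. case_prod F p \<partial>distr M (borel \<Otimes>\<^sub>M borel) (\<lambda>\<omega>. (A \<omega>, Z \<omega>)))"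
    by (subst integral_distr) auto
  also have "\<dots> = (\<integral>B. (\<integral>z. F B z \<partial>distr M borel Z) \<partial>distr M borel A)"
    unfolding joint_distr using P.integral_fst'[OF int] by simp
  also have "\<dots> = (\<integral>\<omega>. (\<integral>z. F (A \<omega>) z \<partial>distr M borel Z) \<partial>M)"
    by (rule integral_distr) measurable
  also have "\<dots> = (\<integral>\<omega>. (\<integral>\<omega>'. F (A \<omega>) (Z \<omega>') \<partial>M) \<partial>M)"
    by (intro Bochner_Integration.integral_cong refl integral_distr) measurable
  finally show ?thesis .
qed

text \<open>This integrand is the Potter bound at the random radius. It grows like
  \<open>(t \<omega> + 1) powr \<beta>\<close>, which is at most
  \<open>2 powr \<beta> * (1 + t \<omega> powr \<beta>)\<close>; with
  \<open>\<beta> = \<alpha> + \<delta>\<close> the moment condition integrates it.\<close>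

lemma weight_bound:
  assumes \<epsilon>: "0 < \<epsilon>"
  shows "\<exists>\<beta>>\<alpha>. integrable M (\<lambda>\<omega>. indicator Om \<omega> * (1 + (\<epsilon> / (t \<omega> + 1)) powr - \<beta>))"
proof -
  obtain \<delta> where \<delta>: "0 < \<delta>" "Eik M A k i (\<lambda>\<omega>. ennreal (enn2real (tau k i (A \<omega>)) powr (\<alpha> + \<delta>))) < \<infinity>"
    using moment by blast
  define \<beta> where "\<beta> = \<alpha> + \<delta>"
  have \<beta>: "0 < \<beta>" using \<delta> alpha_pos by (simp add: \<beta>_def)
  have eq: "ennreal (enn2real (tau k i (A \<omega>)) powr (\<alpha> + \<delta>)) * indicator Om \<omega> =
      ennreal (t \<omega> powr \<beta> * indicator Om \<omega>)" for \<omega>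
    by (simp add: t_def \<beta>_def split: split_indicator)
  have "integrable M (\<lambda>\<omega>. t \<omega> powr \<beta> * indicator Om \<omega>)"
    using \<delta>(2) unfolding Eik_def eq by (intro integrableI_nonneg) auto
  then have int: "integrable M (\<lambda>\<omega>. 1 + (\<epsilon> powr - \<beta> * 2 powr \<beta>) * (1 + t \<omega> powr \<beta> * indicator Om \<omega>))" by auto
  have bound: "(\<epsilon> / (s + 1)) powr - \<beta> \<le> (\<epsilon> powr - \<beta> * 2 powr \<beta>) * (1 + s powr \<beta>)" if s: "0 \<le> s" for s
  proof -
    have "(s + 1) powr \<beta> \<le> (2 * max 1 s) powr \<beta>" using s \<beta> by (intro powr_mono2) auto
    also have "\<dots> = 2 powr \<beta> * max 1 s powr \<beta>" by (simp add: powr_mult)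
    also have "max 1 s powr \<beta> \<le> 1 + s powr \<beta>" by (auto simp: max_def)
    finally have *: "(s + 1) powr \<beta> \<le> 2 powr \<beta> * (1 + s powr \<beta>)" by simp
    have "(\<epsilon> / (s + 1)) powr - \<beta> = \<epsilon> powr - \<beta> * (s + 1) powr \<beta>"
      using s \<epsilon> by (simp add: powr_divide powr_minus field_simps)
    with mult_left_mono[OF *, of "\<epsilon> powr - \<beta>"] show ?thesis by (simp add: mult.assoc)
  qed
  have "integrable M (\<lambda>\<omega>. indicator Om \<omega> * (1 + (\<epsilon> / (t \<omega> + 1)) powr - \<beta>))"
  proof (rule Bochner_Integration.integrable_bound[OF int])
    show "(\<lambda>\<omega>. indicator Om \<omega> * (1 + (\<epsilon> / (t \<omega> + 1)) powr - \<beta>)) \<in> borel_measurable M" by measurable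
    show "AE \<omega> in M. norm (indicator Om \<omega> * (1 + (\<epsilon> / (t \<omega> + 1)) powr - \<beta>)) \<le>
      norm (1 + (\<epsilon> powr - \<beta> * 2 powr \<beta>) * (1 + t \<omega> powr \<beta> * indicator Om \<omega>))"
      using bound[OF t_nonneg] by (auto split: split_indicator simp: abs_of_nonneg)
  qed
  moreover have "\<alpha> < \<beta>" using \<delta> by (simp add: \<beta>_def)
  ultimately show ?thesis by blast
qed

text \<open>At the random radius the tail has mass \<open>?x powr - \<alpha>\<close>, which is below
  \<open>1 + ?x powr - \<beta>\<close> whether \<open>?x\<close> is at least 1 or not. So the same
  weight makes the limit measure finite away from the subcone.\<close>

lemma nn_integral_preimg_tail_finite:
  assumes \<epsilon>: "0 < \<epsilon>"
  shows "(\<integral>\<^sup>+\<omega>. emeasure m (preimg (A \<omega>) (tail k \<epsilon>)) * indicator Om \<omega> \<partial>M) < \<infinity>"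
proof -
  obtain \<beta> where \<beta>: "\<alpha> < \<beta>" and int: "integrable M (\<lambda>\<omega>. indicator Om \<omega> * (1 + (\<epsilon> / (t \<omega> + 1)) powr - \<beta>))"
    using weight_bound[OF \<epsilon>] by blast
  have "emeasure m (preimg (A \<omega>) (tail k \<epsilon>)) \<le> ennreal (1 + (\<epsilon> / (t \<omega> + 1)) powr - \<beta>)" if \<omega>: "\<omega> \<in> Om" for \<omega>
  proof -
    let ?x = "\<epsilon> / (t \<omega> + 1)"
    have x: "0 < ?x" using \<epsilon> t_nonneg[of \<omega>] by simp
    have "emeasure m (preimg (A \<omega>) (tail k \<epsilon>)) \<le> emeasure m (tail i ?x)"
      by (intro emeasure_mono Om_preimg_tail \<omega> \<epsilon>) simp
    also have "\<dots> = ennreal (G ?x)" unfolding G_def using m_fmeasurable[OF x] by (intro emeasure_eq_measure2)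
    also have "G ?x = ?x powr - \<alpha>" by (rule G_eq[OF x])
    also have "?x powr - \<alpha> \<le> 1 + ?x powr - \<beta>"
    proof (cases "1 \<le> ?x")
      case True
      then have "?x powr - \<alpha> \<le> 1" using alpha_pos powr_mono[of "- \<alpha>" 0 ?x] x by (auto split: if_splits)
      then show ?thesis using powr_ge_zero[of ?x "- \<beta>"] by linarith
    next
      case False
      then have "?x powr - \<alpha> \<le> ?x powr - \<beta>" using x \<beta> by (intro powr_mono') auto
      then show ?thesis by simp
    qed
    finally show ?thesis by (simp add: ennreal_leI)
  qed
  then have "(\<integral>\<^sup>+\<omega>. emeasure m (preimg (A \<omega>) (tail k \<epsilon>)) * indicator Om \<omega> \<partial>M) \<le>
    (\<integral>\<^sup>+\<omega>. ennreal (indicator Om \<omega> * (1 + (\<epsilon> / (t \<omega> + 1)) powr - \<beta>)) \<partial>M)"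
    by (intro nn_integral_mono) (auto split: split_indicator)
  also have "\<dots> < \<infinity>"
    using integrableD(2)[OF int] by (simp add: abs_of_nonneg less_top)
  finally show ?thesis .
qed

lemma J_mult_bound:
  fixes f :: "real ^ 'q \<Rightarrow> real"
  assumes f [measurable]: "f \<in> borel_measurable borel" and K: "\<And>v. \<bar>f v\<bar> \<le> K"
    and \<epsilon>: "0 < \<epsilon>" and supp: "\<And>v. v \<in> orthant \<Longrightarrow> f v \<noteq> 0 \<Longrightarrow> v \<in> tail k \<epsilon>"
    and \<omega>: "\<omega> \<in> Om" and s: "0 \<le> s"
  shows "\<bar>J (\<lambda>z. f (A \<omega> *v z)) s\<bar> \<le> K * nu s (tail i (\<epsilon> / (t \<omega> + 1)))"
proof -
  let ?E = "tail i (\<epsilon> / (t \<omega> + 1)) :: (real ^ 'd) set"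
  have b: "\<bar>f (A \<omega> *v z)\<bar> \<le> K * indicator ?E z" if z: "z \<in> orthant" for z
  proof (cases "f (A \<omega> *v z) = 0")
    case True
    then show ?thesis using K[of 0] by (auto split: split_indicator)
  next
    case False
    have "A \<omega> *v z \<in> orthant" using z A_nonneg Om_space[OF \<omega>] by (intro mult_vec_orthant) auto
    then have "A \<omega> *v z \<in> tail k \<epsilon>" using False supp by blast
    then have "z \<in> preimg (A \<omega>) (tail k \<epsilon>)" using z by (simp add: preimg_def)
    then have "z \<in> ?E" using Om_preimg_tail[OF \<omega> \<epsilon>] by blast
    then show ?thesis using K by simp
  qed
  have "\<bar>\<integral>\<omega>'. f (A \<omega> *v (Z \<omega>' /\<^sub>R s)) \<partial>M\<bar> \<le> (\<integral>\<omega>'. \<bar>f (A \<omega> *v (Z \<omega>' /\<^sub>R s))\<bar> \<partial>M)"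
    by (rule integral_abs_bound)
  also have "\<dots> \<le> (\<integral>\<omega>'. K * indicator ?E (Z \<omega>' /\<^sub>R s) \<partial>M)"
  proof (rule integral_mono)
    show "integrable M (\<lambda>\<omega>'. \<bar>f (A \<omega> *v (Z \<omega>' /\<^sub>R s))\<bar>)"
      by (rule integrable_const_bound[of _ K]) (use K in auto)
    show "integrable M (\<lambda>\<omega>'. K * indicator ?E (Z \<omega>' /\<^sub>R s))"
      by (rule integrable_const_bound[of _ "\<bar>K\<bar>"]) (auto split: split_indicator)
    show "\<bar>f (A \<omega> *v (Z \<omega>' /\<^sub>R s))\<bar> \<le> K * indicator ?E (Z \<omega>' /\<^sub>R s)" if "\<omega>' \<in> space M" for \<omega>'
      using Z_orthant[OF that] s by (intro b orthant_scaleR) auto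
  qed
  also have "\<dots> = K * prob {\<omega>' \<in> space M. Z \<omega>' /\<^sub>R s \<in> ?E}" by (simp add: prob_as_integral)
  finally show ?thesis using U_pos[of s] by (simp add: J_def nu_def abs_divide divide_right_mono)
qed

text \<open>The defect \<open>h\<close> need not be measurable. This is not a problem: the upper limit of
  \<open>\<bar>J - \<integral>\<bar>\<close> along a sequence is measurable and lies below \<open>h\<close>, hence it vanishes almost
  surely as soon as the (lower) integral of \<open>h\<close> is zero.\<close>

lemma J_mult_conv_AE:
  fixes f :: "real ^ 'q \<Rightarrow> real" and h :: "'w \<Rightarrow> ennreal"
  assumes f [measurable]: "f \<in> borel_measurable borel"
    and h_fin: "\<And>\<omega>. \<omega> \<in> Om \<Longrightarrow> h \<omega> < \<infinity>" and h0: "Eik M A k i h = 0"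
    and near: "\<And>\<omega> e. \<omega> \<in> Om \<Longrightarrow> 0 < e \<Longrightarrow>
      \<forall>\<^sub>F s in at_top. \<bar>J (\<lambda>z. f (A \<omega> *v z)) s - (\<integral>z. f (A \<omega> *v z) \<partial>m)\<bar> \<le> enn2real (h \<omega>) + e"
    and X: "filterlim X at_top sequentially"
  shows "AE \<omega> in M. \<omega> \<in> Om \<longrightarrow> (\<lambda>n. J (\<lambda>z. f (A \<omega> *v z)) (X n)) \<longlonglongrightarrow> (\<integral>z. f (A \<omega> *v z) \<partial>m)"
proof -
  interpret m: sigma_finite_measure m by (rule sigma_finite_m)
  define D where "D n \<omega> = ennreal \<bar>J (\<lambda>z. f (A \<omega> *v z)) (X n) - (\<integral>z. f (A \<omega> *v z) \<partial>m)\<bar>" for n \<omega>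
  have [measurable]: "D n \<in> borel_measurable M" for n
    unfolding D_def J_def by measurable
  define g where "g \<omega> = limsup (\<lambda>n. D n \<omega>) * indicator Om \<omega>" for \<omega>
  have [measurable]: "g \<in> borel_measurable M" unfolding g_def by measurable
  have "g \<omega> \<le> h \<omega> * indicator Om \<omega>" for \<omega>
  proof (cases "\<omega> \<in> Om")
    case True
    have "limsup (\<lambda>n. D n \<omega>) \<le> ennreal (enn2real (h \<omega>))"
    proof (rule ennreal_le_of_real_epsilon)
      fix e :: real assume "0 < e"
      from filterlim_iff[THEN iffD1, OF X, rule_format, OF near[OF True this]]
      have "\<forall>\<^sub>F n in sequentially. D n \<omega> \<le> ennreal (enn2real (h \<omega>) + e)"
        by eventually_elim (simp add: D_def ennreal_leI)
      then show "limsup (\<lambda>n. D n \<omega>) \<le> ennreal (enn2real (h \<omega>) + e)" by (rule Limsup_bounded)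
    qed simp
    then show ?thesis using True h_fin[OF True] by (simp add: g_def)
  qed (simp add: g_def)
  then have "(\<integral>\<^sup>+\<omega>. g \<omega> \<partial>M) \<le> Eik M A k i h" unfolding Eik_def by (rule nn_integral_mono)
  then have "(\<integral>\<^sup>+\<omega>. g \<omega> \<partial>M) = 0" using h0 by simp
  then have "AE \<omega> in M. g \<omega> = 0" by (simp add: nn_integral_0_iff_AE)
  then show ?thesis
  proof eventually_elim
    case (elim \<omega>)
    show ?case
    proof
      assume "\<omega> \<in> Om"
      then have sup: "limsup (\<lambda>n. D n \<omega>) = 0" using elim by (simp add: g_def)
      have "(\<lambda>n. D n \<omega>) \<longlonglongrightarrow> 0"
        by (rule Liminf_eq_Limsup) (use sup Liminf_le_Limsup[of sequentially "\<lambda>n. D n \<omega>"] in auto)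
      then have "(\<lambda>n. \<bar>J (\<lambda>z. f (A \<omega> *v z)) (X n) - (\<integral>z. f (A \<omega> *v z) \<partial>m)\<bar>) \<longlonglongrightarrow> 0"
        unfolding D_def by (subst (asm) ennreal_0[symmetric], subst (asm) tendsto_ennreal_iff) auto
      then show "(\<lambda>n. J (\<lambda>z. f (A \<omega> *v z)) (X n)) \<longlonglongrightarrow> (\<integral>z. f (A \<omega> *v z) \<partial>m)"
        by (simp add: LIM_zero_iff tendsto_rabs_zero_iff)
    qed
  qed
qed

text \<open>Dominated convergence, run along an arbitrary sequence of scales. The parameter
  \<open>h\<close> is the defect tolerated for a fixed matrix: boundary mass for sets, 0 for
  continuous test functions.\<close>

lemma random_conv:
  fixes f :: "real ^ 'q \<Rightarrow> real" and h :: "'w \<Rightarrow> ennreal"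
  assumes f [measurable]: "f \<in> borel_measurable borel" and K: "\<And>v. \<bar>f v\<bar> \<le> K"
    and \<epsilon>: "0 < \<epsilon>" and supp: "\<And>v. v \<in> orthant \<Longrightarrow> f v \<noteq> 0 \<Longrightarrow> v \<in> tail k \<epsilon>"
    and h_fin: "\<And>\<omega>. \<omega> \<in> Om \<Longrightarrow> h \<omega> < \<infinity>" and h0: "Eik M A k i h = 0"
    and near: "\<And>\<omega> e. \<omega> \<in> Om \<Longrightarrow> 0 < e \<Longrightarrow>
      \<forall>\<^sub>F s in at_top. \<bar>J (\<lambda>z. f (A \<omega> *v z)) s - (\<integral>z. f (A \<omega> *v z) \<partial>m)\<bar> \<le> enn2real (h \<omega>) + e"
  shows "((\<lambda>s. (\<integral>\<omega>. indicator Om \<omega> * f ((A \<omega> *v Z \<omega>) /\<^sub>R s) \<partial>M) / U s)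
    \<longlongrightarrow> (\<integral>\<omega>. indicator Om \<omega> * (\<integral>z. f (A \<omega> *v z) \<partial>m) \<partial>M)) at_top"
proof (rule tendsto_at_topI_sequentially)
  fix X :: "nat \<Rightarrow> real" assume X: "filterlim X at_top sequentially"
  interpret m: sigma_finite_measure m by (rule sigma_finite_m)
  obtain \<beta> where \<beta>: "\<alpha> < \<beta>" and int: "integrable M (\<lambda>\<omega>. indicator Om \<omega> * (1 + (\<epsilon> / (t \<omega> + 1)) powr - \<beta>))"
    using weight_bound[OF \<epsilon>] by blast
  obtain C s0 where C: "0 \<le> C" "0 < s0"
    "\<And>s x. s0 \<le> s \<Longrightarrow> 0 < x \<Longrightarrow> nu s (tail i x) \<le> C * (1 + x powr - \<beta>)"
    using potter[OF \<beta>] by blast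
  have K0: "0 \<le> K" using K[of 0] by simp
  \<comment> \<open>The event \<open>Om\<close> depends on \<open>A\<close> alone, so it stays
    outside the inner integral over \<open>Z\<close>.\<close>
  have eq: "(\<integral>\<omega>. indicator Om \<omega> * f ((A \<omega> *v Z \<omega>) /\<^sub>R s) \<partial>M) / U s =
      (\<integral>\<omega>. indicator Om \<omega> * J (\<lambda>z. f (A \<omega> *v z)) s \<partial>M)" for s
  proof -
    define F where "F B z = indicator {B. ik k B = i} B * f (B *v (z /\<^sub>R s))" for B and z :: "real ^ 'd"
    have F: "case_prod F \<in> borel_measurable (borel \<Otimes>\<^sub>M borel)" unfolding F_def by measurable
    have Fb: "\<bar>F B z\<bar> \<le> K" for B z using K K0 by (auto simp: F_def split: split_indicator)
    have ind: "indicator {B. ik k B = i} (A \<omega>) = (indicator Om \<omega> :: real)" if "\<omega> \<in> space M" for \<omega>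
      using that by (auto simp: Omega_def split: split_indicator)
    have "(\<integral>\<omega>. indicator Om \<omega> * f ((A \<omega> *v Z \<omega>) /\<^sub>R s) \<partial>M) = (\<integral>\<omega>. F (A \<omega>) (Z \<omega>) \<partial>M)"
      by (intro Bochner_Integration.integral_cong refl) (simp add: F_def ind matrix_vector_mult_scaleR)
    also have "\<dots> = (\<integral>\<omega>. (\<integral>\<omega>'. F (A \<omega>) (Z \<omega>') \<partial>M) \<partial>M)" by (rule integral_indep[OF F Fb])
    also have "\<dots> = (\<integral>\<omega>. U s * (indicator Om \<omega> * J (\<lambda>z. f (A \<omega> *v z)) s) \<partial>M)"
      using U_pos[of s] by (intro Bochner_Integration.integral_cong refl) (simp add: F_def ind J_def)
    finally show ?thesis using U_pos[of s] by simp
  qed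
  \<comment> \<open>Shifting the sequence by \<open>N\<close> makes the Potter bound valid from the
    first term on, as domination is required for every index.\<close>
  obtain N where N: "\<And>n. N \<le> n \<Longrightarrow> s0 \<le> X n"
    using X unfolding filterlim_at_top eventually_sequentially by blast
  have "(\<lambda>n. \<integral>\<omega>. indicator Om \<omega> * J (\<lambda>z. f (A \<omega> *v z)) (X (n + N)) \<partial>M)
    \<longlonglongrightarrow> (\<integral>\<omega>. indicator Om \<omega> * (\<integral>z. f (A \<omega> *v z) \<partial>m) \<partial>M)"
  proof (rule integral_dominated_convergence[where w = "\<lambda>\<omega>. K * C * (indicator Om \<omega> * (1 + (\<epsilon> / (t \<omega> + 1)) powr - \<beta>))"])
    show "integrable M (\<lambda>\<omega>. K * C * (indicator Om \<omega> * (1 + (\<epsilon> / (t \<omega> + 1)) powr - \<beta>)))"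
      using int by auto
    show "(\<lambda>\<omega>. indicator Om \<omega> * (\<integral>z. f (A \<omega> *v z) \<partial>m)) \<in> borel_measurable M" by measurable
    show "(\<lambda>\<omega>. indicator Om \<omega> * J (\<lambda>z. f (A \<omega> *v z)) (X (n + N))) \<in> borel_measurable M" for n
      unfolding J_def by measurable
    have "AE \<omega> in M. \<omega> \<in> Om \<longrightarrow> (\<lambda>n. J (\<lambda>z. f (A \<omega> *v z)) (X n)) \<longlonglongrightarrow> (\<integral>z. f (A \<omega> *v z) \<partial>m)"
      by (rule J_mult_conv_AE[OF f _ h0 _ X]) (fact h_fin near)+
    then show "AE \<omega> in M. (\<lambda>n. indicator Om \<omega> * J (\<lambda>z. f (A \<omega> *v z)) (X (n + N)))
        \<longlonglongrightarrow> indicator Om \<omega> * (\<integral>z. f (A \<omega> *v z) \<partial>m)"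
    proof eventually_elim
      case (elim \<omega>)
      then show ?case
        by (cases "\<omega> \<in> Om") (auto intro: LIMSEQ_ignore_initial_segment)
    qed
    show "AE \<omega> in M. norm (indicator Om \<omega> * J (\<lambda>z. f (A \<omega> *v z)) (X (n + N))) \<le>
        K * C * (indicator Om \<omega> * (1 + (\<epsilon> / (t \<omega> + 1)) powr - \<beta>))" for n
    proof (rule AE_I2)
      fix \<omega>
      show "norm (indicator Om \<omega> * J (\<lambda>z. f (A \<omega> *v z)) (X (n + N))) \<le>
        K * C * (indicator Om \<omega> * (1 + (\<epsilon> / (t \<omega> + 1)) powr - \<beta>))"
      proof (cases "\<omega> \<in> Om")
        case True
        let ?x = "\<epsilon> / (t \<omega> + 1)"
        have s: "s0 \<le> X (n + N)" by (rule N) simp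
        have x: "0 < ?x" using \<epsilon> t_nonneg[of \<omega>] by simp
        have "\<bar>J (\<lambda>z. f (A \<omega> *v z)) (X (n + N))\<bar> \<le> K * nu (X (n + N)) (tail i ?x)"
          using s C(2) by (intro J_mult_bound[OF f K \<epsilon> supp True]) auto
        also have "\<dots> \<le> K * (C * (1 + ?x powr - \<beta>))"
          using K0 C(3)[OF s x] by (rule mult_left_mono[rotated])
        finally show ?thesis using True by (simp add: mult.assoc)
      qed simp
    qed
  qed
  then show "(\<lambda>n. (\<integral>\<omega>. indicator Om \<omega> * f ((A \<omega> *v Z \<omega>) /\<^sub>R X n) \<partial>M) / U (X n))
    \<longlonglongrightarrow> (\<integral>\<omega>. indicator Om \<omega> * (\<integral>z. f (A \<omega> *v z) \<partial>m) \<partial>M)"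
    unfolding eq by (rule LIMSEQ_offset)
qed

end

section \<open>The limit measure\<close>

lemma preimg_borel:
  fixes B :: "real ^ 'd ^ 'q"
  assumes [measurable]: "C \<in> sets borel"
  shows "preimg B C \<in> sets borel"
proof -
  have "{z. z \<in> orthant \<and> B *v z \<in> C} \<in> sets borel" by measurable
  then show ?thesis by (simp add: preimg_def)
qed

context mrv_random_matrix
begin

lemma indicator_mult_vec:
  "z \<in> orthant \<Longrightarrow> indicator C (B *v z) = (indicator (preimg B C) z :: real)"
  for B :: "real ^ 'd ^ 'q"
  by (auto simp: preimg_def split: split_indicator)

lemma AE_m_orthant: "AE z in m. z \<in> orthant"
  using AE_m_EE by eventually_elim (simp add: EE_def)

lemma set_conv:
  fixes C :: "(real ^ 'q) set"
  assumes C [measurable]: "C \<in> sets borel" and sub: "C \<subseteq> tail k \<epsilon>" and \<epsilon>: "0 < \<epsilon>"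
    and bd: "Eik M A k i (\<lambda>\<omega>. emeasure \<mu> (bdry (preimg (A \<omega>) C))) = 0"
  shows "((\<lambda>s. prob {\<omega> \<in> Om. (A \<omega> *v Z \<omega>) /\<^sub>R s \<in> C} / U s)
    \<longlongrightarrow> enn2real (Eik M A k i (\<lambda>\<omega>. emeasure \<mu> (preimg (A \<omega>) C)))) at_top"
proof -
  interpret m: sigma_finite_measure m by (rule sigma_finite_m)
  define x where "x \<omega> = \<epsilon> / (t \<omega> + 1)" for \<omega>
  have x: "0 < x \<omega>" for \<omega> using \<epsilon> t_nonneg[of \<omega>] by (simp add: x_def)
  define D where "D \<omega> = preimg (A \<omega>) C" for \<omega>
  have Db [measurable]: "D \<omega> \<in> sets borel" for \<omega> unfolding D_def by (rule preimg_borel[OF C])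
  have D_sub: "D \<omega> \<subseteq> tail i (x \<omega>)" if "\<omega> \<in> Om" for \<omega>
    using Om_preimg_tail[OF that \<epsilon>] sub by (auto simp: D_def x_def preimg_def)
  have D_orth: "D \<omega> \<subseteq> orthant" for \<omega> by (auto simp: D_def preimg_def)
  have bd_sub: "bdry (D \<omega>) \<subseteq> tail i (x \<omega>)" if "\<omega> \<in> Om" for \<omega>
    using closure_minimal[OF D_sub[OF that] closed_tail[OF i]] by (auto simp: bdry_eq[OF D_orth])
  have bd_m: "bdry (D \<omega>) \<in> fmeasurable m" and bd_eq: "emeasure \<mu> (bdry (D \<omega>)) = emeasure m (bdry (D \<omega>))"
    if "\<omega> \<in> Om" for \<omega>
    by (rule m_subset_fmeasurable[OF x bdry_borel[OF D_orth] bd_sub[OF that]])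
      (rule emeasure_m_subset[OF bdry_borel[OF D_orth] order_trans[OF bd_sub[OF that] tail_subset_EE[OF i x]], symmetric])
  have D_m: "D \<omega> \<in> fmeasurable m" and D_eq: "emeasure \<mu> (D \<omega>) = emeasure m (D \<omega>)"
    if "\<omega> \<in> Om" for \<omega>
    by (rule m_subset_fmeasurable[OF x Db D_sub[OF that]])
      (rule emeasure_m_subset[OF Db order_trans[OF D_sub[OF that] tail_subset_EE[OF i x]], symmetric])
  \<comment> \<open>\<open>preimg\<close> sees only the orthant, while the integrand lives on the
    whole space; the two agree because \<open>m\<close> has no mass outside the orthant.\<close>
  have intC: "(\<integral>z. indicator C (A \<omega> *v z) \<partial>m) = measure m (D \<omega>)" for \<omega>
  proof -
    have "(\<integral>z. indicator C (A \<omega> *v z) \<partial>m) = (\<integral>z. indicator (D \<omega>) z \<partial>m :: real)"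
    proof (rule integral_cong_AE)
      show "AE z in m. indicator C (A \<omega> *v z) = (indicator (D \<omega>) z :: real)"
        using AE_m_orthant by eventually_elim (simp add: indicator_mult_vec D_def)
    qed measurable
    then show ?thesis by simp
  qed
  have JC: "J (\<lambda>z. indicator C (A \<omega> *v z)) s = nu s (D \<omega>)" if "0 \<le> s" for \<omega> s
  proof -
    have "J (\<lambda>z. indicator C (A \<omega> *v z)) s = J (indicator (D \<omega>)) s"
      unfolding J_def D_def using that Z_orthant
      by (intro arg_cong[where f = "\<lambda>a. a / U s"] Bochner_Integration.integral_cong refl indicator_mult_vec orthant_scaleR) auto
    then show ?thesis by (simp add: J_indicator)
  qed
  have "((\<lambda>s. (\<integral>\<omega>. indicator Om \<omega> * indicator C ((A \<omega> *v Z \<omega>) /\<^sub>R s) \<partial>M) / U s)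
    \<longlongrightarrow> (\<integral>\<omega>. indicator Om \<omega> * (\<integral>z. indicator C (A \<omega> *v z) \<partial>m) \<partial>M)) at_top"
  proof (rule random_conv[where K = 1 and \<epsilon> = \<epsilon> and h = "\<lambda>\<omega>. emeasure \<mu> (bdry (preimg (A \<omega>) C))"])
    show "emeasure \<mu> (bdry (preimg (A \<omega>) C)) < \<infinity>" if "\<omega> \<in> Om" for \<omega>
      using bd_m[OF that] bd_eq[OF that] by (simp add: D_def fmeasurable_def)
    fix \<omega> and e :: real assume \<omega>: "\<omega> \<in> Om" and e: "0 < e"
    have h: "enn2real (emeasure \<mu> (bdry (preimg (A \<omega>) C))) = measure m (bdry (D \<omega>))"
      using bd_eq[OF \<omega>] by (simp add: D_def measure_def)
    show "\<forall>\<^sub>F s in at_top. \<bar>J (\<lambda>z. indicator C (A \<omega> *v z)) s - (\<integral>z. indicator C (A \<omega> *v z) \<partial>m)\<bar>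
        \<le> enn2real (emeasure \<mu> (bdry (preimg (A \<omega>) C))) + e"
      using nu_set[OF Db D_sub[OF \<omega>] x e] eventually_ge_at_top[of 0]
      by eventually_elim (simp add: h JC intC)
  qed (use sub \<epsilon> bd in \<open>auto split: split_indicator split_indicator_asm\<close>)
  moreover have "(\<integral>\<omega>. indicator Om \<omega> * indicator C ((A \<omega> *v Z \<omega>) /\<^sub>R s) \<partial>M)
      = prob {\<omega> \<in> Om. (A \<omega> *v Z \<omega>) /\<^sub>R s \<in> C}" for s
  proof -
    have "(\<integral>\<omega>. indicator Om \<omega> * indicator C ((A \<omega> *v Z \<omega>) /\<^sub>R s) \<partial>M) =
        (\<integral>\<omega>. indicator {\<omega> \<in> Om. (A \<omega> *v Z \<omega>) /\<^sub>R s \<in> C} \<omega> \<partial>M :: real)"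
      by (rule Bochner_Integration.integral_cong) (auto split: split_indicator)
    moreover have "{\<omega> \<in> Om. (A \<omega> *v Z \<omega>) /\<^sub>R s \<in> C} \<subseteq> space M" using Om_space by auto
    ultimately show ?thesis by (simp add: Int_absorb2)
  qed
  moreover have "(\<integral>\<omega>. indicator Om \<omega> * (\<integral>z. indicator C (A \<omega> *v z) \<partial>m) \<partial>M) =
      enn2real (Eik M A k i (\<lambda>\<omega>. emeasure \<mu> (preimg (A \<omega>) C)))"
  proof -
    have [measurable]: "(\<lambda>\<omega>. \<integral>z. indicator C (A \<omega> *v z) \<partial>m :: real) \<in> borel_measurable M" by measurable
    have "(\<integral>\<omega>. indicator Om \<omega> * (\<integral>z. indicator C (A \<omega> *v z) \<partial>m) \<partial>M) =
        enn2real (\<integral>\<^sup>+\<omega>. ennreal (indicator Om \<omega> * (\<integral>z. indicator C (A \<omega> *v z) \<partial>m)) \<partial>M)"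
      by (rule integral_eq_nn_integral) auto
    also have "(\<integral>\<^sup>+\<omega>. ennreal (indicator Om \<omega> * (\<integral>z. indicator C (A \<omega> *v z) \<partial>m)) \<partial>M) =
        Eik M A k i (\<lambda>\<omega>. emeasure \<mu> (preimg (A \<omega>) C))"
      unfolding Eik_def intC
    proof (rule nn_integral_cong)
      fix \<omega> show "ennreal (indicator Om \<omega> * measure m (D \<omega>)) = emeasure \<mu> (preimg (A \<omega>) C) * indicator Om \<omega>"
        using D_m[of \<omega>] D_eq[of \<omega>] by (cases "\<omega> \<in> Om") (auto simp: D_def emeasure_eq_measure2)
    qed
    finally show ?thesis .
  qed
  ultimately show ?thesis by simp
qed

section \<open>Continuous test functions under a random matrix\<close>

lemma test_fun_continuous_orthant:
  fixes f :: "real ^ 'q \<Rightarrow> real"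
  assumes "f \<in> MM_test k"
  shows "continuous_on orthant (\<lambda>v. indicator (EE k) v * f v)"
proof -
  let ?f = "\<lambda>v. indicator (EE k) v * f v"
  obtain \<epsilon> where \<epsilon>: "0 < \<epsilon>" "\<And>x. x \<in> EE k \<Longrightarrow> f x \<noteq> 0 \<Longrightarrow> x \<in> tail k \<epsilon>" and c: "continuous_on (EE k) f"
    using assms unfolding MM_test_iff[OF k] by blast
  \<comment> \<open>A matrix can send points of a tail outside \<open>EE k\<close>, so
    \<open>f\<close> is extended by 0. Continuity is local: \<open>?S\<close> and \<open>?T\<close>
    are relatively open and cover the orthant, and the extension vanishes on
    \<open>?T\<close>.\<close>
  let ?S = "EE k :: (real ^ 'q) set" let ?T = "orthant - tail k \<epsilon> :: (real ^ 'q) set"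
  have un: "?S \<union> ?T = orthant" using tail_subset_EE[OF k \<epsilon>(1)] by (auto simp: EE_def)
  have "open {v :: real ^ 'q. 0 < ord_stat k v}"
    by (intro open_Collect_less continuous_intros k)
  then have "openin (top_of_set orthant) (orthant \<inter> {v :: real ^ 'q. 0 < ord_stat k v})" by (rule openin_open_Int)
  also have "orthant \<inter> {v :: real ^ 'q. 0 < ord_stat k v} = ?S" by (auto simp: EE_eq[OF k])
  finally have S: "openin (top_of_set (?S \<union> ?T)) ?S" unfolding un .
  have "openin (top_of_set orthant) (orthant \<inter> - tail k \<epsilon> :: (real ^ 'q) set)"
    by (intro openin_open_Int open_Compl closed_tail k)
  then have T: "openin (top_of_set (?S \<union> ?T)) ?T" unfolding un by (simp add: Diff_eq)
  have "continuous_on ?S ?f" using c by (rule continuous_on_eq) simp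
  moreover have "continuous_on ?T ?f"
    by (rule continuous_on_eq[of _ "\<lambda>_. 0"]) (use \<epsilon> in \<open>auto split: split_indicator\<close>)
  ultimately show ?thesis using continuous_on_Un_local_open[OF S T] unfolding un by blast
qed

lemma test_fun_properties:
  fixes f :: "real ^ 'q \<Rightarrow> real"
  assumes "f \<in> MM_test k"
  shows "\<exists>K \<epsilon>. 0 < \<epsilon> \<and> (\<forall>v. \<bar>indicator (EE k) v * f v\<bar> \<le> K) \<and>
      (\<forall>v. indicator (EE k) v * f v \<noteq> 0 \<longrightarrow> v \<in> tail k \<epsilon>)"
    and "(\<lambda>v. indicator (EE k) v * f v) \<in> borel_measurable borel"
proof -
  obtain \<epsilon> K where \<epsilon>: "0 < \<epsilon>" "\<And>x. x \<in> EE k \<Longrightarrow> f x \<noteq> 0 \<Longrightarrow> x \<in> tail k \<epsilon>"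
    and K: "\<And>x. x \<in> EE k \<Longrightarrow> \<bar>f x\<bar> \<le> K"
    using assms unfolding MM_test_iff[OF k] by blast
  have "\<bar>indicator (EE k) v * f v\<bar> \<le> \<bar>K\<bar>" for v
    using K[of v] by (auto split: split_indicator)
  moreover have "indicator (EE k) v * f v \<noteq> 0 \<longrightarrow> v \<in> tail k \<epsilon>" for v
    using \<epsilon>(2)[of v] by (auto split: split_indicator_asm)
  ultimately show "\<exists>K \<epsilon>. 0 < \<epsilon> \<and> (\<forall>v. \<bar>indicator (EE k) v * f v\<bar> \<le> K) \<and>
      (\<forall>v. indicator (EE k) v * f v \<noteq> 0 \<longrightarrow> v \<in> tail k \<epsilon>)" using \<epsilon>(1) by blast
  show "(\<lambda>v. indicator (EE k) v * f v) \<in> borel_measurable borel"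
    using MM_test_measurable[OF assms] EE_borel[OF k]
    by (subst (asm) borel_measurable_restrict_space_iff) auto
qed

text \<open>For continuous \<open>g\<close> no boundary defect arises. Given \<open>A\<close>, the
  composed function vanishes off a tail inside the orthant, so cutting it to that tail changes
  nothing and \<open>J_conv\<close> applies.\<close>

lemma test_conv:
  fixes f :: "real ^ 'q \<Rightarrow> real"
  assumes f: "f \<in> MM_test k"
  defines "g \<equiv> \<lambda>v. indicator (EE k) v * f v"
  shows "((\<lambda>s. (\<integral>\<omega>. indicator Om \<omega> * g ((A \<omega> *v Z \<omega>) /\<^sub>R s) \<partial>M) / U s)
    \<longlongrightarrow> (\<integral>\<omega>. indicator Om \<omega> * (\<integral>z. g (A \<omega> *v z) \<partial>m) \<partial>M)) at_top"
proof -
  obtain K \<epsilon> where \<epsilon>: "0 < \<epsilon>" and K: "\<And>v. \<bar>g v\<bar> \<le> K" and supp: "\<And>v. g v \<noteq> 0 \<Longrightarrow> v \<in> tail k \<epsilon>"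
    using test_fun_properties(1)[OF f] unfolding g_def by blast
  have gm [measurable]: "g \<in> borel_measurable borel" unfolding g_def by (rule test_fun_properties(2)[OF f])
  have gc: "continuous_on orthant g" unfolding g_def by (rule test_fun_continuous_orthant[OF f])
  show ?thesis
  proof (rule random_conv[OF gm K \<epsilon> supp, where h = "\<lambda>_. 0"])
    fix \<omega> and e :: real assume \<omega>: "\<omega> \<in> Om" and e: "0 < e"
    define x where "x = \<epsilon> / (t \<omega> + 1)"
    have x: "0 < x" using \<epsilon> t_nonneg[of \<omega>] by (simp add: x_def)
    have orth: "A \<omega> *v z \<in> orthant" if "z \<in> orthant" for z
      using that A_nonneg Om_space[OF \<omega>] by (intro mult_vec_orthant) auto
    have ind: "indicator (tail i x) z * g (A \<omega> *v z) = g (A \<omega> *v z)" if z: "z \<in> orthant" for z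
    proof (cases "g (A \<omega> *v z) = 0")
      case False
      then have "z \<in> preimg (A \<omega>) (tail k \<epsilon>)" using z supp by (simp add: preimg_def)
      then have "z \<in> tail i x" using Om_preimg_tail[OF \<omega> \<epsilon>] by (auto simp: x_def)
      then show ?thesis by simp
    qed simp
    have "continuous_on (tail i x) (\<lambda>z. g (A \<omega> *v z))"
      by (rule continuous_on_compose2[OF gc]) (auto simp: tail_def intro: orth continuous_intros)
    then have "(J (\<lambda>z. indicator (tail i x) z * g (A \<omega> *v z)) \<longlongrightarrow>
        (\<integral>z. indicator (tail i x) z * g (A \<omega> *v z) \<partial>m)) at_top"
      by (rule J_conv[OF _ _ x]) (rule K)
    then have ev: "\<forall>\<^sub>F s in at_top. dist (J (\<lambda>z. indicator (tail i x) z * g (A \<omega> *v z)) s)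
        (\<integral>z. indicator (tail i x) z * g (A \<omega> *v z) \<partial>m) < e"
      using e by (rule tendstoD)
    have int_eq: "(\<integral>z. indicator (tail i x) z * g (A \<omega> *v z) \<partial>m) = (\<integral>z. g (A \<omega> *v z) \<partial>m)"
    proof (rule integral_cong_AE)
      show "AE z in m. indicator (tail i x) z * g (A \<omega> *v z) = g (A \<omega> *v z)"
        using AE_m_orthant by eventually_elim (rule ind)
    qed measurable
    show "\<forall>\<^sub>F s in at_top. \<bar>J (\<lambda>z. g (A \<omega> *v z)) s - (\<integral>z. g (A \<omega> *v z) \<partial>m)\<bar> \<le> enn2real 0 + e"
      using ev eventually_ge_at_top[of 0]
    proof eventually_elim
      case (elim s)
      have "J (\<lambda>z. indicator (tail i x) z * g (A \<omega> *v z)) s = J (\<lambda>z. g (A \<omega> *v z)) s"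
        unfolding J_def using elim Z_orthant
        by (intro arg_cong[where f = "\<lambda>a. a / U s"] Bochner_Integration.integral_cong refl ind orthant_scaleR) auto
      then show ?case using elim by (simp add: dist_real_def int_eq)
    qed
  qed (auto simp: Eik_def)
qed

text \<open>The restriction of \<open>N\<close> to \<open>EE k\<close> turns out to be \<open>mu_bar\<close> when \<open>i\<close> is \<open>istar\<close>.\<close>

definition N :: "(real ^ 'q) measure" where
  "N = distr (density M (\<lambda>\<omega>. ennreal (indicator Om \<omega>)) \<Otimes>\<^sub>M m) borel (\<lambda>(\<omega>, z). A \<omega> *v z)"

lemma finite_density: "finite_measure (density M (\<lambda>\<omega>. ennreal (indicator Om \<omega>)))"
  by (rule finite_measureI) (simp add: emeasure_density emeasure_eq_measure ennreal_indicator nn_integral_cmult_indicator)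

lemma sets_N [simp]: "sets N = sets borel" and space_N [simp]: "space N = UNIV"
  by (simp_all add: N_def)

text \<open>Realising the mixture of the preimage masses as the image of a product measure gives
  countable additivity at once. On \<open>Om\<close> the points of
  \<open>{z. A \<omega> *v z \<in> B}\<close> outside \<open>preimg (A \<omega>) B\<close> lie
  outside \<open>EE i\<close>, where \<open>m\<close> has no mass.\<close>

lemma emeasure_N:
  assumes B [measurable]: "B \<in> sets borel" and sub: "B \<subseteq> EE k"
  shows "emeasure N B = Eik M A k i (\<lambda>\<omega>. emeasure \<mu> (preimg (A \<omega>) B))"
proof -
  let ?M = "density M (\<lambda>\<omega>. ennreal (indicator Om \<omega>))"
  interpret m: sigma_finite_measure m by (rule sigma_finite_m)
  let ?S = "(\<lambda>(\<omega>, z). A \<omega> *v z) -` B \<inter> space (?M \<Otimes>\<^sub>M m)"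
  have S: "?S \<in> sets (?M \<Otimes>\<^sub>M m)" by measurable
  have "emeasure N B = emeasure (?M \<Otimes>\<^sub>M m) ?S"
    unfolding N_def by (rule emeasure_distr) measurable
  also have "\<dots> = (\<integral>\<^sup>+\<omega>. emeasure m (Pair \<omega> -` ?S) \<partial>?M)"
    by (rule m.emeasure_pair_measure_alt[OF S])
  also have "\<dots> = (\<integral>\<^sup>+\<omega>. ennreal (indicator Om \<omega>) * emeasure m (Pair \<omega> -` ?S) \<partial>M)"
    using m.measurable_emeasure_Pair[OF S] unfolding measurable_cong_sets[OF sets_density refl]
    by (intro nn_integral_density) auto
  also have "\<dots> = (\<integral>\<^sup>+\<omega>. emeasure \<mu> (preimg (A \<omega>) B) * indicator Om \<omega> \<partial>M)"
  proof (rule nn_integral_cong)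
    fix \<omega> assume "\<omega> \<in> space M"
    then have "Pair \<omega> -` ?S = {z. A \<omega> *v z \<in> B}" by (auto simp: space_pair_measure)
    moreover have "emeasure m {z. A \<omega> *v z \<in> B} = emeasure \<mu> (preimg (A \<omega>) B)" if "\<omega> \<in> Om"
    proof -
      have "preimg (A \<omega>) B \<subseteq> EE i" using Om_preimg_EE[OF that] sub by (auto simp: preimg_def)
      then have "{z. A \<omega> *v z \<in> B} \<inter> EE i = preimg (A \<omega>) B" by (auto simp: preimg_def EE_def)
      moreover have "{z. A \<omega> *v z \<in> B} \<in> sets borel" by measurable
      ultimately show ?thesis by (simp add: emeasure_m)
    qed
    ultimately show "ennreal (indicator Om \<omega>) * emeasure m (Pair \<omega> -` ?S) =
        emeasure \<mu> (preimg (A \<omega>) B) * indicator Om \<omega>"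
      by (auto split: split_indicator)
  qed
  finally show ?thesis by (simp add: Eik_def)
qed

lemma N_tail_finite:
  assumes \<epsilon>: "0 < \<epsilon>"
  shows "emeasure N (tail k \<epsilon>) < \<infinity>"
proof -
  have "emeasure N (tail k \<epsilon>) = (\<integral>\<^sup>+\<omega>. emeasure m (preimg (A \<omega>) (tail k \<epsilon>)) * indicator Om \<omega> \<partial>M)"
    unfolding emeasure_N[OF tail_borel[OF k] tail_subset_EE[OF k \<epsilon>]] Eik_def
  proof (rule nn_integral_cong)
    fix \<omega>
    have "preimg (A \<omega>) (tail k \<epsilon>) \<subseteq> EE i" if "\<omega> \<in> Om"
      using Om_preimg_EE[OF that] tail_subset_EE[OF k \<epsilon>] by (auto simp: preimg_def)
    then show "emeasure \<mu> (preimg (A \<omega>) (tail k \<epsilon>)) * indicator Om \<omega> =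
        emeasure m (preimg (A \<omega>) (tail k \<epsilon>)) * indicator Om \<omega>"
      by (auto simp: emeasure_m_subset[OF preimg_borel[OF tail_borel[OF k]]] split: split_indicator)
  qed
  then show ?thesis using nn_integral_preimg_tail_finite[OF \<epsilon>] by simp
qed

lemma integral_N:
  fixes g :: "real ^ 'q \<Rightarrow> real"
  assumes g [measurable]: "g \<in> borel_measurable borel" and K: "\<And>v. \<bar>g v\<bar> \<le> K"
    and \<epsilon>: "0 < \<epsilon>" and supp: "\<And>v. g v \<noteq> 0 \<Longrightarrow> v \<in> tail k \<epsilon>"
  shows "(\<integral>v. g v \<partial>N) = (\<integral>\<omega>. indicator Om \<omega> * (\<integral>z. g (A \<omega> *v z) \<partial>m) \<partial>M)"
proof -
  let ?M = "density M (\<lambda>\<omega>. ennreal (indicator Om \<omega>))"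
  interpret m: sigma_finite_measure m by (rule sigma_finite_m)
  interpret D: finite_measure ?M by (rule finite_density)
  interpret P: pair_sigma_finite ?M m ..
  have "integrable N g"
  proof (rule Bochner_Integration.integrable_bound[of N "\<lambda>v. K * indicator (tail k \<epsilon>) v"])
    show "integrable N (\<lambda>v. K * indicator (tail k \<epsilon>) v)"
      using N_tail_finite[OF \<epsilon>] tail_borel[OF k] by (auto intro!: integrable_mult_right integrable_real_indicator)
    have "norm (g v) \<le> norm (K * indicator (tail k \<epsilon>) v)" for v
      using K[of v] supp[of v] by (cases "g v = 0") auto
    then show "AE v in N. norm (g v) \<le> norm (K * indicator (tail k \<epsilon>) v)" by simp
  qed (simp add: measurable_cong_sets[OF sets_N refl])
  then have int: "integrable (?M \<Otimes>\<^sub>M m) (\<lambda>p. g (case p of (\<omega>, z) \<Rightarrow> A \<omega> *v z))"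
    unfolding N_def by (subst (asm) integrable_distr_eq) auto
  have "(\<integral>v. g v \<partial>N) = (\<integral>p. g (case p of (\<omega>, z) \<Rightarrow> A \<omega> *v z) \<partial>(?M \<Otimes>\<^sub>M m))"
    unfolding N_def by (rule integral_distr) auto
  also have "\<dots> = (\<integral>\<omega>. (\<integral>z. g (A \<omega> *v z) \<partial>m) \<partial>?M)"
    using P.integral_fst'[OF int] by simp
  also have "\<dots> = (\<integral>\<omega>. indicator Om \<omega> *\<^sub>R (\<integral>z. g (A \<omega> *v z) \<partial>m) \<partial>M)"
    by (rule integral_density) auto
  finally show ?thesis by simp
qed

text \<open>\<open>measure_of\<close> keeps the prescribed set function only if it is a measure, and
  otherwise yields the zero measure. Agreement with a restriction of \<open>N\<close> rules out the
  degenerate case.\<close>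

lemma measure_of_eq_restrict_N:
  "measure_of (EE k) (sets (restrict_space borel (EE k)))
     (\<lambda>B. Eik M A k i (\<lambda>\<omega>. emeasure \<mu> (preimg (A \<omega>) B))) = restrict_space N (EE k)" (is "?L = ?R")
proof -
  have sets_R: "sets ?R = sets (restrict_space borel (EE k))"
    by (simp cong: sets_restrict_space_cong)
  have space_R: "space ?R = EE k" by (simp add: space_restrict_space)
  have "?L = measure_of (space ?R) (sets ?R) (emeasure ?R)"
    unfolding sets_R space_R
  proof (rule measure_of_eq)
    show "sets (restrict_space borel (EE k)) \<subseteq> Pow (EE k :: (real ^ 'q) set)"
      using sets.space_closed[of ?R] sets_R space_R by simp
    fix B :: "(real ^ 'q) set" assume "B \<in> sigma_sets (EE k) (sets (restrict_space borel (EE k)))"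
    then have "B \<in> sets ?R" using sets.sigma_sets_eq[of ?R] sets_R space_R by simp
    then have B: "B \<in> sets borel" "B \<subseteq> EE k"
      using sets_R EE_borel[OF k] by (auto simp: sets_restrict_space_iff)
    then show "Eik M A k i (\<lambda>\<omega>. emeasure \<mu> (preimg (A \<omega>) B)) = emeasure ?R B"
      using EE_borel[OF k] by (simp add: emeasure_restrict_space emeasure_N)
  qed
  then show ?thesis by (simp add: measure_of_of_measure)
qed

lemma restrict_N_in_MM: "restrict_space N (EE k) \<in> MM k"
proof -
  have "emeasure (restrict_space N (EE k)) B < \<infinity>"
    if B: "B \<in> sets (restrict_space N (EE k))" "bounded_away B (CA (k - 1))" for B
  proof -
    have sub: "B \<subseteq> EE k" using sets.sets_into_space[OF B(1)] by (simp add: space_restrict_space)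
    then have "B \<subseteq> orthant" by (auto simp: EE_def)
    from bounded_away_iff[OF k this] B(2) obtain \<epsilon> where \<epsilon>: "0 < \<epsilon>" "B \<subseteq> tail k \<epsilon>" by blast
    have "emeasure (restrict_space N (EE k)) B = emeasure N B"
      using sub EE_borel[OF k] by (intro emeasure_restrict_space) auto
    also have "\<dots> \<le> emeasure N (tail k \<epsilon>)" using \<epsilon> tail_borel[OF k] by (intro emeasure_mono) auto
    finally show ?thesis using N_tail_finite[OF \<epsilon>(1)] by (rule le_less_trans)
  qed
  then show ?thesis by (auto simp: MM_def cong: sets_restrict_space_cong)
qed

lemma integral_restrict_N:
  fixes f :: "real ^ 'q \<Rightarrow> real"
  assumes f: "f \<in> MM_test k"
  shows "(\<integral>v. f v \<partial>restrict_space N (EE k)) =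
    (\<integral>\<omega>. indicator Om \<omega> * (\<integral>z. indicator (EE k) (A \<omega> *v z) * f (A \<omega> *v z) \<partial>m) \<partial>M)"
proof -
  obtain K \<epsilon> where \<epsilon>: "0 < \<epsilon>" and K: "\<And>v. \<bar>indicator (EE k) v * f v\<bar> \<le> K"
    and supp: "\<And>v. indicator (EE k) v * f v \<noteq> 0 \<Longrightarrow> v \<in> tail k \<epsilon>"
    using test_fun_properties(1)[OF f] by blast
  have "(\<integral>v. f v \<partial>restrict_space N (EE k)) = (\<integral>v. indicator (EE k) v *\<^sub>R f v \<partial>N)"
    using EE_borel[OF k] by (subst integral_restrict_space) auto
  also have "\<dots> = (\<integral>v. indicator (EE k) v * f v \<partial>N)" by simp
  also have "\<dots> = (\<integral>\<omega>. indicator Om \<omega> * (\<integral>z. indicator (EE k) (A \<omega> *v z) * f (A \<omega> *v z) \<partial>m) \<partial>M)"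
    by (rule integral_N[OF test_fun_properties(2)[OF f] K \<epsilon> supp])
  finally show ?thesis .
qed

text \<open>If the mass were 0, the preimage of \<open>EE k\<close> would be null for almost every
  \<omega> in \<open>Om\<close>. It contains a face with \<open>i\<close> positive coordinates,
  whose mass is positive.\<close>

lemma N_EE_nonzero:
  assumes rows: "AE \<omega> in M. \<forall>r. row r (A \<omega>) \<noteq> 0"
    and faces: "\<And>J. card J = i \<Longrightarrow> 0 < emeasure \<mu> (face J)" and Om: "0 < prob Om"
  shows "emeasure N (EE k) \<noteq> 0"
proof
  interpret m: sigma_finite_measure m by (rule sigma_finite_m)
  let ?g = "\<lambda>\<omega>. emeasure m {z. A \<omega> *v z \<in> EE k} * indicator Om \<omega>"
  have [measurable]: "EE k \<in> sets (borel :: (real ^ 'q) measure)" by (rule EE_borel[OF k])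
  have mu_m: "emeasure m {z. A \<omega> *v z \<in> EE k} = emeasure \<mu> (preimg (A \<omega>) (EE k))" if "\<omega> \<in> Om" for \<omega>
  proof -
    have "{z. A \<omega> *v z \<in> EE k} \<inter> EE i = preimg (A \<omega>) (EE k)"
      using Om_preimg_EE[OF that] by (auto simp: preimg_def EE_def)
    moreover have "{z. A \<omega> *v z \<in> EE k} \<in> sets borel" by measurable
    ultimately show ?thesis by (simp add: emeasure_m)
  qed
  have gm: "?g \<in> borel_measurable M" by measurable
  assume "emeasure N (EE k) = 0"
  then have "(\<integral>\<^sup>+\<omega>. emeasure \<mu> (preimg (A \<omega>) (EE k)) * indicator Om \<omega> \<partial>M) = 0"
    by (simp add: emeasure_N Eik_def)
  also have "(\<integral>\<^sup>+\<omega>. emeasure \<mu> (preimg (A \<omega>) (EE k)) * indicator Om \<omega> \<partial>M) = (\<integral>\<^sup>+\<omega>. ?g \<omega> \<partial>M)"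
    by (intro nn_integral_cong) (auto simp: mu_m split: split_indicator)
  finally have "AE \<omega> in M. ?g \<omega> = 0" using gm by (simp add: nn_integral_0_iff_AE)
  with rows have "AE \<omega> in M. \<omega> \<notin> Om"
  proof eventually_elim
    case (elim \<omega>)
    show ?case
    proof
      assume \<omega>: "\<omega> \<in> Om"
      have "\<exists>J. card J = ik k (A \<omega>) \<and> face J \<subseteq> preimg (A \<omega>) (EE k)"
        by (rule face_subset_preimg[OF k]) (use elim A_nonneg Om_space[OF \<omega>] in auto)
      then obtain J where J: "card J = i" "face J \<subseteq> preimg (A \<omega>) (EE k)" using Om_ik[OF \<omega>] by auto
      have "preimg (A \<omega>) (EE k) \<in> sets \<mu>"
        using Om_preimg_EE[OF \<omega>] preimg_borel[OF EE_borel[OF k], of "A \<omega>"]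
        by (auto simp: sets_mu sets_restrict_space_iff)
      then have "emeasure \<mu> (face J) \<le> emeasure \<mu> (preimg (A \<omega>) (EE k))" using J(2) by (intro emeasure_mono)
      also have "\<dots> = 0" using elim \<omega> mu_m[OF \<omega>] by simp
      finally show False using faces[OF J(1)] by simp
    qed
  qed
  then have "prob Om = 0" by (simp add: measure_eq_0_null_sets AE_iff_null_sets)
  then show False using Om by simp
qed

end

section \<open>The theorem\<close>

text \<open>Quantiles far apart are turned into tails far apart: at the time \<open>T\<close> at
  which the smaller order statistic has tail comparable to \<open>1 / T\<close> at \<open>s\<close>,
  the larger one still has tail above \<open>1 / T\<close> at \<open>K * s\<close>, and that is
  about \<open>K powr - \<alpha>\<close> times its tail at \<open>s\<close>.\<close>

lemma tail_prob_ratio_Suc: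
  assumes V: "mrv_vector M Z i \<alpha> \<mu>" and W: "mrv_vector M Z (i + 1) \<alpha>' \<mu>'"
    and b: "filterlim (\<lambda>t. canon_scal M Z i t / canon_scal M Z (i + 1) t) at_top at_top"
  shows "((\<lambda>s. mrv_vector.U M Z (i + 1) s / mrv_vector.U M Z i s) \<longlongrightarrow> 0) at_top"
proof (rule tendstoI)
  interpret V: mrv_vector M Z i \<alpha> \<mu> by fact
  interpret W: mrv_vector M Z "i + 1" \<alpha>' \<mu>' by fact
  fix e :: real assume e: "0 < e"
  have "((\<lambda>K. K powr - \<alpha>) \<longlongrightarrow> 0) at_top"
    using V.alpha_pos by (intro tendsto_neg_powr filterlim_ident) auto
  then have "\<forall>\<^sub>F K in at_top. K powr - \<alpha> < e / 2 \<and> 0 < K"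
    using e by (intro eventually_conj order_tendstoD(2) eventually_gt_at_top) auto
  then obtain K where K: "K powr - \<alpha> < e / 2" "0 < K" by (auto simp: eventually_at_top_linorder)
  have nu_small: "\<forall>\<^sub>F s in at_top. V.nu s (tail i K) < e / 2"
    using K V.G_eq[OF K(2)] by (intro order_tendstoD(2)[OF V.nu_tail[OF K(2)]]) (simp add: V.G_def)
  have "filterlim (\<lambda>s. 1 / W.U s * 2) at_top at_top"
    by (rule filterlim_at_top_mult_tendsto_pos[OF tendsto_const _ W.inverse_U_at_top]) simp
  moreover have ev: "\<forall>\<^sub>F t in at_top. 1 < t \<and> 0 < W.b t \<and> K < V.b t / W.b t"
    using b W.eventually_b_pos unfolding filterlim_at_top_dense
    by (intro eventually_conj eventually_gt_at_top) auto
  ultimately have "\<forall>\<^sub>F s in at_top. 1 < 1 / W.U s * 2 \<and> 0 < W.b (1 / W.U s * 2) \<and>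
      K < V.b (1 / W.U s * 2) / W.b (1 / W.U s * 2)"
    unfolding filterlim_iff by blast
  with nu_small show "\<forall>\<^sub>F s in at_top. dist (W.U s / V.U s) 0 < e"
    using eventually_gt_at_top[of 0]
  proof eventually_elim
    case (elim s)
    \<comment> \<open>The factor 2 makes the tail at \<open>W.b T\<close> strictly smaller than at
      \<open>s\<close>, hence \<open>s < W.b T\<close> even where the scaling jumps.\<close>
    define T where "T = 1 / W.U s * 2"
    have T: "1 < T" "0 < W.b T" "K * W.b T < V.b T" "1 / T = W.U s / 2"
      using elim by (auto simp: T_def less_divide_eq)
    have "s < W.b T"
    proof (rule ccontr)
      assume "\<not> s < W.b T"
      then have "W.U s \<le> W.U (W.b T)" by (intro W.U_antimono) simp
      also have "\<dots> \<le> W.U s / 2" using W.U_b_le[OF T(1)] T(4) by simp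
      finally show False using W.U_pos[of s] by simp
    qed
    then have "K * s < K * W.b T" using K by simp
    then have "K * s < V.b T" using T by simp
    then have 1: "W.U s / 2 < V.U (K * s)" using V.U_below_b[OF T(1)] T(4) by simp
    have "V.U (K * s) \<le> V.prob {\<omega> \<in> space M. Z \<omega> /\<^sub>R s \<in> tail i K}"
      unfolding V.U_def using elim by (intro V.finite_measure_mono) (auto simp: V.in_tail_div)
    also have "\<dots> = V.nu s (tail i K) * V.U s" using V.U_pos[of s] by (simp add: V.nu_def)
    also have "\<dots> < e / 2 * V.U s" using elim V.U_pos[of s] by (intro mult_strict_right_mono) auto
    finally have "W.U s < e * V.U s" using 1 by simp
    then show ?case using V.U_pos[of s] W.U_pos[of s] by (simp add: divide_less_eq)
  qed
qed

text \<open>Terms after \<open>i0\<close> are negligible against \<open>u i0\<close>. Terms before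
  it have larger normalisations in the application, so they have to vanish exactly.\<close>

lemma tendsto_sum_dominant:
  fixes a u :: "nat \<Rightarrow> real \<Rightarrow> real"
  assumes lim: "\<And>i. i \<in> I \<Longrightarrow> ((\<lambda>s. a i s / u i s) \<longlongrightarrow> L i) F" and I: "finite I" "i0 \<in> I"
    and pos: "\<And>i s. i \<in> I \<Longrightarrow> 0 < u i s"
    and before: "\<And>i s. i \<in> I \<Longrightarrow> i < i0 \<Longrightarrow> a i s = 0"
    and after: "\<And>i. i \<in> I \<Longrightarrow> i0 < i \<Longrightarrow> ((\<lambda>s. u i s / u i0 s) \<longlongrightarrow> 0) F"
  shows "((\<lambda>s. (\<Sum>i\<in>I. a i s) / u i0 s) \<longlongrightarrow> L i0) F"
proof -
  have "((\<lambda>s. a i s / u i0 s) \<longlongrightarrow> (if i = i0 then L i0 else 0)) F" if i: "i \<in> I" for i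
  proof -
    consider "i = i0" | "i < i0" | "i0 < i" by linarith
    then show ?thesis
    proof cases
      case 3
      have "((\<lambda>s. a i s / u i s * (u i s / u i0 s)) \<longlongrightarrow> L i * 0) F"
        by (intro tendsto_mult lim after i 3)
      moreover have "a i s / u i s * (u i s / u i0 s) = a i s / u i0 s" for s
        using pos[OF i, of s] by simp
      ultimately show ?thesis using 3 by (simp only: mult_zero_right) simp
    qed (use lim[OF I(2)] before[OF i] in auto)
  qed
  then have "((\<lambda>s. \<Sum>i\<in>I. a i s / u i0 s) \<longlongrightarrow> (\<Sum>i\<in>I. if i = i0 then L i0 else 0)) F"
    by (rule tendsto_sum)
  then show ?thesis using I by (simp add: sum_divide_distrib)
qed

theorem theorem3p7:
  fixes M :: "'w measure"
    and Z :: "'w \<Rightarrow> real ^ 'd"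
    and A :: "'w \<Rightarrow> real ^ 'd ^ 'q"
    and \<alpha> :: "nat \<Rightarrow> real"
    and \<mu> :: "nat \<Rightarrow> (real ^ 'd) measure"
    and k :: nat
    and C :: "(real ^ 'q) set"
  assumes "prob_space M"
    and "Z \<in> borel_measurable M"
    and "\<forall>\<omega>\<in>space M. Z \<omega> \<in> orthant"
    and "\<forall>i\<in>{1..CARD('d)}. MRV_scal M Z (\<alpha> i) (canon_scal M Z i) (\<mu> i) i"
    and "\<forall>i\<in>{1..<CARD('d)}.
           filterlim (\<lambda>t. canon_scal M Z i t / canon_scal M Z (i + 1) t) at_top at_top"
    and "A \<in> borel_measurable M"
    and "\<forall>\<omega>\<in>space M. \<forall>r c. 0 \<le> A \<omega> $ r $ c"
    and "indep_elements M A Z"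
    and "AE \<omega> in M. \<forall>r. row r (A \<omega>) \<noteq> 0"
    and "k \<in> {1..CARD('q)}"
    and "\<forall>i\<in>{1..CARD('d)}. \<exists>\<delta>>0.
           Eik M A k i (\<lambda>\<omega>. ennreal (enn2real (tau k i (A \<omega>)) powr (\<alpha> i + \<delta>))) < \<infinity>"
    and "\<forall>i\<in>{1..CARD('d)}. \<forall>J. card J = i \<longrightarrow> 0 < emeasure (\<mu> i) (face J)"
    and "C \<in> sets borel"
    and "C \<subseteq> EE k"
    and "bounded_away C (CA (k - 1))"
    and "\<forall>i\<in>{1..CARD('d)}. Eik M A k i (\<lambda>\<omega>. emeasure (\<mu> i) (bdry (preimg (A \<omega>) C))) = 0"
  shows
    "(\<forall>i\<in>{1..CARD('d)}. Eik M A k i (\<lambda>\<omega>. emeasure (\<mu> i) (preimg (A \<omega>) C)) < \<infinity>) \<and>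
     (\<exists>\<epsilon> :: nat \<Rightarrow> real \<Rightarrow> real.
        (\<forall>i\<in>{1..CARD('d)}. (\<epsilon> i \<longlongrightarrow> 0) at_top) \<and>
        (\<forall>\<^sub>F t in at_top.
           measure M {\<omega> \<in> space M. A \<omega> *v Z \<omega> \<in> (\<lambda>x. t *\<^sub>R x) ` C} =
           (\<Sum>i = 1..CARD('d). measure M {\<omega> \<in> space M. ord_stat i (Z \<omega>) > t} *
              (enn2real (Eik M A k i (\<lambda>\<omega>. emeasure (\<mu> i) (preimg (A \<omega>) C))) + \<epsilon> i t)))) \<and>
     ((\<lambda>t. measure M {\<omega> \<in> space M. A \<omega> *v Z \<omega> \<in> (\<lambda>x. t *\<^sub>R x) ` C} /
           measure M {\<omega> \<in> space M. ord_stat (istar M A k) (Z \<omega>) > t})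
        \<longlongrightarrow> enn2real (Eik M A k (istar M A k)
               (\<lambda>\<omega>. emeasure (\<mu> (istar M A k)) (preimg (A \<omega>) C)))) at_top \<and>
     (\<forall>B\<in>sets borel. B \<subseteq> EE k \<longrightarrow>
        emeasure (mu_bar M A \<mu> k) B =
        Eik M A k (istar M A k) (\<lambda>\<omega>. emeasure (\<mu> (istar M A k)) (preimg (A \<omega>) B))) \<and>
     MM_conv k
       (\<lambda>t. scaled_law M (\<lambda>\<omega>. A \<omega> *v Z \<omega>) k
              (1 / measure M {\<omega> \<in> space M. ord_stat (istar M A k) (Z \<omega>) > t}) t)
       (mu_bar M A \<mu> k) \<and>
     MRV M (\<lambda>\<omega>. A \<omega> *v Z \<omega>) (\<alpha> (istar M A k)) (mu_bar M A \<mu> k) k"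
proof -
  interpret prob_space M by fact
  let ?I = "{1..CARD('d)}"
  have RM: "mrv_random_matrix M Z i (\<alpha> i) (\<mu> i) A k" if "i \<in> ?I" for i
    using assms that by unfold_locales auto
  have VV: "mrv_vector M Z i (\<alpha> i) (\<mu> i)" if "i \<in> ?I" for i
    using RM[OF that] by (rule mrv_random_matrix.axioms(1))

  \<comment> \<open>Comparison of the tails of all order statistics\<close>
  define u where "u i = mrv_vector.U M Z i" for i
  have u_eq: "u i s = measure M {\<omega> \<in> space M. s < ord_stat i (Z \<omega>)}" if "i \<in> ?I" for i s
    unfolding u_def by (rule mrv_vector.U_def[OF VV[OF that]])
  have u_pos: "0 < u i s" if "i \<in> ?I" for i s
    unfolding u_def by (rule mrv_vector.U_pos[OF VV[OF that]])
  have u_ratio_Suc: "((\<lambda>s. u (i + 1) s / u i s) \<longlongrightarrow> 0) at_top" if "i \<in> {1..<CARD('d)}" for i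
    unfolding u_def using assms(5) that by (intro tail_prob_ratio_Suc[OF VV VV]) auto
  \<comment> \<open>Ratios of consecutive tails are multiplied; positivity of \<open>u\<close>
    permits the cancellation.\<close>
  have u_ratio_add: "((\<lambda>s. u (i + Suc n) s / u i s) \<longlongrightarrow> 0) at_top" if "i \<in> ?I" "i + Suc n \<in> ?I" for i n
    using that(2)
  proof (induction n)
    case 0
    then show ?case using u_ratio_Suc[of i] that(1) by simp
  next
    case (Suc n)
    have "((\<lambda>s. u (i + Suc n + 1) s / u (i + Suc n) s * (u (i + Suc n) s / u i s)) \<longlongrightarrow> 0 * 0) at_top"
      using Suc that(1) by (intro tendsto_mult u_ratio_Suc) auto
    moreover have "u (i + Suc n + 1) s / u (i + Suc n) s * (u (i + Suc n) s / u i s) = u (i + Suc (Suc n)) s / u i s" for s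
      using u_pos[of "i + Suc n" s] Suc.prems that(1) by simp
    ultimately show ?case by (simp only: mult_zero_right)
  qed
  have u_ratio: "((\<lambda>s. u j s / u i s) \<longlongrightarrow> 0) at_top" if "i \<in> ?I" "j \<in> ?I" "i < j" for i j
    using u_ratio_add[of i "j - Suc i"] that by simp

  \<comment> \<open>Partition of the sample space by the index of the matrix\<close>
  define Om where "Om = Omega M A k"
  have k: "k \<in> {1..CARD('q)}" by fact
  have Om_sets [measurable]: "Om i \<in> sets M" if "i \<in> ?I" for i
    unfolding Om_def by (rule mrv_random_matrix.Om_measurable[OF RM[OF that]])
  have ik_range: "ik k (A \<omega>) \<in> ?I" if "\<omega> \<in> space M" for \<omega>
    using assms(7) that by (intro ik_properties(1)[OF k]) auto
  have ind_sum: "(\<Sum>i\<in>?I. indicator (Om i) \<omega>) = (1 :: real)" if "\<omega> \<in> space M" for \<omega>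
  proof -
    have "(\<Sum>i\<in>?I. indicator (Om i) \<omega>) = (\<Sum>i\<in>?I. if i = ik k (A \<omega>) then 1 else 0 :: real)"
      using that by (intro sum.cong) (auto simp: Om_def Omega_def)
    then show ?thesis using ik_range[OF that] by simp
  qed
  have split: "(\<integral>\<omega>. g \<omega> \<partial>M) = (\<Sum>i\<in>?I. \<integral>\<omega>. indicator (Om i) \<omega> * g \<omega> \<partial>M)"
    if g: "integrable M g" for g :: "'w \<Rightarrow> real"
  proof -
    have "(\<integral>\<omega>. g \<omega> \<partial>M) = (\<integral>\<omega>. (\<Sum>i\<in>?I. indicator (Om i) \<omega> * g \<omega>) \<partial>M)"
      by (intro Bochner_Integration.integral_cong refl) (simp only: sum_distrib_right[symmetric] ind_sum mult_1)
    also have "\<dots> = (\<Sum>i\<in>?I. \<integral>\<omega>. indicator (Om i) \<omega> * g \<omega> \<partial>M)"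
    proof (rule Bochner_Integration.integral_sum)
      fix i assume "i \<in> ?I"
      from integrable_mult_indicator[OF Om_sets[OF this] g]
      show "integrable M (\<lambda>\<omega>. indicator (Om i) \<omega> * g \<omega>)" by simp
    qed
    finally show ?thesis .
  qed

  \<comment> \<open>The first index of positive probability\<close>
  define i0 where "i0 = istar M A k"
  let ?P = "{i \<in> ?I. 0 < prob (Om i)}"
  \<comment> \<open>Needed to make the minimum in \<open>istar\<close> meaningful: the finitely many
    probabilities sum to 1.\<close>
  have "?P \<noteq> {}"
  proof
    assume "?P = {}"
    then have "prob (Om i) = 0" if "i \<in> ?I" for i using that by (auto simp: less_le)
    moreover have "1 = (\<Sum>i\<in>?I. prob (Om i))"
      using split[of "\<lambda>_. 1"] Om_sets sets.sets_into_space by (simp add: prob_space Int_absorb2)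
    ultimately show False by simp
  qed
  then have "Min ?P \<in> ?P" by (intro Min_in) auto
  then have i0: "i0 \<in> ?I" "0 < prob (Om i0)" by (simp_all add: i0_def istar_def Om_def)
  have before: "(\<integral>\<omega>. indicator (Om i) \<omega> * g \<omega> \<partial>M) = 0" if i: "i \<in> ?I" "i < i0" for i and g :: "'w \<Rightarrow> real"
  proof -
    have "\<not> 0 < prob (Om i)"
    proof
      assume "0 < prob (Om i)"
      then have "Min ?P \<le> i" using i by (intro Min_le) auto
      then show False using i(2) by (simp add: i0_def istar_def Om_def)
    qed
    then have "prob (Om i) = 0" by (simp add: less_le)
    then have "AE \<omega> in M. \<omega> \<notin> Om i"
      using Om_sets[OF i(1)] by (subst AE_iff_null_sets[symmetric]) (auto simp: emeasure_eq_measure null_sets_def)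
    then have "AE \<omega> in M. indicator (Om i) \<omega> * g \<omega> = 0" by eventually_elim simp
    then show ?thesis by (rule integral_eq_zero_AE)
  qed

  interpret R: mrv_random_matrix M Z i0 "\<alpha> i0" "\<mu> i0" A k by (rule RM[OF i0(1)])
  note [measurable] = assms(2,6)
  let ?X = "\<lambda>\<omega>. A \<omega> *v Z \<omega>"
  have X [measurable]: "?X \<in> borel_measurable M" by measurable
  have X_orth: "?X \<omega> \<in> orthant" if "\<omega> \<in> space M" for \<omega>
    using assms(3,7) that by (intro mult_vec_orthant) auto
  \<comment> \<open>Common final step for the indicator of \<open>C\<close> and for test functions:
    limits on the individual pieces, each with its own normalisation, combine to the limit on the
    piece \<open>i0\<close> alone.\<close>
  have dominant: "((\<lambda>s. (\<integral>\<omega>. f (?X \<omega> /\<^sub>R s) \<partial>M) / u i0 s) \<longlongrightarrow> L i0) at_top"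
    if f: "f \<in> borel_measurable borel" "\<And>v. \<bar>f v\<bar> \<le> K"
    and lim: "\<And>i. i \<in> ?I \<Longrightarrow> ((\<lambda>s. (\<integral>\<omega>. indicator (Om i) \<omega> * f (?X \<omega> /\<^sub>R s) \<partial>M) / u i s) \<longlongrightarrow> L i) at_top"
    for f :: "real ^ 'q \<Rightarrow> real" and K L
  proof -
    note [measurable] = f(1)
    have "integrable M (\<lambda>\<omega>. f (?X \<omega> /\<^sub>R s))" for s
      by (rule integrable_const_bound[of _ K]) (use f(2) in auto)
    from split[OF this] show ?thesis
      using tendsto_sum_dominant[of ?I "\<lambda>i s. \<integral>\<omega>. indicator (Om i) \<omega> * f (?X \<omega> /\<^sub>R s) \<partial>M" u L at_top i0]
        lim i0(1) u_pos before u_ratio by simp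
  qed

  \<comment> \<open>The expansion and the limit for the set \<open>C\<close>\<close>
  obtain \<epsilon> where \<epsilon>: "0 < \<epsilon>" "C \<subseteq> tail k \<epsilon>"
    using bounded_away_iff[OF k, of C] assms(14,15) by (auto simp: EE_def)
  define E where "E i = Eik M A k i (\<lambda>\<omega>. emeasure (\<mu> i) (preimg (A \<omega>) C))" for i
  \<comment> \<open>Finiteness guarantees that \<open>enn2real (E i)\<close> represents the true
    expectation instead of the default 0 for infinity.\<close>
  have E_fin: "E i < \<infinity>" if i: "i \<in> ?I" for i
  proof -
    interpret Ri: mrv_random_matrix M Z i "\<alpha> i" "\<mu> i" A k by (rule RM[OF i])
    have "E i = emeasure Ri.N C" unfolding E_def using assms(13,14) by (rule Ri.emeasure_N[symmetric])
    also have "\<dots> \<le> emeasure Ri.N (tail k \<epsilon>)" using \<epsilon>(2) tail_borel[OF k] by (intro emeasure_mono) auto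
    finally show ?thesis using Ri.N_tail_finite[OF \<epsilon>(1)] by (rule le_less_trans)
  qed
  have C [measurable]: "C \<in> sets borel" by fact
  have ind_Om: "(\<integral>\<omega>. indicator (Om i) \<omega> * indicator C (?X \<omega> /\<^sub>R s) \<partial>M) = prob {\<omega> \<in> Om i. ?X \<omega> /\<^sub>R s \<in> C}"
    for i s
  proof -
    have "(\<integral>\<omega>. indicator (Om i) \<omega> * indicator C (?X \<omega> /\<^sub>R s) \<partial>M) =
        (\<integral>\<omega>. indicator {\<omega> \<in> Om i. ?X \<omega> /\<^sub>R s \<in> C} \<omega> \<partial>M :: real)"
      by (rule Bochner_Integration.integral_cong) (auto split: split_indicator)
    moreover have "{\<omega> \<in> Om i. ?X \<omega> /\<^sub>R s \<in> C} \<subseteq> space M" by (auto simp: Om_def Omega_def)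
    ultimately show ?thesis by (simp add: Int_absorb2)
  qed
  have set_lim: "((\<lambda>s. prob {\<omega> \<in> Om i. ?X \<omega> /\<^sub>R s \<in> C} / u i s) \<longlongrightarrow> enn2real (E i)) at_top" if i: "i \<in> ?I" for i
    unfolding Om_def u_def E_def using assms(16) i
    by (intro mrv_random_matrix.set_conv[OF RM[OF i] C \<epsilon>(2,1)]) auto
  define p where "p s = measure M {\<omega> \<in> space M. ?X \<omega> \<in> (\<lambda>x. s *\<^sub>R x) ` C}" for s
  have p_eq: "p s = (\<integral>\<omega>. indicator C (?X \<omega> /\<^sub>R s) \<partial>M)" if s: "0 < s" for s
  proof -
    have "x \<in> (\<lambda>x. s *\<^sub>R x) ` C \<longleftrightarrow> x /\<^sub>R s \<in> C" for x
      using s by (auto simp: image_iff intro!: bexI[of _ "x /\<^sub>R s"])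
    then have "p s = prob {\<omega> \<in> space M. ?X \<omega> /\<^sub>R s \<in> C}" by (simp add: p_def)
    also have "\<dots> = (\<integral>\<omega>. indicator {\<omega> \<in> space M. ?X \<omega> /\<^sub>R s \<in> C} \<omega> \<partial>M)" by simp
    also have "\<dots> = (\<integral>\<omega>. indicator C (?X \<omega> /\<^sub>R s) \<partial>M)"
      by (rule Bochner_Integration.integral_cong) (auto split: split_indicator)
    finally show ?thesis .
  qed
  have ind_bound: "\<bar>indicator C v\<bar> \<le> (1 :: real)" for v by (auto split: split_indicator)
  have p_lim: "((\<lambda>s. p s / u i0 s) \<longlongrightarrow> enn2real (E i0)) at_top"
  proof -
    have "((\<lambda>s. (\<integral>\<omega>. indicator C (?X \<omega> /\<^sub>R s) \<partial>M) / u i0 s) \<longlongrightarrow> enn2real (E i0)) at_top"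
      by (rule dominant[OF _ ind_bound]) (simp_all add: ind_Om set_lim)
    moreover have "\<forall>\<^sub>F s in at_top. (\<integral>\<omega>. indicator C (?X \<omega> /\<^sub>R s) \<partial>M) / u i0 s = p s / u i0 s"
      using eventually_gt_at_top[of 0] by eventually_elim (simp add: p_eq)
    ultimately show ?thesis by (rule Lim_transform_eventually)
  qed
  \<comment> \<open>Defined as the exact remainder, so the expansion is an identity for every
    \<open>s > 0\<close>; the content lies in \<open>err\<close> tending to 0.\<close>
  define err where "err i s = prob {\<omega> \<in> Om i. ?X \<omega> /\<^sub>R s \<in> C} / u i s - enn2real (E i)" for i s
  have err: "(err i \<longlongrightarrow> 0) at_top" if "i \<in> ?I" for i
    unfolding err_def using set_lim[OF that] by (rule LIM_zero)
  have expansion: "p s = (\<Sum>i\<in>?I. u i s * (enn2real (E i) + err i s))" if s: "0 < s" for s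
  proof -
    have "p s = (\<Sum>i\<in>?I. prob {\<omega> \<in> Om i. ?X \<omega> /\<^sub>R s \<in> C})"
      unfolding p_eq[OF s] ind_Om[symmetric]
      by (rule split, rule integrable_const_bound[of _ 1]) (auto split: split_indicator)
    also have "\<dots> = (\<Sum>i\<in>?I. u i s * (enn2real (E i) + err i s))"
      using u_pos by (intro sum.cong) (auto simp: err_def less_imp_neq[symmetric])
    finally show ?thesis .
  qed

  \<comment> \<open>The limit measure and convergence on the subcone\<close>
  have mb: "mu_bar M A \<mu> k = restrict_space R.N (EE k)"
    unfolding mu_bar_def i0_def[symmetric] by (rule R.measure_of_eq_restrict_N)
  have mb_emeasure: "emeasure (mu_bar M A \<mu> k) B = Eik M A k i0 (\<lambda>\<omega>. emeasure (\<mu> i0) (preimg (A \<omega>) B))"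
    if "B \<in> sets borel" "B \<subseteq> EE k" for B
    unfolding mb using that EE_borel[OF k] by (simp add: emeasure_restrict_space R.emeasure_N)
  have test_lim: "((\<lambda>s. (\<integral>\<omega>. indicator (EE k) (?X \<omega> /\<^sub>R s) * f (?X \<omega> /\<^sub>R s) \<partial>M) / u i0 s)
      \<longlongrightarrow> (\<integral>v. f v \<partial>mu_bar M A \<mu> k)) at_top" if f: "f \<in> MM_test k" for f
  proof -
    obtain K where K: "\<And>v. \<bar>indicator (EE k) v * f v\<bar> \<le> K" using R.test_fun_properties(1)[OF f] by blast
    have *: "((\<lambda>s. (\<integral>\<omega>. indicator (Om i) \<omega> * (indicator (EE k) (?X \<omega> /\<^sub>R s) * f (?X \<omega> /\<^sub>R s)) \<partial>M) / u i s)
      \<longlongrightarrow> (\<integral>\<omega>. indicator (Om i) \<omega> * (\<integral>z. indicator (EE k) (A \<omega> *v z) * f (A \<omega> *v z) \<partial>mrv_vector.m (\<mu> i)) \<partial>M)) at_top"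
      if i: "i \<in> ?I" for i
      unfolding Om_def u_def by (rule mrv_random_matrix.test_conv[OF RM[OF i] f])
    show ?thesis
      unfolding mb R.integral_restrict_N[OF f] Om_def[symmetric]
      by (rule dominant[OF R.test_fun_properties(2)[OF f] K *])
  qed
  have scaled: "(\<integral>v. f v \<partial>scaled_law M ?X k c s) =
      c * (\<integral>\<omega>. indicator (EE k) (?X \<omega> /\<^sub>R s) * f (?X \<omega> /\<^sub>R s) \<partial>M)" if "f \<in> MM_test k" "0 \<le> c" for f c s
    by (rule integral_scaled_law[OF k X that(2) MM_test_measurable[OF that(1)]])
  have law_MM: "scaled_law M ?X k c s \<in> MM k" for c s
    by (rule scaled_law_in_MM[OF k _ X]) unfold_locales
  have mb_MM: "mu_bar M A \<mu> k \<in> MM k" unfolding mb by (rule R.restrict_N_in_MM)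
  have MM1: "MM_conv k (\<lambda>s. scaled_law M ?X k (1 / u i0 s) s) (mu_bar M A \<mu> k)"
    unfolding MM_conv_def
  proof (intro conjI ballI)
    fix f :: "real ^ 'q \<Rightarrow> real" assume f: "f \<in> MM_test k"
    show "((\<lambda>s. \<integral>x. f x \<partial>scaled_law M ?X k (1 / u i0 s) s) \<longlongrightarrow> (\<integral>x. f x \<partial>mu_bar M A \<mu> k)) at_top"
      using test_lim[OF f] less_imp_le[OF u_pos[OF i0(1)]] by (simp add: scaled[OF f])
  qed (simp_all add: law_MM mb_MM)
  \<comment> \<open>The canonical scaling of the \<open>i0\<close>-th order statistic also scales
    \<open>A Z\<close>: substitute \<open>s = R.b t\<close>, which tends to infinity, and replace
    \<open>1 / u i0 s\<close> by \<open>t\<close> using \<open>R.t_U_b\<close>.\<close>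
  have MM2: "MM_conv k (\<lambda>s. scaled_law M ?X k s (R.b s)) (mu_bar M A \<mu> k)"
    unfolding MM_conv_def
  proof (intro conjI ballI)
    fix f :: "real ^ 'q \<Rightarrow> real" assume f: "f \<in> MM_test k"
    define I where "I s = (\<integral>\<omega>. indicator (EE k) (?X \<omega> /\<^sub>R s) * f (?X \<omega> /\<^sub>R s) \<partial>M)" for s
    have "((\<lambda>t. t * u i0 (R.b t) * (I (R.b t) / u i0 (R.b t))) \<longlongrightarrow> 1 * (\<integral>v. f v \<partial>mu_bar M A \<mu> k)) at_top"
      unfolding I_def
      by (intro tendsto_mult filterlim_compose[OF test_lim[OF f] R.b_at_top]) (simp add: u_def R.t_U_b)
    moreover have "\<forall>\<^sub>F t in at_top. t * u i0 (R.b t) * (I (R.b t) / u i0 (R.b t)) = (\<integral>x. f x \<partial>scaled_law M ?X k t (R.b t))"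
      using eventually_ge_at_top[of 0]
    proof eventually_elim
      case (elim t)
      then show ?case using u_pos[OF i0(1), of "R.b t"] by (simp add: scaled[OF f] I_def)
    qed
    ultimately show "((\<lambda>s. \<integral>x. f x \<partial>scaled_law M ?X k s (R.b s)) \<longlongrightarrow> (\<integral>x. f x \<partial>mu_bar M A \<mu> k)) at_top"
      using Lim_transform_eventually by fastforce
  qed (simp_all add: law_MM mb_MM)
  have "emeasure R.N (EE k) \<noteq> 0"
    using assms(9,12) i0 by (intro R.N_EE_nonzero) (auto simp: Om_def)
  then have "emeasure (mu_bar M A \<mu> k) (EE k) \<noteq> 0"
    unfolding mb using EE_borel[OF k] by (simp add: emeasure_restrict_space)
  moreover have "R.b \<in> RV (1 / \<alpha> i0)" using R.mrv by (simp add: MRV_scal_def)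
  ultimately have "MRV_scal M ?X (\<alpha> i0) R.b (mu_bar M A \<mu> k) k"
    unfolding MRV_scal_def using X X_orth R.alpha_pos mb_MM MM2 by blast
  then have mrv: "MRV M ?X (\<alpha> i0) (mu_bar M A \<mu> k) k" unfolding MRV_def by blast

  have part_a: "\<exists>\<epsilon> :: nat \<Rightarrow> real \<Rightarrow> real.
      (\<forall>i\<in>?I. (\<epsilon> i \<longlongrightarrow> 0) at_top) \<and>
      (\<forall>\<^sub>F t in at_top. p t = (\<Sum>i\<in>?I. measure M {\<omega> \<in> space M. t < ord_stat i (Z \<omega>)} * (enn2real (E i) + \<epsilon> i t)))"
  proof (intro exI[of _ err] conjI ballI)
    show "\<forall>\<^sub>F t in at_top. p t = (\<Sum>i\<in>?I. measure M {\<omega> \<in> space M. t < ord_stat i (Z \<omega>)} * (enn2real (E i) + err i t))"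
      using eventually_gt_at_top[of 0] by eventually_elim (simp add: expansion u_eq)
  qed (rule err)
  have "\<forall>i\<in>?I. E i < \<infinity>" using E_fin by blast
  moreover note part_a p_lim[unfolded u_eq[OF i0(1)]]
  moreover have "\<forall>B\<in>sets borel. B \<subseteq> EE k \<longrightarrow>
      emeasure (mu_bar M A \<mu> k) B = Eik M A k i0 (\<lambda>\<omega>. emeasure (\<mu> i0) (preimg (A \<omega>) B))"
    using mb_emeasure by blast
  moreover note MM1[unfolded u_eq[OF i0(1)]] mrv
  ultimately show ?thesis
    unfolding p_def E_def i0_def by (intro conjI)
qed

end
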